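(* Assume that $V\in\mathcal C^1$. Consider the numerical discretization of the stochastic Hamiltonian system with additive noise $$dq(t)=p(t)\,dt,\qquad dp(t)=-V'(q(t))\,dt+\Sigma\,dW(t),\qquad (p(0),q(0))=(p_0,q_0),$$ by the drift-preserving numerical scheme $$\Psi_{n+1}=p_n+\Sigma\Delta W_n-\frac h2\int_0^1V'(q_n+sh\Psi_{n+1})\,ds,\quad q_{n+1}=q_n+h\Psi_{n+1},\quad p_{n+1}=p_n+\Sigma\Delta W_n-h\int_0^1V'(q_n+sh\Psi_{n+1})\,ds.$$ (i) The single level Monte Carlo error satisfies $$\left\|\mathbb E[H(p(t_n),q(t_n))]-E_M[H(p_n,q_n)]\right\|_{L^2(\Omega)}=M^{-1/2}\,\mathsf{Var}[H(p_n,q_n)]^{1/2}\le M^{-1/2}\,\|H(p_n,q_n)\|_{L^2(\Omega)}$$ for all $t_n=nh$. (ii) Assume in addition that $V'$ is globally Lipschitz continuous, and let $f\colon\mathbb R^{2m}\to\mathbb R$ be a differentiable test function with $f'$ of polynomial growth. Then on any finite time interval $[0,T]$ there exist $C>0$ and $h^*>0$ such that for all $0<h\le h^*$ and corresponding $n=1,\dots,N$ with $hN=T$, $$\left\|\mathbb E[f(p(t_n),q(t_n))]-E_M[f(p_n,q_n)]\right\|_{L^2(\Omega)}\le Ch+M^{-1/2}\,\mathsf{Var}[f(p(t_n),q(t_n))]^{1/2}\le Ch+M^{-1/2}\,\|f(p(t_n),q(t_n))\|_{L^2(\Omega)},$$ with computational work for balanced error contributions $$\mathcal W=h^{-1}\cdot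 M=h^{-3}.$$
   Context: Let $m,d$ be positive integers, $(\Omega,\mathcal F,\mathbb P)$ a probability space with a normal filtration $(\mathcal F_t)$, and $W$ a standard $\mathbb R^d$-valued $(\mathcal F_t)$-Brownian motion with continuous sample paths. For a potential $V\colon\mathbb R^m\to\mathbb R$ with gradient $V'$, the separable Hamiltonian is $H(p,q)=\frac12\sum_{j=1}^m p_j^2+V(q)$. The matrix $\Sigma\in\mathbb R^{m\times d}$ is constant. The initial values have finite expected energy, $\mathbb E[H(p_0,q_0)]<+\infty$. Here $h>0$ is the step size of the scheme, taken sufficiently small for the implicit scheme to be solvable; the scheme starts from $(p_0,q_0)$, and $\Delta W_n=W(t_{n+1})-W(t_n)$ are the Wiener increments. For a real random variable $Y$, $\|Y\|_{L^2(\Omega)}=\mathbb E[|Y|^2]^{1/2}$, and $E_M[Y]=M^{-1}\sum_{i=1}^M\hat Y^i$ is the Monte Carlo estimator of $Y$ based on $M$ independent, identically distributed random variables $\hat Y^i$ (samples of $Y$). Balanced error contributions means that $M^{-1/2}$ is of the size of $h$, i.e. $M=h^{-2}$; the work is the cost $h^{-1}$ of one sample path times the number of samples.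
   Formalization: In (i), V is bounded below, or E∫_0^t|p|²ds is finite for all t and every H(p_n,q_n) is integrable; in (ii), the initial values have a finite moment of order 2κ+2, where |f'(x)| ≤ K(1+|x|^κ). Without such conditions the expectations may not exist. *)

theory Defs
  imports "HOL-Probability.Probability"
begin

text \<open>A filtration indexed by times \<open>t \<ge> 0\<close>; values at negative indices are irrelevant. Normal means
  right-continuous, with all null sets of the ambient sigma-algebra already in \<open>F 0\<close>.\<close>

definition normal_filtration :: "'a measure \<Rightarrow> (real \<Rightarrow> 'a measure) \<Rightarrow> bool" where
  "normal_filtration Om F \<longleftrightarrow>
     (\<forall>t\<ge>0. subalgebra Om (F t)) \<and>
     (\<forall>s t. 0 \<le> s \<longrightarrow> s \<le> t \<longrightarrow> sets (F s) \<subseteq> sets (F t)) \<and>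
     (\<forall>t\<ge>0. sets (F t) = (\<Inter>s\<in>{t<..}. sets (F s))) \<and>
     null_sets Om \<subseteq> sets (F 0)"

definition brownian_motion ::
  "'a measure \<Rightarrow> (real \<Rightarrow> 'a measure) \<Rightarrow> (real \<Rightarrow> 'a \<Rightarrow> real^'d) \<Rightarrow> bool" where
  "brownian_motion Om F W \<longleftrightarrow>
     (\<forall>t\<ge>0. W t \<in> borel_measurable (F t)) \<and>
     (\<forall>\<omega>\<in>space Om. continuous_on {0..} (\<lambda>t. W t \<omega>)) \<and>
     (AE \<omega> in Om. W 0 \<omega> = 0) \<and>
     (\<forall>s t. 0 \<le> s \<longrightarrow> s < t \<longrightarrow>
        (\<forall>j. distributed Om lborel (\<lambda>\<omega>. (W t \<omega> - W s \<omega>) $ j)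
               (\<lambda>x. ennreal (normal_density 0 (sqrt (t - s)) x))) \<and>
        prob_space.indep_vars Om (\<lambda>_. borel) (\<lambda>j \<omega>. (W t \<omega> - W s \<omega>) $ j) UNIV \<and>
        prob_space.indep_set Om (sets (F s))
          {(\<lambda>\<omega>. W t \<omega> - W s \<omega>) -` A \<inter> space Om |A. A \<in> sets borel})"

definition hamiltonian :: "(real^'m \<Rightarrow> real) \<Rightarrow> real^'m \<Rightarrow> real^'m \<Rightarrow> real" where
  "hamiltonian V p q = 1/2 * (\<Sum>j\<in>UNIV. (p $ j)\<^sup>2) + V q"

text \<open>Strong solutions on \<open>[0,\<infinity>)\<close>, in integral form. As the noise is additive and \<open>\<Sigma>\<close> is constant,
  the stochastic integral of \<open>\<Sigma>\<close> over \<open>[0,t]\<close> is \<open>\<Sigma> *v W t\<close>.\<close>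

definition sde_solution ::
  "'a measure \<Rightarrow> (real \<Rightarrow> 'a measure) \<Rightarrow> (real \<Rightarrow> 'a \<Rightarrow> real^'d) \<Rightarrow> (real^'m \<Rightarrow> real^'m) \<Rightarrow> real^'d^'m
    \<Rightarrow> ('a \<Rightarrow> real^'m) \<Rightarrow> ('a \<Rightarrow> real^'m) \<Rightarrow> (real \<Rightarrow> 'a \<Rightarrow> real^'m) \<Rightarrow> (real \<Rightarrow> 'a \<Rightarrow> real^'m) \<Rightarrow> bool" where
  "sde_solution Om F W V' \<Sigma> p0 q0 p q \<longleftrightarrow>
     (\<forall>t\<ge>0. p t \<in> borel_measurable (F t) \<and> q t \<in> borel_measurable (F t)) \<and>
     (AE \<omega> in Om.
        continuous_on {0..} (\<lambda>t. p t \<omega>) \<and> continuous_on {0..} (\<lambda>t. q t \<omega>) \<and>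
        (\<forall>t\<ge>0. q t \<omega> = q0 \<omega> + integral {0..t} (\<lambda>s. p s \<omega>) \<and>
               p t \<omega> = p0 \<omega> - integral {0..t} (\<lambda>s. V' (q s \<omega>)) + \<Sigma> *v W t \<omega>))"

text \<open>The scheme with step size \<open>h\<close> on the grid \<open>t\<^sub>n = n h\<close>. It is implicit in \<open>\<Psi>\<close>, so adaptedness has
  to be required: a solution of the implicit equation need not be unique in general.\<close>

definition drift_preserving_scheme ::
  "'a measure \<Rightarrow> (real \<Rightarrow> 'a measure) \<Rightarrow> (real \<Rightarrow> 'a \<Rightarrow> real^'d) \<Rightarrow> (real^'m \<Rightarrow> real^'m) \<Rightarrow> real^'d^'m
    \<Rightarrow> ('a \<Rightarrow> real^'m) \<Rightarrow> ('a \<Rightarrow> real^'m) \<Rightarrow> real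
    \<Rightarrow> (nat \<Rightarrow> 'a \<Rightarrow> real^'m) \<Rightarrow> (nat \<Rightarrow> 'a \<Rightarrow> real^'m) \<Rightarrow> bool" where
  "drift_preserving_scheme Om F W V' \<Sigma> p0 q0 h P Q \<longleftrightarrow>
     (\<forall>n. P n \<in> borel_measurable (F (real n * h)) \<and> Q n \<in> borel_measurable (F (real n * h))) \<and>
     (AE \<omega> in Om. P 0 \<omega> = p0 \<omega> \<and> Q 0 \<omega> = q0 \<omega> \<and>
       (\<forall>n. \<exists>\<Psi>. let \<Delta>W = W (real (Suc n) * h) \<omega> - W (real n * h) \<omega>;
                     G = integral {0..1} (\<lambda>s. V' (Q n \<omega> + (s * h) *\<^sub>R \<Psi>))
         in \<Psi> = P n \<omega> + \<Sigma> *v \<Delta>W - (h / 2) *\<^sub>R G \<and>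
            Q (Suc n) \<omega> = Q n \<omega> + h *\<^sub>R \<Psi> \<and>
            P (Suc n) \<omega> = P n \<omega> + \<Sigma> *v \<Delta>W - h *\<^sub>R G))"

text \<open>Norms and variances take the value \<open>\<infinity>\<close> for random variables that are not square-integrable;
  the Bochner integral would return 0 there.\<close>

definition ennreal_sqrt :: "ennreal \<Rightarrow> ennreal" where
  "ennreal_sqrt x = (if x = \<infinity> then \<infinity> else ennreal (sqrt (enn2real x)))"

definition l2norm :: "'a measure \<Rightarrow> ('a \<Rightarrow> real) \<Rightarrow> ennreal" where
  "l2norm Om Y = ennreal_sqrt (\<integral>\<^sup>+\<omega>. ennreal (\<bar>Y \<omega>\<bar>\<^sup>2) \<partial>Om)"

definition var :: "'a measure \<Rightarrow> ('a \<Rightarrow> real) \<Rightarrow> ennreal" where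
  "var Om Y = (\<integral>\<^sup>+\<omega>. ennreal ((Y \<omega> - (\<integral>\<omega>'. Y \<omega>' \<partial>Om))\<^sup>2) \<partial>Om)"

text \<open>Independent samples \<open>Yhat 1, ..., Yhat M\<close>, each with the law of \<open>Y\<close>.\<close>

definition iid_samples :: "'a measure \<Rightarrow> nat \<Rightarrow> ('a \<Rightarrow> real) \<Rightarrow> (nat \<Rightarrow> 'a \<Rightarrow> real) \<Rightarrow> bool" where
  "iid_samples Om M Y Yhat \<longleftrightarrow>
     prob_space.indep_vars Om (\<lambda>_. borel) Yhat {1..M} \<and>
     (\<forall>i\<in>{1..M}. distr Om borel (Yhat i) = distr Om borel Y)"

definition mc_estimator :: "nat \<Rightarrow> (nat \<Rightarrow> 'a \<Rightarrow> real) \<Rightarrow> 'a \<Rightarrow> real" where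
  "mc_estimator M Yhat \<omega> = inverse (real M) * (\<Sum>i=1..M. Yhat i \<omega>)"

text \<open>The number of samples enters the work as a real number, since \<open>1 / h^2\<close> is in general not an integer.\<close>

definition path_cost :: "real \<Rightarrow> real" where
  "path_cost h = h powi (-1)"

definition mc_work :: "real \<Rightarrow> real \<Rightarrow> real" where
  "mc_work h M = path_cost h * M"

definition balanced_samples :: "real \<Rightarrow> real" where
  "balanced_samples h = h powi (-2)"

end

theory Submission
  imports Defs
begin

text \<open>Along the scheme the averaged force is a discrete gradient of \<open>V\<close>, so a step changes the energy exactly by
  \<open>P\<^sub>n \<bullet> \<xi> + |\<xi>|\<^sup>2/2\<close>, where \<open>\<xi>\<close> is the noise increment, and the mean energy grows linearly. The exact solution satisfies
  the same identity on every grid up to a residual that vanishes pathwise with the mesh, because \<open>q\<close> is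
  continuously differentiable; the noise sums are bounded in \<open>L\<^sup>2\<close>, so the expectations converge and the mean energies
  coincide. The estimator of the energy is therefore unbiased and its error is a pure variance, finite or not.

  For a Lipschitz force, a discrete Gronwall argument bounds the pathwise error of the scheme by the sums of
  \<open>\<integral> (W t\<^sub>j\<^sub>+\<^sub>1 - W s) ds\<close> over the cells of the grid, plus \<open>h\<close> times a variable with enough moments. Such a sum is a limit
  of weighted sums of independent Gaussian increments with weights at most \<open>h\<close>, hence of size \<open>h\<close> in every \<open>L\<^sup>r\<close>, which
  yields order one for bias and standard deviation of test functions of polynomial growth.\<close>

subsection \<open>Monte Carlo estimators\<close>

text \<open>The stochastic integral of \<open>p\<close> never appears: finite sums over grids
  replace it, so that only the laws and the independence of Brownian increments enter. Three
  obstacles shape part (i). The sums need an L2 bound uniform in the mesh, while the second moment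
  of \<open>p\<close> is at best controlled after integration in time; the grid is therefore shifted
  to a favourable offset. If \<open>V\<close> is merely bounded below, even this control has to be
  won first, from a saturated energy. And the initial energy is only integrable, so the variance may
  be infinite: norms live in the extended reals, and only energy differences are treated in L2. In
  part (ii) every cell contributes a noise error of size h powr (3/2) to the position. Adding norms
  cell by cell would leave order one half, so the signed errors are kept together as one Gaussian
  sum and compensated before Gronwall. Suprema of Brownian paths are avoided in favour of time
  integrals and grid values of the norm.\<close>

lemma ennreal_sqrt_mono: "x \<le> y \<Longrightarrow> ennreal_sqrt x \<le> ennreal_sqrt y"
  by (cases x; cases y) (auto simp: ennreal_sqrt_def top_unique)

lemma ennreal_sqrt_mult: "0 < c \<Longrightarrow> ennreal_sqrt (ennreal c * x) = ennreal (sqrt c) * ennreal_sqrt x"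
  by (cases x)
    (auto simp: ennreal_sqrt_def ennreal_mult_top real_sqrt_mult ennreal_mult[symmetric])

lemma ennreal_sqrt_power2: "(ennreal_sqrt x)\<^sup>2 = x"
  by (cases x) (auto simp: ennreal_sqrt_def ennreal_power)

lemma ennreal_power2_le_imp_le:
  assumes "x\<^sup>2 \<le> (y::ennreal)\<^sup>2" shows "x \<le> y"
  using assms by (cases x; cases y) (auto simp: ennreal_power power2_le_iff_abs_le top_unique)

lemma l2norm_le_iff: "l2norm M X \<le> c \<longleftrightarrow> (\<integral>\<^sup>+\<omega>. ennreal ((X \<omega>)\<^sup>2) \<partial>M) \<le> c\<^sup>2"
proof -
  have "l2norm M X \<le> c \<longleftrightarrow> (l2norm M X)\<^sup>2 \<le> c\<^sup>2"
    using ennreal_power2_le_imp_le power_mono[of "l2norm M X" c 2] by auto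
  then show ?thesis by (simp add: l2norm_def ennreal_sqrt_power2)
qed

lemma l2norm_power2: "(l2norm M X)\<^sup>2 = (\<integral>\<^sup>+\<omega>. ennreal ((X \<omega>)\<^sup>2) \<partial>M)"
  by (simp add: l2norm_def ennreal_sqrt_power2)

text \<open>Expanding the square leaves a cross term that Cauchy-Schwarz for nonnegative integrals
  bounds by the product of the norms. The argument stays in the extended reals, so infinite norms
  are covered.\<close>

lemma l2norm_triangle:
  assumes [measurable]: "X \<in> borel_measurable M" "Y \<in> borel_measurable M"
  shows "l2norm M (\<lambda>\<omega>. X \<omega> + Y \<omega>) \<le> l2norm M X + l2norm M Y"
proof -
  have cs: "(\<integral>\<^sup>+\<omega>. ennreal \<bar>X \<omega>\<bar> * ennreal \<bar>Y \<omega>\<bar> \<partial>M) \<le> l2norm M X * l2norm M Y"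
  proof (rule ennreal_power2_le_imp_le)
    have "(\<integral>\<^sup>+\<omega>. ennreal \<bar>X \<omega>\<bar> * ennreal \<bar>Y \<omega>\<bar> \<partial>M)\<^sup>2
      \<le> (\<integral>\<^sup>+\<omega>. (ennreal \<bar>X \<omega>\<bar>)\<^sup>2 \<partial>M) * (\<integral>\<^sup>+\<omega>. (ennreal \<bar>Y \<omega>\<bar>)\<^sup>2 \<partial>M)"
      by (rule Cauchy_Schwarz_nn_integral) auto
    then show "(\<integral>\<^sup>+\<omega>. ennreal \<bar>X \<omega>\<bar> * ennreal \<bar>Y \<omega>\<bar> \<partial>M)\<^sup>2 \<le> (l2norm M X * l2norm M Y)\<^sup>2"
      by (simp only: power_mult_distrib l2norm_power2 ennreal_power abs_ge_zero power2_abs)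
  qed
  have "(\<integral>\<^sup>+\<omega>. ennreal ((X \<omega> + Y \<omega>)\<^sup>2) \<partial>M)
     \<le> (\<integral>\<^sup>+\<omega>. ennreal ((X \<omega>)\<^sup>2) + 2 * (ennreal \<bar>X \<omega>\<bar> * ennreal \<bar>Y \<omega>\<bar>) + ennreal ((Y \<omega>)\<^sup>2) \<partial>M)"
  proof (intro nn_integral_mono)
    fix \<omega>
    have "(X \<omega> + Y \<omega>)\<^sup>2 \<le> (X \<omega>)\<^sup>2 + 2 * (\<bar>X \<omega>\<bar> * \<bar>Y \<omega>\<bar>) + (Y \<omega>)\<^sup>2"
      using abs_ge_self[of "X \<omega> * Y \<omega>"] by (simp add: power2_sum abs_mult)
    then show "ennreal ((X \<omega> + Y \<omega>)\<^sup>2)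
      \<le> ennreal ((X \<omega>)\<^sup>2) + 2 * (ennreal \<bar>X \<omega>\<bar> * ennreal \<bar>Y \<omega>\<bar>) + ennreal ((Y \<omega>)\<^sup>2)"
      by (simp add: ennreal_mult[symmetric] ennreal_plus[symmetric] ennreal_numeral[symmetric]
          del: ennreal_plus ennreal_numeral)
  qed
  also have "\<dots> = (l2norm M X)\<^sup>2 + 2 * (\<integral>\<^sup>+\<omega>. ennreal \<bar>X \<omega>\<bar> * ennreal \<bar>Y \<omega>\<bar> \<partial>M) + (l2norm M Y)\<^sup>2"
    by (simp add: nn_integral_add nn_integral_cmult l2norm_power2)
  also have "\<dots> \<le> (l2norm M X)\<^sup>2 + 2 * (l2norm M X * l2norm M Y) + (l2norm M Y)\<^sup>2"
    by (intro add_mono mult_left_mono cs) auto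
  also have "\<dots> = (l2norm M X + l2norm M Y)\<^sup>2"
    by (simp add: power2_sum ac_simps)
  finally show ?thesis by (simp add: l2norm_le_iff)
qed

lemma (in prob_space) square_nn_finite_imp_integrable:
  fixes X :: "'a \<Rightarrow> real"
  assumes [measurable]: "X \<in> borel_measurable M" and "(\<integral>\<^sup>+\<omega>. ennreal ((X \<omega>)\<^sup>2) \<partial>M) < \<infinity>"
  shows "integrable M (\<lambda>\<omega>. (X \<omega>)\<^sup>2)" "integrable M X"
proof -
  show "integrable M (\<lambda>\<omega>. (X \<omega>)\<^sup>2)"
    using assms(2) by (intro integrableI_bounded) auto
  then show "integrable M X" by (rule square_integrable_imp_integrable[OF assms(1)])
qed

text \<open>The bias-variance identity. For a finite second moment the cross term has mean zero;
  otherwise both sides are infinite, because a constant shift cannot make a second moment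
  finite.\<close>

lemma (in prob_space) nn_integral_square_shift:
  fixes X :: "'a \<Rightarrow> real"
  assumes X: "integrable M X" and mean: "expectation X = 0"
  shows "(\<integral>\<^sup>+\<omega>. ennreal ((X \<omega> + s)\<^sup>2) \<partial>M) = (\<integral>\<^sup>+\<omega>. ennreal ((X \<omega>)\<^sup>2) \<partial>M) + ennreal (s\<^sup>2)"
proof (cases "(\<integral>\<^sup>+\<omega>. ennreal ((X \<omega>)\<^sup>2) \<partial>M) < \<infinity>")
  case True
  have [measurable]: "X \<in> borel_measurable M" using X by auto
  note sq = square_nn_finite_imp_integrable(1)[OF _ True, simplified]
  have "(\<integral>\<^sup>+\<omega>. ennreal ((X \<omega> + s)\<^sup>2) \<partial>M) = ennreal (expectation (\<lambda>\<omega>. (X \<omega> + s)\<^sup>2))"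
    using sq X by (intro nn_integral_eq_integral)
      (simp add: power2_sum, simp)
  also have "expectation (\<lambda>\<omega>. (X \<omega> + s)\<^sup>2) = expectation (\<lambda>\<omega>. (X \<omega>)\<^sup>2) + s\<^sup>2"
    using sq X mean by (simp add: power2_sum prob_space)
  finally show ?thesis
    using sq by (simp add: nn_integral_eq_integral[OF sq] ennreal_plus[symmetric] del: ennreal_plus)
next
  case False
  have [measurable]: "X \<in> borel_measurable M" using X by auto
  have "(\<integral>\<^sup>+\<omega>. ennreal ((X \<omega>)\<^sup>2) \<partial>M) \<le> (\<integral>\<^sup>+\<omega>. 2 * ennreal ((X \<omega> + s)\<^sup>2) + 2 * ennreal (s\<^sup>2) \<partial>M)"
  proof (intro nn_integral_mono)
    fix \<omega>
    have "(X \<omega>)\<^sup>2 \<le> 2 * (X \<omega> + s)\<^sup>2 + 2 * s\<^sup>2"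
      using zero_le_power2[of "X \<omega> + 2 * s"] by (simp add: power2_eq_square algebra_simps)
    then show "ennreal ((X \<omega>)\<^sup>2) \<le> 2 * ennreal ((X \<omega> + s)\<^sup>2) + 2 * ennreal (s\<^sup>2)"
      by (simp add: ennreal_mult[symmetric] ennreal_plus[symmetric] ennreal_numeral[symmetric]
          del: ennreal_plus ennreal_numeral)
  qed
  also have "\<dots> = 2 * (\<integral>\<^sup>+\<omega>. ennreal ((X \<omega> + s)\<^sup>2) \<partial>M) + 2 * ennreal (s\<^sup>2)"
    by (simp add: nn_integral_add nn_integral_cmult emeasure_space_1)
  finally have "(\<integral>\<^sup>+\<omega>. ennreal ((X \<omega> + s)\<^sup>2) \<partial>M) = \<infinity>"
    using False by (cases "\<integral>\<^sup>+\<omega>. ennreal ((X \<omega> + s)\<^sup>2) \<partial>M")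
      (auto simp: top.not_eq_extremum[symmetric] top_unique ennreal_mult[symmetric] ennreal_plus[symmetric]
        ennreal_numeral[symmetric] simp del: ennreal_plus ennreal_numeral)
  moreover have "(\<integral>\<^sup>+\<omega>. ennreal ((X \<omega>)\<^sup>2) \<partial>M) = \<infinity>" using False by (auto simp: top.not_eq_extremum[symmetric])
  ultimately show ?thesis by simp
qed

text \<open>Fubini on the product law reduces the claim to \<open>nn_integral_square_shift\<close>
  at each fixed value of \<open>S\<close>. This avoids the expectation of \<open>X * S\<close>,
  which need not exist when \<open>S\<close> has no moments.\<close>

lemma (in prob_space) nn_integral_indep_square_add:
  fixes X S :: "'a \<Rightarrow> real"
  assumes ind: "indep_var borel X borel S"
    and X: "integrable M X" and mean: "expectation X = 0"
  shows "(\<integral>\<^sup>+\<omega>. ennreal ((X \<omega> + S \<omega>)\<^sup>2) \<partial>M)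
    = (\<integral>\<^sup>+\<omega>. ennreal ((X \<omega>)\<^sup>2) \<partial>M) + (\<integral>\<^sup>+\<omega>. ennreal ((S \<omega>)\<^sup>2) \<partial>M)"
proof -
  have [measurable]: "X \<in> borel_measurable M" "S \<in> borel_measurable M"
    using indep_var_rv1[OF ind] indep_var_rv2[OF ind] by auto
  interpret X: prob_space "distr M borel X" by (rule prob_space_distr) simp
  interpret S: prob_space "distr M borel S" by (rule prob_space_distr) simp
  interpret P: pair_sigma_finite "distr M borel X" "distr M borel S" ..
  have eq: "distr M borel X \<Otimes>\<^sub>M distr M borel S = distr M (borel \<Otimes>\<^sub>M borel) (\<lambda>\<omega>. (X \<omega>, S \<omega>))"
    using ind by (simp add: indep_var_distribution_eq)
  have "(\<integral>\<^sup>+\<omega>. ennreal ((X \<omega> + S \<omega>)\<^sup>2) \<partial>M)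
      = (\<integral>\<^sup>+z. ennreal ((fst z + snd z)\<^sup>2) \<partial>(distr M borel X \<Otimes>\<^sub>M distr M borel S))"
    unfolding eq by (subst nn_integral_distr) auto
  also have "\<dots> = (\<integral>\<^sup>+s. \<integral>\<^sup>+x. ennreal ((x + s)\<^sup>2) \<partial>distr M borel X \<partial>distr M borel S)"
    by (subst P.nn_integral_snd[symmetric]) auto
  also have "\<dots> = (\<integral>\<^sup>+s. (\<integral>\<^sup>+x. ennreal (x\<^sup>2) \<partial>distr M borel X) + ennreal (s\<^sup>2) \<partial>distr M borel S)"
    using X mean by (subst X.nn_integral_square_shift) (auto simp: integrable_distr_eq integral_distr)
  also have "\<dots> = (\<integral>\<^sup>+\<omega>. ennreal ((X \<omega>)\<^sup>2) \<partial>M) + (\<integral>\<^sup>+\<omega>. ennreal ((S \<omega>)\<^sup>2) \<partial>M)"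
    using S.emeasure_space_1 by (subst nn_integral_add) (auto simp: nn_integral_distr)
  finally show ?thesis .
qed

lemma (in prob_space) nn_integral_square_sum_indep:
  fixes D :: "nat \<Rightarrow> 'a \<Rightarrow> real"
  assumes "finite I" "indep_vars (\<lambda>_. borel) D I"
    and "\<And>i. i \<in> I \<Longrightarrow> integrable M (D i)" "\<And>i. i \<in> I \<Longrightarrow> expectation (D i) = 0"
  shows "(\<integral>\<^sup>+\<omega>. ennreal ((\<Sum>i\<in>I. D i \<omega>)\<^sup>2) \<partial>M) = (\<Sum>i\<in>I. \<integral>\<^sup>+\<omega>. ennreal ((D i \<omega>)\<^sup>2) \<partial>M)"
  using assms
proof (induction I)
  case (insert i I)
  then have "indep_var borel (D i) borel (\<lambda>\<omega>. \<Sum>i\<in>I. D i \<omega>)"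
    by (intro indep_vars_sum) auto
  from nn_integral_indep_square_add[OF this] insert show ?case
    by (simp add: indep_vars_subset[of _ _ "insert i I" I] subset_insertI)
qed simp

lemma (in prob_space) iid_samplesD:
  assumes Y: "Y \<in> borel_measurable M" and iid: "iid_samples M m Y Yhat" and i: "i \<in> {1..m}"
  shows "Yhat i \<in> borel_measurable M"
    and "g \<in> borel_measurable borel \<Longrightarrow> (\<integral>\<^sup>+\<omega>. g (Yhat i \<omega>) \<partial>M) = (\<integral>\<^sup>+\<omega>. g (Y \<omega>) \<partial>M)"
    and "integrable M Y \<Longrightarrow> integrable M (Yhat i)"
    and "expectation (Yhat i) = expectation Y"
proof -
  show [measurable]: "Yhat i \<in> borel_measurable M"
    using iid i by (auto simp: iid_samples_def indep_vars_def)
  note [measurable] = Y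
  have d: "distr M borel (Yhat i) = distr M borel Y" using iid i by (auto simp: iid_samples_def)
  show "(\<integral>\<^sup>+\<omega>. g (Yhat i \<omega>) \<partial>M) = (\<integral>\<^sup>+\<omega>. g (Y \<omega>) \<partial>M)" if [measurable]: "g \<in> borel_measurable borel"
    using arg_cong[OF d, of "\<lambda>D. nn_integral D g"] by (simp add: nn_integral_distr)
  show "integrable M Y \<Longrightarrow> integrable M (Yhat i)"
    using arg_cong[OF d, of "\<lambda>D. integrable D (\<lambda>x. x)"] by (simp add: integrable_distr_eq)
  show "expectation (Yhat i) = expectation Y"
    using arg_cong[OF d, of "\<lambda>D. integral\<^sup>L D (\<lambda>x. x)"] by (simp add: integral_distr)
qed

text \<open>The centred samples are independent with mean zero, so their second moments add up to
  \<open>m\<close> times the variance, against a prefactor \<open>1 / m^2\<close>. As the addition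
  rule holds for infinite second moments too, \<open>Y\<close> may have infinite variance.\<close>

lemma (in prob_space) mc_estimator_l2_error:
  assumes m: "m \<ge> 1" and Y: "integrable M Y" and iid: "iid_samples M m Y Yhat"
  shows "l2norm M (\<lambda>\<omega>. expectation Y - mc_estimator m Yhat \<omega>)
    = ennreal (real m powr (-1/2)) * ennreal_sqrt (var M Y)"
proof -
  have [measurable]: "Y \<in> borel_measurable M" using Y by auto
  note D = iid_samplesD[OF \<open>Y \<in> borel_measurable M\<close> iid]
  define \<mu> where "\<mu> = expectation Y"
  define Z where "Z i \<omega> = Yhat i \<omega> - \<mu>" for i \<omega>
  have ind: "indep_vars (\<lambda>_. borel) Z {1..m}"
    unfolding Z_def using iid
    by (intro indep_vars_compose2[where X=Yhat and M'="\<lambda>_. borel" and Y="\<lambda>_ y. y - \<mu>"]) (auto simp: iid_samples_def)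
  have sq: "(\<integral>\<^sup>+\<omega>. ennreal ((Z i \<omega>)\<^sup>2) \<partial>M) = var M Y" if "i \<in> {1..m}" for i
    unfolding Z_def var_def \<mu>_def using that by (intro D(2)[of i "\<lambda>y. ennreal ((y - expectation Y)\<^sup>2)"]) auto
  have *: "expectation Y - mc_estimator m Yhat \<omega> = - (inverse (real m) * (\<Sum>i=1..m. Z i \<omega>))" for \<omega>
    using m by (simp add: mc_estimator_def Z_def sum_subtractf \<mu>_def algebra_simps)
  have [measurable]: "\<And>i. i \<in> {1..m} \<Longrightarrow> Z i \<in> borel_measurable M"
    using D(1) by (auto simp: Z_def[abs_def])
  have "(\<integral>\<^sup>+\<omega>. ennreal (\<bar>expectation Y - mc_estimator m Yhat \<omega>\<bar>\<^sup>2) \<partial>M)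
     = (\<integral>\<^sup>+\<omega>. ennreal ((inverse (real m))\<^sup>2) * ennreal ((\<Sum>i=1..m. Z i \<omega>)\<^sup>2) \<partial>M)"
    unfolding * by (simp add: power_mult_distrib ennreal_mult)
  also have "\<dots> = ennreal ((inverse (real m))\<^sup>2) * (\<Sum>i=1..m. \<integral>\<^sup>+\<omega>. ennreal ((Z i \<omega>)\<^sup>2) \<partial>M)"
    using D(3,4) Y by (subst nn_integral_cmult, measurable)
      (subst nn_integral_square_sum_indep[OF _ ind], auto simp: Z_def[abs_def] \<mu>_def prob_space)
  also have "(\<Sum>i=1..m. \<integral>\<^sup>+\<omega>. ennreal ((Z i \<omega>)\<^sup>2) \<partial>M) = ennreal (real m) * var M Y"
    by (simp add: sq ennreal_of_nat_eq_real_of_nat)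
  also have "ennreal ((inverse (real m))\<^sup>2) * (ennreal (real m) * var M Y) = ennreal (inverse (real m)) * var M Y"
    using m by (simp add: mult.assoc[symmetric] ennreal_mult[symmetric] power2_eq_square field_simps)
  finally have "l2norm M (\<lambda>\<omega>. expectation Y - mc_estimator m Yhat \<omega>)
      = ennreal (sqrt (inverse (real m))) * ennreal_sqrt (var M Y)"
    using m by (simp only: l2norm_def) (simp add: ennreal_sqrt_mult)
  moreover have "sqrt (inverse (real m)) = real m powr - (1/2)"
    using m by (simp only: powr_minus powr_half_sqrt real_sqrt_inverse of_nat_0_le_iff)
  ultimately show ?thesis by simp
qed

lemma (in prob_space) var_le_second_moment:
  assumes [measurable]: "Y \<in> borel_measurable M"
  shows "ennreal_sqrt (var M Y) \<le> l2norm M Y"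
proof (cases "integrable M Y")
  case True
  have "(\<integral>\<^sup>+\<omega>. ennreal ((Y \<omega> - expectation Y + expectation Y)\<^sup>2) \<partial>M)
      = (\<integral>\<^sup>+\<omega>. ennreal ((Y \<omega> - expectation Y)\<^sup>2) \<partial>M) + ennreal ((expectation Y)\<^sup>2)"
    using True by (intro nn_integral_square_shift) (auto simp: prob_space)
  then show ?thesis
    unfolding l2norm_def by (intro ennreal_sqrt_mono) (simp add: var_def)
next
  \<comment> \<open>Without integrability the Bochner expectation is 0 by convention, so
    \<open>var\<close> is the second moment itself.\<close>
  case False
  then show ?thesis
    unfolding l2norm_def var_def by (simp add: not_integrable_integral_eq)
qed

lemma sd_eq_l2norm: "ennreal_sqrt (var M Y) = l2norm M (\<lambda>\<omega>. Y \<omega> - (\<integral>\<omega>'. Y \<omega>' \<partial>M))"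
  by (simp add: var_def l2norm_def)

text \<open>\<open>X\<close> is the exact quantity, \<open>Y\<close> the approximation that is
  sampled, \<open>D\<close> a bound on their L2 distance. \<open>D\<close> is paid twice: once for
  the bias of the means and once for replacing the standard deviation of \<open>Y\<close> by that of
  \<open>X\<close>, the latter with a prefactor bounded by 1.\<close>

lemma (in prob_space) mc_estimator_biased_l2_error:
  assumes m: "m \<ge> 1" and iid: "iid_samples M m Y Yhat"
    and [measurable]: "Y \<in> borel_measurable M" "X \<in> borel_measurable M"
    and X: "(\<integral>\<^sup>+\<omega>. ennreal ((X \<omega>)\<^sup>2) \<partial>M) < \<infinity>"
    and D: "0 \<le> D" "(\<integral>\<^sup>+\<omega>. ennreal ((Y \<omega> - X \<omega>)\<^sup>2) \<partial>M) \<le> ennreal (D\<^sup>2)"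
  shows "l2norm M (\<lambda>\<omega>. expectation X - mc_estimator m Yhat \<omega>)
    \<le> ennreal (2 * D) + ennreal (real m powr (-1/2)) * ennreal_sqrt (var M X)"
proof -
  let ?c = "ennreal (real m powr (-1/2))"
  have Zl: "l2norm M (\<lambda>\<omega>. Y \<omega> - X \<omega>) \<le> ennreal D"
    using D by (simp add: l2norm_le_iff ennreal_power)
  have iX: "integrable M X" by (rule square_nn_finite_imp_integrable) (use X in auto)
  have iZ: "integrable M (\<lambda>\<omega>. Y \<omega> - X \<omega>)"
    by (rule square_nn_finite_imp_integrable) (use D in \<open>auto intro: le_less_trans\<close>)
  have iY: "integrable M Y" using Bochner_Integration.integrable_add[OF iX iZ] by simp
  have eZ: "expectation (\<lambda>\<omega>. Y \<omega> - X \<omega>) = expectation Y - expectation X"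
    using iX iY by simp
  have [measurable]: "mc_estimator m Yhat \<in> borel_measurable M"
    unfolding mc_estimator_def[abs_def] using iid_samplesD(1)[OF _ iid] by auto
  \<comment> \<open>Jensen's inequality for the square, read off from the bias-variance identity for
    \<open>Y - X\<close>.\<close>
  have bias: "\<bar>expectation X - expectation Y\<bar> \<le> D"
  proof -
    have "(\<integral>\<^sup>+\<omega>. ennreal ((Y \<omega> - X \<omega> - expectation (\<lambda>\<omega>. Y \<omega> - X \<omega>) + expectation (\<lambda>\<omega>. Y \<omega> - X \<omega>))\<^sup>2) \<partial>M)
      = (\<integral>\<^sup>+\<omega>. ennreal ((Y \<omega> - X \<omega> - expectation (\<lambda>\<omega>. Y \<omega> - X \<omega>))\<^sup>2) \<partial>M) + ennreal ((expectation (\<lambda>\<omega>. Y \<omega> - X \<omega>))\<^sup>2)"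
      using iZ by (intro nn_integral_square_shift) (auto simp: prob_space iX iY)
    then have "ennreal ((expectation Y - expectation X)\<^sup>2) \<le> (\<integral>\<^sup>+\<omega>. ennreal ((Y \<omega> - X \<omega>)\<^sup>2) \<partial>M)"
      unfolding eZ diff_add_cancel by simp
    then have "ennreal ((expectation Y - expectation X)\<^sup>2) \<le> ennreal (D\<^sup>2)"
      using D(2) by (rule order_trans)
    then show ?thesis using D(1) by (simp add: power2_le_iff_abs_le abs_minus_commute)
  qed
  have "l2norm M (\<lambda>\<omega>. (expectation X - expectation Y) + (expectation Y - mc_estimator m Yhat \<omega>))
      \<le> l2norm M (\<lambda>\<omega>. expectation X - expectation Y)
      + l2norm M (\<lambda>\<omega>. expectation Y - mc_estimator m Yhat \<omega>)"
    by (rule l2norm_triangle) auto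
  then have 1: "l2norm M (\<lambda>\<omega>. expectation X - mc_estimator m Yhat \<omega>)
      \<le> l2norm M (\<lambda>\<omega>. expectation X - expectation Y) + ?c * ennreal_sqrt (var M Y)"
    by (simp add: mc_estimator_l2_error[OF m iY iid])
  have 2: "l2norm M (\<lambda>\<omega>. expectation X - expectation Y) \<le> ennreal D"
    using bias D(1) by (simp add: l2norm_le_iff emeasure_space_1 ennreal_power power2_le_iff_abs_le)
  have "l2norm M (\<lambda>\<omega>. (X \<omega> - expectation X) + ((Y \<omega> - X \<omega>) - expectation (\<lambda>\<omega>. Y \<omega> - X \<omega>)))
      \<le> l2norm M (\<lambda>\<omega>. X \<omega> - expectation X)
        + l2norm M (\<lambda>\<omega>. (Y \<omega> - X \<omega>) - expectation (\<lambda>\<omega>. Y \<omega> - X \<omega>))"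
    by (rule l2norm_triangle) auto
  then have "ennreal_sqrt (var M Y) \<le> ennreal_sqrt (var M X) + ennreal_sqrt (var M (\<lambda>\<omega>. Y \<omega> - X \<omega>))"
    unfolding sd_eq_l2norm eZ by simp
  also have "\<dots> \<le> ennreal_sqrt (var M X) + ennreal D"
    by (intro add_left_mono order_trans[OF var_le_second_moment Zl]) auto
  finally have "?c * ennreal_sqrt (var M Y) \<le> ?c * (ennreal_sqrt (var M X) + ennreal D)"
    by (rule mult_left_mono) simp
  also have "\<dots> \<le> ?c * ennreal_sqrt (var M X) + ennreal D"
  proof -
    have "real m powr (-1/2) \<le> 1"
      using m powr_mono[of "-1/2" 0 "real m"] by simp
    then have "?c * ennreal D \<le> 1 * ennreal D"
      by (intro mult_right_mono) (auto simp: ennreal_le_1)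
    then show ?thesis by (simp add: distrib_left add_left_mono)
  qed
  finally have 3: "?c * ennreal_sqrt (var M Y) \<le> ?c * ennreal_sqrt (var M X) + ennreal D" .
  have "ennreal (2 * D) = ennreal D + ennreal D"
    using D(1) by (simp only: mult_2 ennreal_plus)
  then show ?thesis
    using order_trans[OF 1 add_mono[OF 2 3]] by (simp only: ac_simps)
qed

subsection \<open>Riemann sums and limits of expectations\<close>

text \<open>Jensen's inequality for the r-th power after division by the total weight. Weights
  summing to at most \<open>c\<close> instead of 1 fit Riemann sums, where \<open>c\<close> is the
  length of the interval.\<close>

lemma power_sum_le_sum_power:
  fixes a :: "'i \<Rightarrow> real"
  assumes "finite I" "\<And>i. i \<in> I \<Longrightarrow> 0 \<le> a i" "\<And>i. i \<in> I \<Longrightarrow> 0 \<le> w i" "(\<Sum>i\<in>I. w i) \<le> c" and r: "r > 0"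
  shows "(\<Sum>i\<in>I. w i * a i) ^ r \<le> c ^ (r - 1) * (\<Sum>i\<in>I. w i * a i ^ r)"
proof (cases "(\<Sum>i\<in>I. w i) = 0")
  case True
  then have "\<forall>i\<in>I. w i = 0" using assms by (subst (asm) sum_nonneg_eq_0_iff) auto
  then show ?thesis using r by (simp add: zero_power)
next
  case False
  define s where "s = (\<Sum>i\<in>I. w i)"
  have s: "s > 0" using False assms(3) by (auto simp: s_def intro!: sum_nonneg order.not_eq_order_implies_strict)
  have cvx: "convex_on {0::real..} (\<lambda>x. x ^ r)"
    using convex_power_odd[of r] convex_on_subset[OF convex_power_even[of r]] by (cases "even r") auto
  have "(\<Sum>i\<in>I. (w i / s) *\<^sub>R a i) ^ r \<le> (\<Sum>i\<in>I. (w i / s) * a i ^ r)"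
    using assms s False by (intro convex_on_sum[OF _ _ cvx]) (auto simp: s_def sum_divide_distrib[symmetric])
  then have "((\<Sum>i\<in>I. w i * a i) / s) ^ r \<le> (\<Sum>i\<in>I. w i * a i ^ r) / s"
    by (simp add: sum_divide_distrib)
  then have "(\<Sum>i\<in>I. w i * a i) ^ r \<le> s ^ r * ((\<Sum>i\<in>I. w i * a i ^ r) / s)"
    using s by (simp add: power_divide divide_simps mult.commute)
  also have "\<dots> = s ^ (r - 1) * (\<Sum>i\<in>I. w i * a i ^ r)"
    using s r by (cases r) auto
  also have "\<dots> \<le> c ^ (r - 1) * (\<Sum>i\<in>I. w i * a i ^ r)"
    using assms s by (intro mult_right_mono power_mono sum_nonneg mult_nonneg_nonneg) (auto simp: s_def)
  finally show ?thesis .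
qed

lemma power_add_le:
  fixes a b :: real
  assumes "0 \<le> a" "0 \<le> b"
  shows "(a + b) ^ r \<le> 2 ^ r * (a ^ r + b ^ r)"
proof -
  have "(a + b) ^ r \<le> (2 * max a b) ^ r" using assms by (intro power_mono) auto
  also have "\<dots> = 2 ^ r * max a b ^ r" by (simp add: power_mult_distrib)
  also have "max a b ^ r \<le> a ^ r + b ^ r" using assms by (auto simp: max_def)
  finally show ?thesis by simp
qed

lemma norm_integral_step_diff_le:
  fixes g :: "real \<Rightarrow> 'b::euclidean_space"
  assumes g: "continuous_on {a..a + real m * \<delta>} g" and \<delta>: "\<delta> \<ge> 0"
    and b: "\<And>i s. i < m \<Longrightarrow> a + real i * \<delta> \<le> s \<Longrightarrow> s \<le> a + real (Suc i) * \<delta> \<Longrightarrow> norm (g s - c i) \<le> e"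
  shows "norm (integral {a..a + real m * \<delta>} g - (\<Sum>i<m. \<delta> *\<^sub>R c i)) \<le> real m * \<delta> * e"
  using g b
proof (induction m)
  case (Suc m)
  let ?x = "a + real m * \<delta>" and ?y = "a + real (Suc m) * \<delta>"
  have xy: "a \<le> ?x" "?x \<le> ?y" using \<delta> by (auto simp: algebra_simps)
  have int: "g integrable_on {a..?y}" "g integrable_on {?x..?y}"
    using Suc.prems(1) xy by (auto intro!: integrable_continuous_interval intro: continuous_on_subset)
  have eq: "integral {a..?y} g - (\<Sum>i<Suc m. \<delta> *\<^sub>R c i)
     = (integral {a..?x} g - (\<Sum>i<m. \<delta> *\<^sub>R c i)) + (integral {?x..?y} g - \<delta> *\<^sub>R c m)"
    using Henstock_Kurzweil_Integration.integral_combine[OF xy int(1)] by (simp add: algebra_simps)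
  have 1: "norm (integral {a..?x} g - (\<Sum>i<m. \<delta> *\<^sub>R c i)) \<le> real m * \<delta> * e"
    using Suc.prems xy by (intro Suc.IH) (auto intro: continuous_on_subset)
  have 2: "norm (integral {?x..?y} g - \<delta> *\<^sub>R c m) \<le> \<delta> * e"
  proof -
    have "integral {?x..?y} (\<lambda>s. g s - c m) = integral {?x..?y} g - \<delta> *\<^sub>R c m"
      using int(2) xy by (subst integral_diff) (auto simp: algebra_simps)
    moreover have "norm (integral {?x..?y} (\<lambda>s. g s - c m)) \<le> e * (?y - ?x)"
      using Suc.prems(1) xy
      by (intro integral_bound) (auto intro!: continuous_intros Suc.prems(2) intro: continuous_on_subset)
    moreover have "?y - ?x = \<delta>" by (simp add: algebra_simps)
    ultimately show ?thesis by (simp only: mult.commute)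
  qed
  have "real (Suc m) * \<delta> * e = real m * \<delta> * e + \<delta> * e" by (simp add: algebra_simps)
  then show ?case unfolding eq using norm_triangle_ineq 1 2 by (smt (verit, best))
qed simp

text \<open>These left-endpoint sums make path integrals limits of variables evaluated at finitely
  many times, which later gives measurability and, through Fatou, moments. Counting
  \<open>Suc m\<close> cells avoids an empty partition.\<close>

lemma riemann_sum_tendsto:
  fixes g :: "real \<Rightarrow> 'b::euclidean_space"
  assumes g: "continuous_on {a..b} g" and ab: "a \<le> b"
  shows "(\<lambda>m. \<Sum>i<Suc m. ((b - a) / real (Suc m)) *\<^sub>R g (a + real i * ((b - a) / real (Suc m))))
    \<longlonglongrightarrow> integral {a..b} g"
proof (rule metric_LIMSEQ_I)
  fix e :: real assume e: "e > 0"
  \<comment> \<open>The summand 1 keeps the denominator positive when \<open>a = b\<close>; the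
    factor 2 makes the final inequality strict.\<close>
  define e' where "e' = e / (2 * (b - a + 1))"
  have e': "e' > 0" using e ab by (simp add: e'_def)
  have "uniformly_continuous_on {a..b} g"
    using g by (intro compact_uniformly_continuous) auto
  then obtain d where d: "d > 0" "\<And>s t. s \<in> {a..b} \<Longrightarrow> t \<in> {a..b} \<Longrightarrow> dist s t < d \<Longrightarrow> dist (g s) (g t) < e'"
    using e' unfolding uniformly_continuous_on_def by metis
  obtain N where N: "(b - a) / d < real N" using reals_Archimedean2 by auto
  show "\<exists>no. \<forall>n\<ge>no. dist (\<Sum>i<Suc n. ((b - a) / real (Suc n)) *\<^sub>R g (a + real i * ((b - a) / real (Suc n))))
    (integral {a..b} g) < e"
  proof (intro exI[of _ N] allI impI)
    fix n assume n: "N \<le> n"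
    define \<delta> where "\<delta> = (b - a) / real (Suc n)"
    have \<delta>: "\<delta> \<ge> 0" using ab by (simp add: \<delta>_def)
    have "(b - a) / d < real (Suc n)" using N n by linarith
    then have \<delta>d: "\<delta> < d" using d(1) by (simp add: \<delta>_def field_simps)
    have b: "a + real (Suc n) * \<delta> = b" by (simp add: \<delta>_def)
    have "norm (integral {a..a + real (Suc n) * \<delta>} g - (\<Sum>i<Suc n. \<delta> *\<^sub>R g (a + real i * \<delta>))) \<le> real (Suc n) * \<delta> * e'"
    proof (rule norm_integral_step_diff_le)
      show "continuous_on {a..a + real (Suc n) * \<delta>} g" using g b by simp
      fix i s assume i: "i < Suc n" and s: "a + real i * \<delta> \<le> s" "s \<le> a + real (Suc i) * \<delta>"
      have "real (Suc i) * \<delta> \<le> real (Suc n) * \<delta>" using i \<delta> by (intro mult_right_mono) auto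
      moreover have "0 \<le> real i * \<delta>" using \<delta> by simp
      ultimately have "s \<in> {a..b}" "a + real i * \<delta> \<in> {a..b}" "dist s (a + real i * \<delta>) < d"
        using s b \<delta>d \<delta> unfolding atLeastAtMost_iff dist_real_def of_nat_Suc distrib_right by linarith+
      from d(2)[OF this] show "norm (g s - g (a + real i * \<delta>)) \<le> e'" by (simp add: dist_norm)
    qed (use \<delta> in auto)
    also have "real (Suc n) * \<delta> * e' < e"
    proof -
      have "real (Suc n) * \<delta> = b - a" using b by linarith
      moreover have "(b - a) * e' < e"
      proof -
        have "(b - a) * e' \<le> (b - a + 1) * e'" using e' by (intro mult_right_mono) auto
        also have "\<dots> = e / 2" using ab by (simp add: e'_def field_simps)
        finally show ?thesis using e by simp
      qed
      ultimately show ?thesis by simp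
    qed
    finally have "norm (integral {a..b} g - (\<Sum>i<Suc n. \<delta> *\<^sub>R g (a + real i * \<delta>))) < e"
      by (simp only: b)
    then show "dist (\<Sum>i<Suc n. ((b - a) / real (Suc n)) *\<^sub>R g (a + real i * ((b - a) / real (Suc n))))
      (integral {a..b} g) < e"
      by (simp only: dist_norm norm_minus_commute[of "sum _ _"] \<delta>_def)
  qed
qed

text \<open>Fatou's lemma in the form used throughout: a bound uniform along an almost surely
  convergent sequence survives in the limit.\<close>

lemma nn_integral_le_of_LIMSEQ:
  fixes f :: "nat \<Rightarrow> 'a \<Rightarrow> ennreal"
  assumes [measurable]: "\<And>n. f n \<in> borel_measurable M"
    and lim: "AE \<omega> in M. (\<lambda>n. f n \<omega>) \<longlonglongrightarrow> g \<omega>"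
    and K: "\<And>n. (\<integral>\<^sup>+\<omega>. f n \<omega> \<partial>M) \<le> K"
  shows "(\<integral>\<^sup>+\<omega>. g \<omega> \<partial>M) \<le> K"
proof -
  have "(\<integral>\<^sup>+\<omega>. g \<omega> \<partial>M) = (\<integral>\<^sup>+\<omega>. liminf (\<lambda>n. f n \<omega>) \<partial>M)"
    by (rule nn_integral_cong_AE, use lim in eventually_elim) (simp add: lim_imp_Liminf)
  also have "\<dots> \<le> liminf (\<lambda>n. \<integral>\<^sup>+\<omega>. f n \<omega> \<partial>M)"
    by (intro nn_integral_liminf) auto
  also have "\<dots> \<le> K"
    using K by (intro Liminf_le) auto
  finally show ?thesis .
qed

text \<open>A uniform second moment gives uniform integrability. Concretely, the distance of
  \<open>Y n\<close> to \<open>Z\<close> is cut at a level \<open>L\<close>: the truncated part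
  vanishes by dominated convergence, and beyond the level the distance is at most its square divided
  by \<open>L\<close>.\<close>

lemma (in prob_space) expectation_LIMSEQ_of_bounded_second_moment:
  fixes Y :: "nat \<Rightarrow> 'a \<Rightarrow> real"
  assumes [measurable]: "\<And>n. Y n \<in> borel_measurable M" "Z \<in> borel_measurable M"
    and lim: "AE \<omega> in M. (\<lambda>n. Y n \<omega>) \<longlonglongrightarrow> Z \<omega>"
    and K: "0 \<le> K" "\<And>n. (\<integral>\<^sup>+\<omega>. ennreal ((Y n \<omega>)\<^sup>2) \<partial>M) \<le> ennreal K"
  shows "(\<integral>\<^sup>+\<omega>. ennreal ((Z \<omega>)\<^sup>2) \<partial>M) \<le> ennreal K" "integrable M Z"
    "(\<lambda>n. expectation (Y n)) \<longlonglongrightarrow> expectation Z"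
proof -
  show Z2: "(\<integral>\<^sup>+\<omega>. ennreal ((Z \<omega>)\<^sup>2) \<partial>M) \<le> ennreal K"
    by (rule nn_integral_le_of_LIMSEQ[OF _ _ K(2)])
      (use lim in \<open>auto elim!: eventually_mono intro!: tendsto_ennrealI tendsto_power\<close>)
  have "(\<integral>\<^sup>+\<omega>. ennreal ((Y n \<omega>)\<^sup>2) \<partial>M) < \<infinity>" for n
    using le_less_trans[OF K(2)[of n]] by simp
  note iY = square_nn_finite_imp_integrable[OF assms(1) this]
  have "(\<integral>\<^sup>+\<omega>. ennreal ((Z \<omega>)\<^sup>2) \<partial>M) < \<infinity>"
    using le_less_trans[OF Z2] by simp
  note iZ = square_nn_finite_imp_integrable[OF assms(2) this]
  show "integrable M Z" by (rule iZ(2))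
  have eY: "expectation (\<lambda>\<omega>. (Y n \<omega>)\<^sup>2) \<le> K" for n
    using K(1) K(2)[of n] nn_integral_eq_integral[OF iY(1)[of n]] by auto
  have eZ: "expectation (\<lambda>\<omega>. (Z \<omega>)\<^sup>2) \<le> K"
    using K Z2 nn_integral_eq_integral[OF iZ(1)] by auto
  show "(\<lambda>n. expectation (Y n)) \<longlonglongrightarrow> expectation Z"
  proof (rule metric_LIMSEQ_I)
    fix e :: real assume e: "e > 0"
    \<comment> \<open>The tail contributes at most \<open>4 * K / L\<close>, which this level makes
      at most \<open>e / 2\<close>; the 1 covers \<open>K = 0\<close>.\<close>
    define L where "L = 8 * K / e + 1"
    have L: "L > 0" using e K(1) by (simp add: L_def add_nonneg_pos)
    let ?D = "\<lambda>n \<omega>. \<bar>Y n \<omega> - Z \<omega>\<bar>"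
    have "(\<lambda>n. expectation (\<lambda>\<omega>. min (?D n \<omega>) L)) \<longlonglongrightarrow> expectation (\<lambda>\<omega>. 0)"
    proof (rule integral_dominated_convergence[where w="\<lambda>_. L"])
      show "AE \<omega> in M. (\<lambda>n. min (?D n \<omega>) L) \<longlonglongrightarrow> 0"
        using lim
      proof eventually_elim
        fix \<omega> assume "(\<lambda>n. Y n \<omega>) \<longlonglongrightarrow> Z \<omega>"
        then have "(\<lambda>n. min (?D n \<omega>) L) \<longlonglongrightarrow> min \<bar>Z \<omega> - Z \<omega>\<bar> L"
          by (intro tendsto_intros)
        then show "(\<lambda>n. min (?D n \<omega>) L) \<longlonglongrightarrow> 0" using L by simp
      qed
    qed (use L in auto)
    from LIMSEQ_D[OF this half_gt_zero[OF e]] obtain no where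
      "\<forall>n\<ge>no. norm (expectation (\<lambda>\<omega>. min (?D n \<omega>) L) - expectation (\<lambda>\<omega>. 0)) < e / 2" by blast
    then have no: "\<bar>expectation (\<lambda>\<omega>. min (?D n \<omega>) L)\<bar> < e / 2" if "n \<ge> no" for n
      using that by simp
    show "\<exists>no. \<forall>n\<ge>no. dist (expectation (Y n)) (expectation Z) < e"
    proof (intro exI[of _ no] allI impI)
      fix n assume n: "no \<le> n"
      have iD: "integrable M (?D n)" using iY(2)[of n] iZ(2) by auto
      have im: "integrable M (\<lambda>\<omega>. min (?D n \<omega>) L)"
        by (rule integrable_const_bound[where B=L]) (use L in auto)
      have pt: "?D n \<omega> \<le> min (?D n \<omega>) L + (2 * (Y n \<omega>)\<^sup>2 + 2 * (Z \<omega>)\<^sup>2) / L" for \<omega>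
      proof (cases "?D n \<omega> \<le> L")
        case True then show ?thesis using L by simp
      next
        case False
        then have "?D n \<omega> * L \<le> ?D n \<omega> * ?D n \<omega>" by (intro mult_left_mono) auto
        also have "\<dots> = (Y n \<omega> - Z \<omega>)\<^sup>2" by (simp add: power2_eq_square abs_mult[symmetric])
        also have "\<dots> \<le> 2 * (Y n \<omega>)\<^sup>2 + 2 * (Z \<omega>)\<^sup>2"
          using zero_le_power2[of "Y n \<omega> + Z \<omega>"] by (simp add: power2_eq_square algebra_simps)
        finally have "?D n \<omega> \<le> (2 * (Y n \<omega>)\<^sup>2 + 2 * (Z \<omega>)\<^sup>2) / L" using L by (simp add: field_simps)
        then show ?thesis using L by (simp add: min_def)
      qed
      have "dist (expectation (Y n)) (expectation Z) = \<bar>expectation (\<lambda>\<omega>. Y n \<omega> - Z \<omega>)\<bar>"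
        using iY(2)[of n] iZ(2) by (simp add: dist_real_def)
      also have "\<dots> \<le> expectation (?D n)" by (rule integral_abs_bound)
      also have "\<dots> \<le> expectation (\<lambda>\<omega>. min (?D n \<omega>) L + (2 * (Y n \<omega>)\<^sup>2 + 2 * (Z \<omega>)\<^sup>2) / L)"
        using iD im iY(1)[of n] iZ(1) by (intro integral_mono pt) auto
      also have "\<dots> = expectation (\<lambda>\<omega>. min (?D n \<omega>) L)
          + (2 * expectation (\<lambda>\<omega>. (Y n \<omega>)\<^sup>2) + 2 * expectation (\<lambda>\<omega>. (Z \<omega>)\<^sup>2)) / L"
        using im iY(1)[of n] iZ(1) by simp
      also have "\<dots> < e / 2 + 4 * K / L"
        using no[OF n] eY[of n] eZ L by (intro add_less_le_mono divide_right_mono) auto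
      also have "4 * K / L \<le> e / 2"
        using e K(1) L by (simp add: L_def field_simps)
      finally show "dist (expectation (Y n)) (expectation Z) < e" by simp
    qed
  qed
qed

subsection \<open>Increments of Brownian motion\<close>

lemma (in prob_space) indep_var_nn_integral_mult:
  assumes ind: "indep_var S X T Y"
    and [measurable]: "f \<in> borel_measurable S" "g \<in> borel_measurable T"
  shows "(\<integral>\<^sup>+\<omega>. f (X \<omega>) * g (Y \<omega>) \<partial>M) = (\<integral>\<^sup>+\<omega>. f (X \<omega>) \<partial>M) * (\<integral>\<^sup>+\<omega>. g (Y \<omega>) \<partial>M)"
proof -
  have [measurable]: "X \<in> measurable M S" "Y \<in> measurable M T"
    using indep_var_rv1[OF ind] indep_var_rv2[OF ind] by auto
  interpret X: prob_space "distr M S X" by (rule prob_space_distr) simp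
  interpret Y: prob_space "distr M T Y" by (rule prob_space_distr) simp
  interpret P: pair_sigma_finite "distr M S X" "distr M T Y" ..
  have eq: "distr M S X \<Otimes>\<^sub>M distr M T Y = distr M (S \<Otimes>\<^sub>M T) (\<lambda>\<omega>. (X \<omega>, Y \<omega>))"
    using ind by (simp add: indep_var_distribution_eq)
  have "(\<integral>\<^sup>+\<omega>. f (X \<omega>) * g (Y \<omega>) \<partial>M) = (\<integral>\<^sup>+z. f (fst z) * g (snd z) \<partial>(distr M S X \<Otimes>\<^sub>M distr M T Y))"
    unfolding eq by (subst nn_integral_distr) auto
  also have "\<dots> = (\<integral>\<^sup>+y. \<integral>\<^sup>+x. f x * g y \<partial>distr M S X \<partial>distr M T Y)"
    by (subst P.nn_integral_snd[symmetric]) auto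
  also have "\<dots> = (\<integral>\<^sup>+\<omega>. f (X \<omega>) \<partial>M) * (\<integral>\<^sup>+\<omega>. g (Y \<omega>) \<partial>M)"
    by (simp add: nn_integral_multc nn_integral_cmult nn_integral_distr)
  finally show ?thesis .
qed

text \<open>Fubini integrates over \<open>Y\<close> first and finds \<open>x \<bullet> 0\<close> for
  each fixed value \<open>x\<close> of \<open>X\<close>. Integrability is asked of the product only,
  so \<open>X\<close> may have no mean.\<close>

lemma (in prob_space) indep_var_expectation_inner_eq_0:
  fixes X Y :: "'a \<Rightarrow> 'b::euclidean_space"
  assumes ind: "indep_var borel X borel Y"
    and int: "integrable M (\<lambda>\<omega>. X \<omega> \<bullet> Y \<omega>)"
    and Y: "integrable M Y" "expectation Y = 0"
  shows "expectation (\<lambda>\<omega>. X \<omega> \<bullet> Y \<omega>) = 0"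
proof -
  have [measurable]: "X \<in> borel_measurable M" "Y \<in> borel_measurable M"
    using indep_var_rv1[OF ind] indep_var_rv2[OF ind] by auto
  interpret X: prob_space "distr M borel X" by (rule prob_space_distr) simp
  interpret Y: prob_space "distr M borel Y" by (rule prob_space_distr) simp
  interpret P: pair_sigma_finite "distr M borel X" "distr M borel Y" ..
  have eq: "distr M borel X \<Otimes>\<^sub>M distr M borel Y = distr M (borel \<Otimes>\<^sub>M borel) (\<lambda>\<omega>. (X \<omega>, Y \<omega>))"
    using ind by (simp add: indep_var_distribution_eq)
  have int': "integrable (distr M borel X \<Otimes>\<^sub>M distr M borel Y) (\<lambda>(x, y). x \<bullet> y)"
    unfolding eq using int by (subst integrable_distr_eq) (auto simp: case_prod_unfold)
  have "expectation (\<lambda>\<omega>. X \<omega> \<bullet> Y \<omega>) = (\<integral>z. (case z of (x, y) \<Rightarrow> x \<bullet> y) \<partial>(distr M borel X \<Otimes>\<^sub>M distr M borel Y))"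
    unfolding eq by (subst integral_distr) (auto simp: case_prod_unfold)
  also have "\<dots> = (\<integral>x. \<integral>y. x \<bullet> y \<partial>distr M borel Y \<partial>distr M borel X)"
    using P.integral_fst'[OF int'] by simp
  also have "\<dots> = 0"
    using Y by (simp add: integral_distr integrable_distr_eq)
  finally show ?thesis .
qed

text \<open>A single term of the exponential series; it turns one exponential moment into moments of
  every order.\<close>

lemma power_le_fact_exp:
  fixes x :: real assumes "0 \<le> x"
  shows "x ^ r \<le> fact r * exp x"
proof -
  have "(\<Sum>n\<in>{r}. x ^ n /\<^sub>R fact n) \<le> (\<Sum>n. x ^ n /\<^sub>R fact n)"
    using assms summable_exp_generic[of x] by (intro sum_le_suminf) auto
  then show ?thesis
    by (simp add: exp_def field_simps)
qed

text \<open>Completing the square turns the tilted density into a multiple of the normal density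
  with mean \<open>\<theta> * \<sigma>\<^sup>2\<close>.\<close>

lemma nn_integral_normal_exp:
  assumes "\<sigma> > 0"
  shows "(\<integral>\<^sup>+x. ennreal (normal_density 0 \<sigma> x) * ennreal (exp (\<theta> * x)) \<partial>lborel) = ennreal (exp (\<theta>\<^sup>2 * \<sigma>\<^sup>2 / 2))"
proof -
  have "normal_density 0 \<sigma> x * exp (\<theta> * x) = exp (\<theta>\<^sup>2 * \<sigma>\<^sup>2 / 2) * normal_density (\<theta> * \<sigma>\<^sup>2) \<sigma> x" for x
  proof -
    have "- x\<^sup>2 / (2 * \<sigma>\<^sup>2) + \<theta> * x = \<theta>\<^sup>2 * \<sigma>\<^sup>2 / 2 + - (x - \<theta> * \<sigma>\<^sup>2)\<^sup>2 / (2 * \<sigma>\<^sup>2)"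
      using assms by (simp add: field_simps power2_eq_square)
    then have "exp (- x\<^sup>2 / (2 * \<sigma>\<^sup>2)) * exp (\<theta> * x) = exp (\<theta>\<^sup>2 * \<sigma>\<^sup>2 / 2) * exp (- (x - \<theta> * \<sigma>\<^sup>2)\<^sup>2 / (2 * \<sigma>\<^sup>2))"
      by (simp only: exp_add[symmetric])
    then show ?thesis by (simp add: normal_density_def)
  qed
  then have "(\<integral>\<^sup>+x. ennreal (normal_density 0 \<sigma> x) * ennreal (exp (\<theta> * x)) \<partial>lborel)
      = (\<integral>\<^sup>+x. ennreal (exp (\<theta>\<^sup>2 * \<sigma>\<^sup>2 / 2)) * ennreal (normal_density (\<theta> * \<sigma>\<^sup>2) \<sigma> x) \<partial>lborel)"
    by (simp add: ennreal_mult[symmetric])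
  also have "\<dots> = ennreal (exp (\<theta>\<^sup>2 * \<sigma>\<^sup>2 / 2))"
    using assms by (subst nn_integral_cmult) (auto simp: nn_integral_eq_integral)
  finally show ?thesis .
qed

locale brownian = prob_space M for M :: "'a measure" +
  fixes F :: "real \<Rightarrow> 'a measure" and W :: "real \<Rightarrow> 'a \<Rightarrow> real^'d"
  assumes normal: "normal_filtration M F" and bm: "brownian_motion M F W"
begin

lemma subalg: "0 \<le> t \<Longrightarrow> subalgebra M (F t)"
  using normal by (auto simp: normal_filtration_def)

lemma space_F: "0 \<le> t \<Longrightarrow> space (F t) = space M"
  using subalg by (auto simp: subalgebra_def)

lemma measurable_F_imp: "0 \<le> t \<Longrightarrow> X \<in> measurable (F t) N \<Longrightarrow> X \<in> measurable M N"
  using measurable_from_subalg[OF subalg] by auto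

lemma measurable_F_mono: "0 \<le> s \<Longrightarrow> s \<le> t \<Longrightarrow> X \<in> measurable (F s) N \<Longrightarrow> X \<in> measurable (F t) N"
proof -
  assume *: "0 \<le> s" "s \<le> t" "X \<in> measurable (F s) N"
  then have "sets (F s) \<subseteq> sets (F t)" using normal unfolding normal_filtration_def by blast
  with * show ?thesis
    by (intro measurable_from_subalg[of "F t" "F s" X]) (simp_all add: subalgebra_def space_F)
qed

lemma W_measurable_F: "0 \<le> t \<Longrightarrow> W t \<in> borel_measurable (F t)"
  using bm by (auto simp: brownian_motion_def)

lemma W_measurable: "0 \<le> t \<Longrightarrow> W t \<in> borel_measurable M"
  using measurable_F_imp W_measurable_F by blast

lemma continuous_on_W: "\<omega> \<in> space M \<Longrightarrow> continuous_on {0..} (\<lambda>t. W t \<omega>)"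
  using bm by (auto simp: brownian_motion_def)

text \<open>Independence of \<open>F s\<close> and the increment passes to any
  \<open>F s\<close>-measurable variable and any measurable image of the increment, because their
  preimages belong to the same two families of events.\<close>

lemma indep_increment:
  assumes st: "0 \<le> s" "s < t" and X: "X \<in> measurable (F s) N" and g: "g \<in> measurable borel N'"
  shows "indep_var N X N' (\<lambda>\<omega>. g (W t \<omega> - W s \<omega>))"
proof -
  let ?Y = "\<lambda>\<omega>. g (W t \<omega> - W s \<omega>)"
  have "indep_set (sets (F s)) {(\<lambda>\<omega>. W t \<omega> - W s \<omega>) -` A \<inter> space M |A. A \<in> sets borel}"
    using bm st by (auto simp: brownian_motion_def)
  then have "indep_sets (\<lambda>i. {case_bool X ?Y i -` A \<inter> space M |A. A \<in> sets (case_bool N N' i)}) UNIV"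
    unfolding indep_set_def
  proof (rule indep_sets_mono_sets)
    fix i :: bool
    have "\<exists>B. ?Y -` A \<inter> space M = (\<lambda>\<omega>. W t \<omega> - W s \<omega>) -` B \<inter> space M \<and> B \<in> sets borel" if "A \<in> sets N'" for A
      using measurable_sets[OF g that] by (intro exI[of _ "g -` A"]) auto
    then show "{case_bool X ?Y i -` A \<inter> space M |A. A \<in> sets (case_bool N N' i)}
      \<subseteq> case_bool (sets (F s)) {(\<lambda>\<omega>. W t \<omega> - W s \<omega>) -` A \<inter> space M |A. A \<in> sets borel} i"
      using measurable_sets[OF X] space_F[OF st(1)] by (cases i) auto
  qed
  moreover have "?Y \<in> measurable M N'"
    using st by (intro measurable_compose[OF _ g] borel_measurable_diff W_measurable) auto
  ultimately show ?thesis
    unfolding indep_var_def indep_vars_def2 using measurable_F_imp[OF st(1) X]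
    by (auto split: bool.split)
qed

lemma increment_distributed:
  "0 \<le> s \<Longrightarrow> s < t \<Longrightarrow> distributed M lborel (\<lambda>\<omega>. (W t \<omega> - W s \<omega>) $ j) (\<lambda>x. ennreal (normal_density 0 (sqrt (t - s)) x))"
  using bm by (auto simp: brownian_motion_def)

lemma increment_exp:
  assumes "0 \<le> s" "s < t"
  shows "(\<integral>\<^sup>+\<omega>. ennreal (exp (\<theta> * (W t \<omega> - W s \<omega>) $ j)) \<partial>M) = ennreal (exp (\<theta>\<^sup>2 * (t - s) / 2))"
proof -
  have "(\<integral>\<^sup>+\<omega>. ennreal (exp (\<theta> * (W t \<omega> - W s \<omega>) $ j)) \<partial>M)
    = (\<integral>\<^sup>+x. ennreal (normal_density 0 (sqrt (t - s)) x) * ennreal (exp (\<theta> * x)) \<partial>lborel)"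
    by (rule distributed_nn_integral[OF increment_distributed[OF assms], symmetric]) simp
  also have "\<dots> = ennreal (exp (\<theta>\<^sup>2 * (sqrt (t - s))\<^sup>2 / 2))"
    using assms by (intro nn_integral_normal_exp) simp
  finally show ?thesis using assms by (simp only: real_sqrt_pow2 diff_ge_0_iff_ge less_imp_le)
qed

lemma increment_moments:
  assumes st: "0 \<le> s" "s < t"
  shows "integrable M (\<lambda>\<omega>. (W t \<omega> - W s \<omega>) $ j ^ k)"
    and "expectation (\<lambda>\<omega>. (W t \<omega> - W s \<omega>) $ j) = 0"
    and "expectation (\<lambda>\<omega>. (W t \<omega> - W s \<omega>) $ j ^ 2) = t - s"
    and "expectation (\<lambda>\<omega>. (W t \<omega> - W s \<omega>) $ j ^ 4) = 3 * (t - s)\<^sup>2"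
proof -
  note d = increment_distributed[OF st, of j]
  have \<sigma>: "sqrt (t - s) > 0" using st by simp
  show "integrable M (\<lambda>\<omega>. (W t \<omega> - W s \<omega>) $ j ^ k)"
    using distributed_integrable[OF d, of "\<lambda>x. x ^ k"] integrable_normal_moment[OF \<sigma>, of 0 k] by simp
  show "expectation (\<lambda>\<omega>. (W t \<omega> - W s \<omega>) $ j) = 0"
    using distributed_integral[OF d, of "\<lambda>x. x"] integral_normal_moment_odd[OF \<sigma>, of 0 0] by simp
  show "expectation (\<lambda>\<omega>. (W t \<omega> - W s \<omega>) $ j ^ 2) = t - s"
    using distributed_integral[OF d, of "\<lambda>x. x ^ 2"] integral_normal_moment_even[OF \<sigma>, of 0 1] st by simp
  show "expectation (\<lambda>\<omega>. (W t \<omega> - W s \<omega>) $ j ^ 4) = 3 * (t - s)\<^sup>2"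
    using distributed_integral[OF d, of "\<lambda>x. x ^ 4"] integral_normal_moment_even[OF \<sigma>, of 0 2] st
    by (simp add: fact_numeral power_divide power2_eq_square)
qed

lemma increment_product_expectation:
  assumes st: "0 \<le> s" "s < t"
  shows "integrable M (\<lambda>\<omega>. (W t \<omega> - W s \<omega>) $ j * (W t \<omega> - W s \<omega>) $ k)"
    and "expectation (\<lambda>\<omega>. (W t \<omega> - W s \<omega>) $ j * (W t \<omega> - W s \<omega>) $ k) = (if j = k then t - s else 0)"
proof -
  have *: "integrable M (\<lambda>\<omega>. (W t \<omega> - W s \<omega>) $ j * (W t \<omega> - W s \<omega>) $ k) \<and>
    expectation (\<lambda>\<omega>. (W t \<omega> - W s \<omega>) $ j * (W t \<omega> - W s \<omega>) $ k) = (if j = k then t - s else 0)"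
  proof (cases "j = k")
    case True
    then show ?thesis
      using increment_moments(1)[OF st, of k 2] increment_moments(3)[OF st, of k]
      by (simp add: power2_eq_square)
  next
    case False
    have "indep_vars (\<lambda>_. borel) (\<lambda>j \<omega>. (W t \<omega> - W s \<omega>) $ j) UNIV"
      using bm st by (auto simp: brownian_motion_def)
    then have ind: "indep_var borel (\<lambda>\<omega>. (W t \<omega> - W s \<omega>) $ j) borel (\<lambda>\<omega>. \<Sum>i\<in>{k}. (W t \<omega> - W s \<omega>) $ i)"
      using False by (intro indep_vars_sum) (auto intro: indep_vars_subset)
    then show ?thesis
      using indep_var_integrable[OF ind] indep_var_lebesgue_integral[OF ind]
        increment_moments(1)[OF st, of _ 1] increment_moments(2)[OF st] False by simp
  qed
  then show "integrable M (\<lambda>\<omega>. (W t \<omega> - W s \<omega>) $ j * (W t \<omega> - W s \<omega>) $ k)"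
    "expectation (\<lambda>\<omega>. (W t \<omega> - W s \<omega>) $ j * (W t \<omega> - W s \<omega>) $ k) = (if j = k then t - s else 0)"
    by auto
qed

text \<open>The last increment is independent of the preceding sum, so its exponential moment splits
  off as a factor; bounding each weight by \<open>A\<close> leaves only the total time
  \<open>n * \<delta>\<close>. Exponential moments multiply, where powers of the sum would call for
  multinomial expansions.\<close>

lemma gaussian_sum_exp:
  assumes u: "0 \<le> u" and \<delta>: "\<delta> > 0" and a: "\<And>k. \<bar>a k\<bar> \<le> A"
  shows "(\<integral>\<^sup>+\<omega>. ennreal (exp (\<theta> * (\<Sum>k<n. a k * (W (u + real (Suc k) * \<delta>) \<omega> - W (u + real k * \<delta>) \<omega>) $ j))) \<partial>M)
    \<le> ennreal (exp (\<theta>\<^sup>2 * A\<^sup>2 * (real n * \<delta>) / 2))"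
proof (induction n)
  case 0 then show ?case by (simp add: emeasure_space_1)
next
  case (Suc n)
  define X where "X \<omega> = (\<Sum>k<n. a k * (W (u + real (Suc k) * \<delta>) \<omega> - W (u + real k * \<delta>) \<omega>) $ j)" for \<omega>
  let ?s = "u + real n * \<delta>" and ?t = "u + real (Suc n) * \<delta>"
  have st: "0 \<le> ?s" "?s < ?t" using u \<delta> by auto
  have mW: "(\<lambda>\<omega>. W (u + real k * \<delta>) \<omega>) \<in> borel_measurable (F ?s)" if "k \<le> n" for k
    using u \<delta> that
    by (intro measurable_F_mono[OF _ _ W_measurable_F, of "u + real k * \<delta>"]) (auto intro!: mult_right_mono)
  have X: "X \<in> borel_measurable (F ?s)"
    unfolding X_def[abs_def]
  proof (intro borel_measurable_sum borel_measurable_times borel_measurable_const)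
    fix k assume "k \<in> {..<n}"
    then have "(\<lambda>\<omega>. W (u + real (Suc k) * \<delta>) \<omega> - W (u + real k * \<delta>) \<omega>) \<in> borel_measurable (F ?s)"
      by (intro borel_measurable_diff mW) auto
    then show "(\<lambda>\<omega>. (W (u + real (Suc k) * \<delta>) \<omega> - W (u + real k * \<delta>) \<omega>) $ j) \<in> borel_measurable (F ?s)"
      by (rule measurable_compose[OF _ borel_measurable_nth])
  qed
  have "(\<integral>\<^sup>+\<omega>. ennreal (exp (\<theta> * (\<Sum>k<Suc n. a k * (W (u + real (Suc k) * \<delta>) \<omega> - W (u + real k * \<delta>) \<omega>) $ j))) \<partial>M)
     = (\<integral>\<^sup>+\<omega>. ennreal (exp (\<theta> * X \<omega>)) * ennreal (exp (\<theta> * a n * (W ?t \<omega> - W ?s \<omega>) $ j)) \<partial>M)"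
    by (simp add: X_def distrib_left exp_add ennreal_mult mult.assoc)
  also have "\<dots> = (\<integral>\<^sup>+\<omega>. ennreal (exp (\<theta> * X \<omega>)) \<partial>M) * (\<integral>\<^sup>+\<omega>. ennreal (exp (\<theta> * a n * (W ?t \<omega> - W ?s \<omega>) $ j)) \<partial>M)"
    using indep_var_nn_integral_mult[OF indep_increment[OF st X borel_measurable_nth[of j]],
      of "\<lambda>x. ennreal (exp (\<theta> * x))" "\<lambda>x. ennreal (exp (\<theta> * a n * x))"] by simp
  also have "\<dots> \<le> ennreal (exp (\<theta>\<^sup>2 * A\<^sup>2 * (real n * \<delta>) / 2)) * ennreal (exp (\<theta>\<^sup>2 * A\<^sup>2 * \<delta> / 2))"
  proof (intro mult_mono)
    show "(\<integral>\<^sup>+\<omega>. ennreal (exp (\<theta> * X \<omega>)) \<partial>M) \<le> ennreal (exp (\<theta>\<^sup>2 * A\<^sup>2 * (real n * \<delta>) / 2))"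
      using Suc.IH by (simp add: X_def)
    have "(a n)\<^sup>2 \<le> A\<^sup>2" using a[of n] by (metis abs_ge_zero power2_abs power_mono)
    then have "\<theta>\<^sup>2 * (a n)\<^sup>2 * \<delta> \<le> \<theta>\<^sup>2 * A\<^sup>2 * \<delta>" using \<delta> by (intro mult_right_mono mult_left_mono) auto
    moreover have "?t - ?s = \<delta>" by (simp add: algebra_simps)
    ultimately show "(\<integral>\<^sup>+\<omega>. ennreal (exp (\<theta> * a n * (W ?t \<omega> - W ?s \<omega>) $ j)) \<partial>M) \<le> ennreal (exp (\<theta>\<^sup>2 * A\<^sup>2 * \<delta> / 2))"
      unfolding increment_exp[OF st] by (intro ennreal_leI) (simp add: power_mult_distrib)
  qed auto
  also have "\<dots> = ennreal (exp (\<theta>\<^sup>2 * A\<^sup>2 * (real (Suc n) * \<delta>) / 2))"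
    by (simp add: ennreal_mult[symmetric] exp_add[symmetric] algebra_simps add_divide_distrib)
  finally show ?case .
qed

text \<open>The point is the scaling \<open>A ^ r\<close>, uniform in \<open>n\<close> and
  \<open>\<delta>\<close>: with weights of size \<open>h\<close> the sum has size \<open>h\<close>.
  The constant collects \<open>fact r\<close> from the exponential series, 2 from the two signs, and
  powers of the dimension from the passage to coordinates.\<close>

lemma gaussian_sum_moment:
  assumes u: "0 \<le> u" and \<delta>: "\<delta> > 0" and a: "\<And>k. \<bar>a k\<bar> \<le> A" and A: "A > 0" and T: "real n * \<delta> \<le> T"
    and r: "r > 0"
  shows "(\<integral>\<^sup>+\<omega>. ennreal (norm (\<Sum>k<n. a k *\<^sub>R (W (u + real (Suc k) * \<delta>) \<omega> - W (u + real k * \<delta>) \<omega>)) ^ r) \<partial>M)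
    \<le> ennreal (real CARD('d) ^ r * (2 * fact r * exp (T / 2)) * A ^ r)"
proof -
  define X where "X \<omega> = (\<Sum>k<n. a k *\<^sub>R (W (u + real (Suc k) * \<delta>) \<omega> - W (u + real k * \<delta>) \<omega>))" for \<omega>
  have mW[measurable]: "W (u + real k * \<delta>) \<in> borel_measurable M" for k
    using u \<delta> by (intro W_measurable) auto
  have [measurable]: "X \<in> borel_measurable M"
    unfolding X_def[abs_def] by (intro borel_measurable_sum borel_measurable_scaleR borel_measurable_diff mW) auto
  have Xj: "X \<omega> $ j = (\<Sum>k<n. a k * (W (u + real (Suc k) * \<delta>) \<omega> - W (u + real k * \<delta>) \<omega>) $ j)" for \<omega> j
    by (simp add: X_def)
  \<comment> \<open>For \<open>l\<close> of modulus \<open>1 / A\<close> the weights cancel from the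
    exponent, which is then at most \<open>T / 2\<close>.\<close>
  have ex: "(\<integral>\<^sup>+\<omega>. ennreal (exp (l * X \<omega> $ j)) \<partial>M) \<le> ennreal (exp (T / 2))" if "\<bar>l\<bar> = 1 / A" for l j
  proof -
    have "\<bar>l * A\<bar> = 1" using that A by (simp add: abs_mult)
    then have "l\<^sup>2 * A\<^sup>2 = 1" by (metis one_power2 power2_abs power_mult_distrib)
    then have "(\<integral>\<^sup>+\<omega>. ennreal (exp (l * X \<omega> $ j)) \<partial>M) \<le> ennreal (exp (real n * \<delta> / 2))"
      using gaussian_sum_exp[OF u \<delta> a, where \<theta>=l and n=n and j=j] by (simp add: Xj)
    also have "\<dots> \<le> ennreal (exp (T / 2))" using T by (intro ennreal_leI) simp
    finally show ?thesis .
  qed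
  have [measurable]: "(\<lambda>\<omega>. X \<omega> $ j) \<in> borel_measurable M" for j
    by (rule measurable_compose[OF _ borel_measurable_nth]) simp
  have pt: "norm (X \<omega>) ^ r \<le> (\<Sum>j\<in>UNIV. real CARD('d) ^ (r - 1) * (fact r * A ^ r) * (exp (1 / A * X \<omega> $ j) + exp (- 1 / A * X \<omega> $ j)))" for \<omega>
  proof -
    have "norm (X \<omega>) ^ r \<le> (\<Sum>j\<in>UNIV. 1 * \<bar>X \<omega> $ j\<bar>) ^ r"
      using norm_le_l1_cart[of "X \<omega>"] by (intro power_mono) auto
    also have "\<dots> \<le> real CARD('d) ^ (r - 1) * (\<Sum>j\<in>UNIV. 1 * \<bar>X \<omega> $ j\<bar> ^ r)"
      using r by (intro power_sum_le_sum_power) auto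
    also have "\<dots> \<le> real CARD('d) ^ (r - 1) * (\<Sum>j\<in>UNIV. (fact r * A ^ r) * (exp (1 / A * X \<omega> $ j) + exp (- 1 / A * X \<omega> $ j)))"
    proof (intro mult_left_mono sum_mono)
      fix j
      have "(\<bar>X \<omega> $ j\<bar> / A) ^ r \<le> fact r * exp (\<bar>X \<omega> $ j\<bar> / A)"
        using A by (intro power_le_fact_exp) auto
      also have "exp (\<bar>X \<omega> $ j\<bar> / A) \<le> exp (1 / A * X \<omega> $ j) + exp (- 1 / A * X \<omega> $ j)"
        by (cases "X \<omega> $ j \<ge> 0") (auto simp: abs_if add_increasing add_increasing2)
      finally have "(\<bar>X \<omega> $ j\<bar> / A) ^ r \<le> fact r * (exp (1 / A * X \<omega> $ j) + exp (- 1 / A * X \<omega> $ j))"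
        by simp
      then have "(\<bar>X \<omega> $ j\<bar> / A) ^ r * A ^ r \<le> fact r * (exp (1 / A * X \<omega> $ j) + exp (- 1 / A * X \<omega> $ j)) * A ^ r"
        using A by (intro mult_right_mono) auto
      then show "1 * \<bar>X \<omega> $ j\<bar> ^ r \<le> (fact r * A ^ r) * (exp (1 / A * X \<omega> $ j) + exp (- 1 / A * X \<omega> $ j))"
        using A by (simp add: power_divide mult_ac)
    qed auto
    finally show ?thesis by (simp add: sum_distrib_left mult.assoc)
  qed
  let ?c = "real CARD('d) ^ (r - 1) * (fact r * A ^ r)"
  have c: "?c \<ge> 0" using A by simp
  have "(\<integral>\<^sup>+\<omega>. ennreal (norm (X \<omega>) ^ r) \<partial>M)
     \<le> (\<integral>\<^sup>+\<omega>. (\<Sum>j\<in>UNIV. ennreal ?c * (ennreal (exp (1 / A * X \<omega> $ j)) + ennreal (exp (- 1 / A * X \<omega> $ j)))) \<partial>M)"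
  proof (intro nn_integral_mono)
    fix \<omega>
    show "ennreal (norm (X \<omega>) ^ r) \<le> (\<Sum>j\<in>UNIV. ennreal ?c * (ennreal (exp (1 / A * X \<omega> $ j)) + ennreal (exp (- 1 / A * X \<omega> $ j))))"
      using ennreal_leI[OF pt[of \<omega>]] c
      by (simp only: ennreal_plus[symmetric] ennreal_mult[symmetric] exp_ge_zero add_nonneg_nonneg sum_ennreal mult_nonneg_nonneg)
  qed
  also have "\<dots> = (\<Sum>j\<in>UNIV. ennreal ?c * ((\<integral>\<^sup>+\<omega>. ennreal (exp (1 / A * X \<omega> $ j)) \<partial>M) + (\<integral>\<^sup>+\<omega>. ennreal (exp (- 1 / A * X \<omega> $ j)) \<partial>M)))"
  proof -
    have "(\<integral>\<^sup>+\<omega>. ennreal ?c * (ennreal (exp (1 / A * X \<omega> $ j)) + ennreal (exp (- 1 / A * X \<omega> $ j))) \<partial>M)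
      = ennreal ?c * ((\<integral>\<^sup>+\<omega>. ennreal (exp (1 / A * X \<omega> $ j)) \<partial>M) + (\<integral>\<^sup>+\<omega>. ennreal (exp (- 1 / A * X \<omega> $ j)) \<partial>M))" for j
      by (subst nn_integral_cmult) (measurable, subst nn_integral_add, measurable)
    moreover have "(\<lambda>\<omega>. ennreal ?c * (ennreal (exp (1 / A * X \<omega> $ j)) + ennreal (exp (- 1 / A * X \<omega> $ j)))) \<in> borel_measurable M" for j
      by measurable
    ultimately show ?thesis by (simp only: nn_integral_sum)
  qed
  also have "\<dots> \<le> (\<Sum>j\<in>(UNIV :: 'd set). ennreal ?c * (ennreal (exp (T / 2)) + ennreal (exp (T / 2))))"
    using A by (intro sum_mono mult_left_mono add_mono ex) auto
  also have "\<dots> = ennreal (real CARD('d) * (?c * (exp (T / 2) + exp (T / 2))))"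
    using c by (simp add: ennreal_mult[symmetric] ennreal_plus[symmetric] ennreal_of_nat_eq_real_of_nat del: ennreal_plus)
  also have "real CARD('d) * (?c * (exp (T / 2) + exp (T / 2))) = real CARD('d) ^ r * (2 * fact r * exp (T / 2)) * A ^ r"
    using r by (cases r) (auto simp: algebra_simps)
  finally show ?thesis by (simp only: X_def)
qed

end

lemma ennreal_power2_add_le:
  "ennreal ((x + y)\<^sup>2) \<le> 2 * ennreal (x\<^sup>2) + 2 * ennreal (y\<^sup>2)" for x y :: real
proof -
  have "(x + y)\<^sup>2 \<le> 2 * x\<^sup>2 + 2 * y\<^sup>2"
    using zero_le_power2[of "x - y"] by (simp add: power2_eq_square algebra_simps)
  then have "ennreal ((x + y)\<^sup>2) \<le> ennreal (2 * x\<^sup>2 + 2 * y\<^sup>2)" by (rule ennreal_leI)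
  then show ?thesis by (simp add: ennreal_mult ennreal_plus)
qed

section \<open>Sums of noise increments and their moments\<close>

context brownian
begin

abbreviation noise :: "real^'d^'m \<Rightarrow> real \<Rightarrow> real \<Rightarrow> 'a \<Rightarrow> real^'m" where
  "noise S s t \<omega> \<equiv> S *v (W t \<omega> - W s \<omega>)"

text \<open>The squared Frobenius norm of \<open>S\<close>, that is the trace of \<open>S\<close>
  times its transpose; half of it is the growth rate of the mean energy.\<close>

definition noise_rate :: "real^'d^'m \<Rightarrow> real" where
  "noise_rate S = (\<Sum>i\<in>UNIV. \<Sum>j\<in>UNIV. (S $ i $ j)\<^sup>2)"

lemma noise_rate_nonneg: "0 \<le> noise_rate S"
  by (simp add: noise_rate_def sum_nonneg)

lemma increment_integrable:
  assumes st: "0 \<le> s" "s < t"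
  shows "integrable M (\<lambda>\<omega>. W t \<omega> - W s \<omega>)" "expectation (\<lambda>\<omega>. W t \<omega> - W s \<omega>) = 0"
proof -
  have j: "integrable M (\<lambda>\<omega>. (W t \<omega> - W s \<omega>) $ j)" for j
    using increment_moments(1)[OF st, of j 1] by simp
  show int: "integrable M (\<lambda>\<omega>. W t \<omega> - W s \<omega>)"
  proof (rule Bochner_Integration.integrable_bound)
    show "integrable M (\<lambda>\<omega>. \<Sum>j\<in>UNIV. \<bar>(W t \<omega> - W s \<omega>) $ j\<bar>)"
      by (intro Bochner_Integration.integrable_sum integrable_abs j)
    show "(\<lambda>\<omega>. W t \<omega> - W s \<omega>) \<in> borel_measurable M"
      using st by (intro borel_measurable_diff W_measurable) auto
    show "AE \<omega> in M. norm (W t \<omega> - W s \<omega>) \<le> norm (\<Sum>j\<in>UNIV. \<bar>(W t \<omega> - W s \<omega>) $ j\<bar>)"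
      by (intro AE_I2) (metis norm_le_l1_cart abs_ge_self order_trans real_norm_def)
  qed
  have "expectation (\<lambda>\<omega>. W t \<omega> - W s \<omega>) $ j = 0" for j
    using integral_bounded_linear[OF bounded_linear_vec_nth int, of j] increment_moments(2)[OF st, of j]
    by simp
  then show "expectation (\<lambda>\<omega>. W t \<omega> - W s \<omega>) = 0" by (simp add: vec_eq_iff)
qed

lemma noise_measurable: "0 \<le> s \<Longrightarrow> 0 \<le> t \<Longrightarrow> noise S s t \<in> borel_measurable M"
  by (intro measurable_compose[OF borel_measurable_diff[OF W_measurable W_measurable]]
      borel_measurable_continuous_onI linear_continuous_on matrix_vector_mul_bounded_linear)

lemma noise_integrable:
  assumes st: "0 \<le> s" "s < t"
  shows "integrable M (noise S s t)" "expectation (noise S s t) = 0"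
  using integrable_bounded_linear[OF matrix_vector_mul_bounded_linear increment_integrable(1)[OF st], of S]
    integral_bounded_linear[OF matrix_vector_mul_bounded_linear increment_integrable(1)[OF st], of S]
    increment_integrable(2)[OF st]
  by simp_all

lemma noise_square:
  assumes st: "0 \<le> s" "s < t"
  shows "integrable M (\<lambda>\<omega>. (norm (noise S s t \<omega>))\<^sup>2)"
    and "expectation (\<lambda>\<omega>. (norm (noise S s t \<omega>))\<^sup>2) = noise_rate S * (t - s)"
proof -
  have eq: "(norm (S *v x))\<^sup>2 = (\<Sum>i\<in>UNIV. \<Sum>j\<in>UNIV. \<Sum>k\<in>UNIV. (S $ i $ j * S $ i $ k) * (x $ j * x $ k))" for x
    by (simp add: power2_norm_eq_inner inner_vec_def matrix_vector_mult_def sum_product ac_simps)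
  note int = increment_product_expectation(1)[OF st]
  show "integrable M (\<lambda>\<omega>. (norm (noise S s t \<omega>))\<^sup>2)"
    unfolding eq by (intro Bochner_Integration.integrable_sum integrable_mult_right int)
  have "expectation (\<lambda>\<omega>. (norm (noise S s t \<omega>))\<^sup>2)
      = (\<Sum>i\<in>UNIV. \<Sum>j\<in>UNIV. \<Sum>k\<in>UNIV. (S $ i $ j * S $ i $ k) * expectation (\<lambda>\<omega>. (W t \<omega> - W s \<omega>) $ j * (W t \<omega> - W s \<omega>) $ k))"
    unfolding eq by (simp only: Bochner_Integration.integral_sum Bochner_Integration.integrable_sum
      integrable_mult_right int integral_mult_right_zero)
  also have "\<dots> = (\<Sum>i\<in>UNIV. \<Sum>j\<in>UNIV. \<Sum>k\<in>UNIV. if j = k then (S $ i $ j)\<^sup>2 * (t - s) else 0)"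
    unfolding increment_product_expectation(2)[OF st] by (intro sum.cong refl) (auto simp: power2_eq_square)
  also have "\<dots> = noise_rate S * (t - s)"
    by (simp add: noise_rate_def sum_distrib_right)
  finally show "expectation (\<lambda>\<omega>. (norm (noise S s t \<omega>))\<^sup>2) = noise_rate S * (t - s)" .
qed

lemma noise_square_nn:
  assumes st: "0 \<le> s" "s < t"
  shows "(\<integral>\<^sup>+\<omega>. ennreal ((norm (noise S s t \<omega>))\<^sup>2) \<partial>M) = ennreal (noise_rate S * (t - s))"
  using nn_integral_eq_integral[OF noise_square(1)[OF st, of S]] noise_square(2)[OF st, of S] by simp

text \<open>The 3 is the fourth moment of a standard normal variable. One factor
  \<open>CARD('d)\<close> comes from squaring a sum over coordinates, the other from summing the
  fourth moments.\<close>

definition noise_fourth :: "real^'d^'m \<Rightarrow> real" where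
  "noise_fourth S = onorm (\<lambda>x. S *v x) ^ 4 * (3 * (real CARD('d))\<^sup>2)"

lemma noise_fourth_moment:
  assumes st: "0 \<le> s" "s < t"
  shows "integrable M (\<lambda>\<omega>. norm (noise S s t \<omega>) ^ 4)"
    and "expectation (\<lambda>\<omega>. norm (noise S s t \<omega>) ^ 4) \<le> noise_fourth S * (t - s)\<^sup>2"
proof -
  let ?o = "onorm (\<lambda>x. S *v x)"
  have pt: "norm (S *v x) ^ 4 \<le> ?o ^ 4 * (real CARD('d) * (\<Sum>j\<in>UNIV. x $ j ^ 4))" for x
  proof -
    have "norm (S *v x) ^ 4 \<le> (?o * norm x) ^ 4"
      by (intro power_mono onorm matrix_vector_mul_bounded_linear) auto
    also have "\<dots> = ?o ^ 4 * ((norm x)\<^sup>2)\<^sup>2" by (simp add: power_mult_distrib)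
    also have "((norm x)\<^sup>2)\<^sup>2 = (\<Sum>j\<in>UNIV. 1 * (x $ j)\<^sup>2)\<^sup>2"
      by (simp only: power2_norm_eq_inner inner_vec_def inner_real_def) (simp only: power2_eq_square mult_1)
    also have "\<dots> \<le> real CARD('d) ^ (2 - 1) * (\<Sum>j\<in>UNIV. 1 * ((x $ j)\<^sup>2)\<^sup>2)"
      by (intro power_sum_le_sum_power) auto
    finally show ?thesis by (simp add: mult_left_mono)
  qed
  have int: "integrable M (\<lambda>\<omega>. ?o ^ 4 * (real CARD('d) * (\<Sum>j\<in>UNIV. (W t \<omega> - W s \<omega>) $ j ^ 4)))"
    by (intro integrable_mult_right Bochner_Integration.integrable_sum increment_moments(1)[OF st])
  show int4: "integrable M (\<lambda>\<omega>. norm (noise S s t \<omega>) ^ 4)"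
  proof (rule Bochner_Integration.integrable_bound[OF int])
    show "(\<lambda>\<omega>. norm (noise S s t \<omega>) ^ 4) \<in> borel_measurable M"
      using noise_measurable[of s t S] st by (intro borel_measurable_power borel_measurable_norm) auto
    show "AE \<omega> in M. norm (norm (noise S s t \<omega>) ^ 4)
      \<le> norm (?o ^ 4 * (real CARD('d) * (\<Sum>j\<in>UNIV. (W t \<omega> - W s \<omega>) $ j ^ 4)))"
      by (intro AE_I2) (simp only: real_norm_def abs_of_nonneg[OF zero_le_power[OF norm_ge_zero]]
          order_trans[OF pt abs_ge_self])
  qed
  have "expectation (\<lambda>\<omega>. norm (noise S s t \<omega>) ^ 4)
    \<le> expectation (\<lambda>\<omega>. ?o ^ 4 * (real CARD('d) * (\<Sum>j\<in>UNIV. (W t \<omega> - W s \<omega>) $ j ^ 4)))"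
    by (intro integral_mono int int4 pt)
  also have "\<dots> = ?o ^ 4 * (real CARD('d) * (\<Sum>j\<in>(UNIV :: 'd set). 3 * (t - s)\<^sup>2))"
    by (simp only: integral_mult_right_zero Bochner_Integration.integral_sum increment_moments(1)[OF st]
        increment_moments(4)[OF st])
  also have "\<dots> = noise_fourth S * (t - s)\<^sup>2"
    by (simp add: noise_fourth_def power2_eq_square)
  finally show "expectation (\<lambda>\<omega>. norm (noise S s t \<omega>) ^ 4) \<le> noise_fourth S * (t - s)\<^sup>2" .
qed

lemma noise_fourth_nonneg: "0 \<le> noise_fourth S"
  by (simp add: noise_fourth_def)

text \<open>The martingale difference property. It asks for integrability of the product instead of
  moments of \<open>X\<close>, since for the scheme without a lower bound on \<open>V\<close> the
  product is known to be integrable only through the energies.\<close>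

lemma expectation_inner_noise:
  assumes st: "0 \<le> s" "s < t" and X: "X \<in> borel_measurable (F s)"
    and int: "integrable M (\<lambda>\<omega>. X \<omega> \<bullet> noise S s t \<omega>)"
  shows "expectation (\<lambda>\<omega>. X \<omega> \<bullet> noise S s t \<omega>) = 0"
proof -
  have "indep_var borel X borel (noise S s t)"
    by (rule indep_increment[OF st X])
      (intro borel_measurable_continuous_onI linear_continuous_on matrix_vector_mul_bounded_linear)
  then show ?thesis
    by (rule indep_var_expectation_inner_eq_0[OF _ int noise_integrable[OF st]])
qed

text \<open>Cauchy-Schwarz inside the expectation, after which independence factorises the second
  moments; that of \<open>X\<close> may be infinite.\<close>

lemma inner_noise_square:
  assumes st: "0 \<le> s" "s < t" and X: "X \<in> borel_measurable (F s)"
  shows "(\<integral>\<^sup>+\<omega>. ennreal ((X \<omega> \<bullet> noise S s t \<omega>)\<^sup>2) \<partial>M)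
    \<le> (\<integral>\<^sup>+\<omega>. ennreal ((norm (X \<omega>))\<^sup>2) \<partial>M) * ennreal (noise_rate S * (t - s))"
proof -
  have ind: "indep_var borel X borel (noise S s t)"
    by (rule indep_increment[OF st X])
      (intro borel_measurable_continuous_onI linear_continuous_on matrix_vector_mul_bounded_linear)
  have "(\<integral>\<^sup>+\<omega>. ennreal ((X \<omega> \<bullet> noise S s t \<omega>)\<^sup>2) \<partial>M)
    \<le> (\<integral>\<^sup>+\<omega>. ennreal ((norm (X \<omega>))\<^sup>2) * ennreal ((norm (noise S s t \<omega>))\<^sup>2) \<partial>M)"
    using Cauchy_Schwarz_ineq by (intro nn_integral_mono)
      (simp add: ennreal_mult[symmetric] power2_norm_eq_inner ennreal_leI)
  also have "\<dots> = (\<integral>\<^sup>+\<omega>. ennreal ((norm (X \<omega>))\<^sup>2) \<partial>M) * (\<integral>\<^sup>+\<omega>. ennreal ((norm (noise S s t \<omega>))\<^sup>2) \<partial>M)"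
    by (rule indep_var_nn_integral_mult[OF ind, of "\<lambda>x. ennreal ((norm x)\<^sup>2)" "\<lambda>x. ennreal ((norm x)\<^sup>2)"]) auto
  finally show ?thesis by (simp only: noise_square_nn[OF st])
qed

text \<open>An Ito sum: the integrand belongs to the left end of each cell of the grid with offset
  \<open>u\<close> and mesh \<open>\<delta>\<close>.\<close>

definition noise_sum :: "real^'d^'m \<Rightarrow> real \<Rightarrow> real \<Rightarrow> (nat \<Rightarrow> 'a \<Rightarrow> real^'m) \<Rightarrow> nat \<Rightarrow> 'a \<Rightarrow> real" where
  "noise_sum S u \<delta> \<psi> n \<omega> = (\<Sum>k<n. \<psi> k \<omega> \<bullet> noise S (u + real k * \<delta>) (u + real (Suc k) * \<delta>) \<omega>)"

definition half_quadratic_variation :: "real^'d^'m \<Rightarrow> real \<Rightarrow> real \<Rightarrow> nat \<Rightarrow> 'a \<Rightarrow> real" where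
  "half_quadratic_variation S u \<delta> n \<omega> = (\<Sum>k<n. (norm (noise S (u + real k * \<delta>) (u + real (Suc k) * \<delta>) \<omega>))\<^sup>2 / 2)"

lemma noise_sum_measurable:
  assumes u: "0 \<le> u" and \<delta>: "\<delta> > 0"
    and \<psi>: "\<And>k. k < n \<Longrightarrow> \<psi> k \<in> borel_measurable (F (u + real k * \<delta>))"
  shows "noise_sum S u \<delta> \<psi> n \<in> borel_measurable (F (u + real n * \<delta>))"
  unfolding noise_sum_def[abs_def]
proof (intro borel_measurable_sum borel_measurable_inner)
  fix k assume "k \<in> {..<n}"
  then have k: "Suc k \<le> n" by auto
  have le: "u + real i * \<delta> \<le> u + real n * \<delta>" if "i \<le> n" for i using that \<delta> by simp
  have nn: "0 \<le> u + real i * \<delta>" for i using u \<delta> by simp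
  show "\<psi> k \<in> borel_measurable (F (u + real n * \<delta>))"
    using k by (intro measurable_F_mono[OF nn le \<psi>]) auto
  show "noise S (u + real k * \<delta>) (u + real (Suc k) * \<delta>) \<in> borel_measurable (F (u + real n * \<delta>))"
    using k by (intro measurable_compose[OF borel_measurable_diff[OF measurable_F_mono[OF nn le W_measurable_F[OF nn]]
          measurable_F_mono[OF nn le W_measurable_F[OF nn]]]]
      borel_measurable_continuous_onI linear_continuous_on matrix_vector_mul_bounded_linear) auto
qed

text \<open>The discrete Ito isometry, as an inequality because each product is bounded by
  Cauchy-Schwarz. Summands of different cells are orthogonal, since everything before the last
  increment is known when that increment starts.\<close>

lemma noise_sum_moments:
  assumes u: "0 \<le> u" and \<delta>: "\<delta> > 0"
    and \<psi>: "\<And>k. k < n \<Longrightarrow> \<psi> k \<in> borel_measurable (F (u + real k * \<delta>))"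
    and fin: "\<And>k. k < n \<Longrightarrow> (\<integral>\<^sup>+\<omega>. ennreal ((norm (\<psi> k \<omega>))\<^sup>2) \<partial>M) < \<infinity>"
  shows "integrable M (noise_sum S u \<delta> \<psi> n)"
    and "expectation (noise_sum S u \<delta> \<psi> n) = 0"
    and "(\<integral>\<^sup>+\<omega>. ennreal ((noise_sum S u \<delta> \<psi> n \<omega>)\<^sup>2) \<partial>M)
      \<le> (\<Sum>k<n. \<integral>\<^sup>+\<omega>. ennreal ((norm (\<psi> k \<omega>))\<^sup>2) \<partial>M) * ennreal (noise_rate S * \<delta>)"
proof -
  \<comment> \<open>Square integrability joins the induction: it makes the mixed term of the partial
    sum and the next summand integrable.\<close>
  have "integrable M (\<lambda>\<omega>. (noise_sum S u \<delta> \<psi> n \<omega>)\<^sup>2) \<and> integrable M (noise_sum S u \<delta> \<psi> n) \<and>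
    expectation (noise_sum S u \<delta> \<psi> n) = 0 \<and>
    (\<integral>\<^sup>+\<omega>. ennreal ((noise_sum S u \<delta> \<psi> n \<omega>)\<^sup>2) \<partial>M)
      \<le> (\<Sum>k<n. \<integral>\<^sup>+\<omega>. ennreal ((norm (\<psi> k \<omega>))\<^sup>2) \<partial>M) * ennreal (noise_rate S * \<delta>)"
    using \<psi> fin
  proof (induction n)
    case 0 then show ?case by (simp add: noise_sum_def)
  next
    case (Suc n)
    let ?s = "u + real n * \<delta>" and ?t = "u + real (Suc n) * \<delta>"
    let ?X = "noise_sum S u \<delta> \<psi> n"
    let ?Y = "\<lambda>\<omega>. \<psi> n \<omega> \<bullet> noise S ?s ?t \<omega>"
    have st: "0 \<le> ?s" "?s < ?t" using u \<delta> by auto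
    have IH: "integrable M (\<lambda>\<omega>. (?X \<omega>)\<^sup>2)" "integrable M ?X" "expectation ?X = 0"
      "(\<integral>\<^sup>+\<omega>. ennreal ((?X \<omega>)\<^sup>2) \<partial>M)
        \<le> (\<Sum>k<n. \<integral>\<^sup>+\<omega>. ennreal ((norm (\<psi> k \<omega>))\<^sup>2) \<partial>M) * ennreal (noise_rate S * \<delta>)"
      using Suc.IH Suc.prems by auto
    have XF: "?X \<in> borel_measurable (F ?s)"
      using Suc.prems by (intro noise_sum_measurable u \<delta>) auto
    have \<psi>F: "\<psi> n \<in> borel_measurable (F ?s)" using Suc.prems by simp
    have YM: "?Y \<in> borel_measurable M"
      using st by (intro borel_measurable_inner measurable_F_imp[OF st(1) \<psi>F] noise_measurable) auto
    have Y2: "(\<integral>\<^sup>+\<omega>. ennreal ((?Y \<omega>)\<^sup>2) \<partial>M)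
      \<le> (\<integral>\<^sup>+\<omega>. ennreal ((norm (\<psi> n \<omega>))\<^sup>2) \<partial>M) * ennreal (noise_rate S * \<delta>)"
    proof -
      have "?t - ?s = \<delta>" by (simp add: algebra_simps)
      then show ?thesis using inner_noise_square[OF st \<psi>F, of S] by simp
    qed
    also have "\<dots> < \<infinity>" using Suc.prems(2)[of n] by (simp add: ennreal_mult_less_top)
    finally have Yfin: "(\<integral>\<^sup>+\<omega>. ennreal ((?Y \<omega>)\<^sup>2) \<partial>M) < \<infinity>" .
    note iY = square_nn_finite_imp_integrable[OF YM Yfin]
    have eY: "expectation ?Y = 0" by (rule expectation_inner_noise[OF st \<psi>F iY(2)])
    have iXY: "integrable M (\<lambda>\<omega>. ?X \<omega> * ?Y \<omega>)"
    proof (rule Bochner_Integration.integrable_bound)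
      show "integrable M (\<lambda>\<omega>. (?X \<omega>)\<^sup>2 + (?Y \<omega>)\<^sup>2)" using IH(1) iY(1) by simp
      show "(\<lambda>\<omega>. ?X \<omega> * ?Y \<omega>) \<in> borel_measurable M"
        by (intro borel_measurable_times YM measurable_F_imp[OF st(1) XF])
      have "\<bar>x * y\<bar> \<le> x\<^sup>2 + y\<^sup>2" for x y :: real
        using zero_le_power2[of "\<bar>x\<bar> - \<bar>y\<bar>"] zero_le_power2[of x] zero_le_power2[of y]
        unfolding power2_diff power2_abs abs_mult by linarith
      then show "AE \<omega> in M. norm (?X \<omega> * ?Y \<omega>) \<le> norm ((?X \<omega>)\<^sup>2 + (?Y \<omega>)\<^sup>2)" by simp
    qed
    \<comment> \<open>The partial sum is moved into the integrand: its product with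
      \<open>\<psi> n\<close> is still known at time \<open>?s\<close>.\<close>
    have eXY: "expectation (\<lambda>\<omega>. ?X \<omega> * ?Y \<omega>) = 0"
    proof -
      have "expectation (\<lambda>\<omega>. (?X \<omega> *\<^sub>R \<psi> n \<omega>) \<bullet> noise S ?s ?t \<omega>) = 0"
        using iXY by (intro expectation_inner_noise[OF st] borel_measurable_scaleR XF \<psi>F) simp
      then show ?thesis by simp
    qed
    have step: "noise_sum S u \<delta> \<psi> (Suc n) = (\<lambda>\<omega>. ?X \<omega> + ?Y \<omega>)"
      by (simp add: noise_sum_def[abs_def])
    have i2: "integrable M (\<lambda>\<omega>. (?X \<omega> + ?Y \<omega>)\<^sup>2)"
      unfolding power2_sum using IH(1) iY(1) iXY by (simp add: mult.assoc)
    have e2: "expectation (\<lambda>\<omega>. (?X \<omega> + ?Y \<omega>)\<^sup>2) = expectation (\<lambda>\<omega>. (?X \<omega>)\<^sup>2) + expectation (\<lambda>\<omega>. (?Y \<omega>)\<^sup>2)"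
      unfolding power2_sum using IH(1) iY(1) iXY eXY by (simp add: mult.assoc)
    have "(\<integral>\<^sup>+\<omega>. ennreal ((?X \<omega> + ?Y \<omega>)\<^sup>2) \<partial>M) = (\<integral>\<^sup>+\<omega>. ennreal ((?X \<omega>)\<^sup>2) \<partial>M) + (\<integral>\<^sup>+\<omega>. ennreal ((?Y \<omega>)\<^sup>2) \<partial>M)"
      using IH(1) iY(1) i2 e2 by (simp add: nn_integral_eq_integral)
    also have "\<dots> \<le> (\<Sum>k<Suc n. \<integral>\<^sup>+\<omega>. ennreal ((norm (\<psi> k \<omega>))\<^sup>2) \<partial>M) * ennreal (noise_rate S * \<delta>)"
      using add_mono[OF IH(4) Y2] by (simp add: distrib_right)
    finally show ?case
      unfolding step using i2 IH(2,3) iY(2) eY by simp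
  qed
  then show "integrable M (noise_sum S u \<delta> \<psi> n)" "expectation (noise_sum S u \<delta> \<psi> n) = 0"
    "(\<integral>\<^sup>+\<omega>. ennreal ((noise_sum S u \<delta> \<psi> n \<omega>)\<^sup>2) \<partial>M)
      \<le> (\<Sum>k<n. \<integral>\<^sup>+\<omega>. ennreal ((norm (\<psi> k \<omega>))\<^sup>2) \<partial>M) * ennreal (noise_rate S * \<delta>)"
    by auto
qed

lemma half_quadratic_variation_moments:
  assumes u: "0 \<le> u" and \<delta>: "\<delta> > 0"
  shows "integrable M (half_quadratic_variation S u \<delta> n)"
    and "expectation (half_quadratic_variation S u \<delta> n) = noise_rate S / 2 * (real n * \<delta>)"
    and "(\<integral>\<^sup>+\<omega>. ennreal ((half_quadratic_variation S u \<delta> n \<omega>)\<^sup>2) \<partial>M) \<le> ennreal (noise_fourth S * (real n * \<delta>)\<^sup>2)"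
proof -
  let ?\<xi> = "\<lambda>k. noise S (u + real k * \<delta>) (u + real (Suc k) * \<delta>)"
  have st: "0 \<le> u + real k * \<delta>" "u + real k * \<delta> < u + real (Suc k) * \<delta>" for k using u \<delta> by auto
  have d: "u + real (Suc k) * \<delta> - (u + real k * \<delta>) = \<delta>" for k by (simp add: algebra_simps)
  show int: "integrable M (half_quadratic_variation S u \<delta> n)"
    unfolding half_quadratic_variation_def[abs_def]
    by (intro Bochner_Integration.integrable_sum integrable_divide noise_square(1) st)
  have "expectation (half_quadratic_variation S u \<delta> n) = (\<Sum>k<n. expectation (\<lambda>\<omega>. (norm (?\<xi> k \<omega>))\<^sup>2 / 2))"
    unfolding half_quadratic_variation_def[abs_def]
    by (intro Bochner_Integration.integral_sum integrable_divide noise_square(1) st)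
  also have "\<dots> = (\<Sum>k<n. noise_rate S / 2 * \<delta>)"
    by (intro sum.cong refl) (simp only: integral_divide_zero noise_square(2)[OF st] d times_divide_eq_left)
  finally show "expectation (half_quadratic_variation S u \<delta> n) = noise_rate S / 2 * (real n * \<delta>)"
    by simp
  \<comment> \<open>Jensen contributes one factor \<open>n\<close>, and the sum of \<open>n\<close>
    fourth moments, each of order \<open>\<delta>\<close> squared, another: the resulting bound sees
    only the total time \<open>n * \<delta>\<close>.\<close>
  have pt: "(half_quadratic_variation S u \<delta> n \<omega>)\<^sup>2 \<le> real n * (\<Sum>k<n. norm (?\<xi> k \<omega>) ^ 4)" for \<omega>
  proof -
    have "(half_quadratic_variation S u \<delta> n \<omega>)\<^sup>2 = (\<Sum>k<n. 1 * ((norm (?\<xi> k \<omega>))\<^sup>2 / 2))\<^sup>2"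
      by (simp add: half_quadratic_variation_def)
    also have "\<dots> \<le> real n ^ (2 - 1) * (\<Sum>k<n. 1 * ((norm (?\<xi> k \<omega>))\<^sup>2 / 2)\<^sup>2)"
      by (intro power_sum_le_sum_power) auto
    also have "\<dots> \<le> real n * (\<Sum>k<n. norm (?\<xi> k \<omega>) ^ 4)"
      by (auto intro!: mult_left_mono sum_mono simp: power_divide)
    finally show ?thesis .
  qed
  have i4: "integrable M (\<lambda>\<omega>. real n * (\<Sum>k<n. norm (?\<xi> k \<omega>) ^ 4))"
    by (intro integrable_mult_right Bochner_Integration.integrable_sum noise_fourth_moment(1) st)
  have "(\<integral>\<^sup>+\<omega>. ennreal ((half_quadratic_variation S u \<delta> n \<omega>)\<^sup>2) \<partial>M)
    \<le> (\<integral>\<^sup>+\<omega>. ennreal (real n * (\<Sum>k<n. norm (?\<xi> k \<omega>) ^ 4)) \<partial>M)"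
    by (intro nn_integral_mono ennreal_leI pt)
  also have "\<dots> = ennreal (expectation (\<lambda>\<omega>. real n * (\<Sum>k<n. norm (?\<xi> k \<omega>) ^ 4)))"
    by (intro nn_integral_eq_integral i4) (auto intro!: mult_nonneg_nonneg sum_nonneg)
  also have "expectation (\<lambda>\<omega>. real n * (\<Sum>k<n. norm (?\<xi> k \<omega>) ^ 4)) = real n * (\<Sum>k<n. expectation (\<lambda>\<omega>. norm (?\<xi> k \<omega>) ^ 4))"
    by (simp only: integral_mult_right_zero Bochner_Integration.integral_sum noise_fourth_moment(1)[OF st])
  also have "\<dots> \<le> real n * (\<Sum>k<n. noise_fourth S * \<delta>\<^sup>2)"
    by (intro mult_left_mono sum_mono noise_fourth_moment(2)[OF st, of S, unfolded d]) simp
  also have "\<dots> = noise_fourth S * (real n * \<delta>)\<^sup>2" by (simp add: power2_eq_square)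
  finally show "(\<integral>\<^sup>+\<omega>. ennreal ((half_quadratic_variation S u \<delta> n \<omega>)\<^sup>2) \<partial>M) \<le> ennreal (noise_fourth S * (real n * \<delta>)\<^sup>2)"
    by (simp add: ennreal_leI)
qed

end

subsection \<open>Energy of the exact solution\<close>

lemma gderiv_imp_continuous_on:
  "(\<And>x. GDERIV f x :> f' x) \<Longrightarrow> continuous_on UNIV f"
  by (auto simp: continuous_on_eq_continuous_at gderiv_def intro: has_derivative_continuous)

lemma hamiltonian_eq: "hamiltonian V p q = (norm p)\<^sup>2 / 2 + V q"
  unfolding power2_norm_eq_inner inner_vec_def by (simp add: hamiltonian_def power2_eq_square)

text \<open>One sample path of the system. The noise enters as an arbitrary additive path
  \<open>B\<close>, which makes the energy balance below a matter of ordinary calculus.\<close>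

locale hamiltonian_path =
  fixes V :: "real^'m \<Rightarrow> real" and V' :: "real^'m \<Rightarrow> real^'m"
    and B p q :: "real \<Rightarrow> real^'m" and x y :: "real^'m"
  assumes gderiv: "\<And>x. GDERIV V x :> V' x" and cont_V': "continuous_on UNIV V'"
    and cont_p: "continuous_on {0..} p" and cont_q: "continuous_on {0..} q"
    and q_eq: "\<And>t. 0 \<le> t \<Longrightarrow> q t = y + integral {0..t} p"
    and p_eq: "\<And>t. 0 \<le> t \<Longrightarrow> p t = x - integral {0..t} (\<lambda>s. V' (q s)) + B t"
begin

lemma cont_V'_q: "continuous_on {0..} (\<lambda>s. V' (q s))"
  using continuous_on_compose2[OF cont_V' cont_q] by auto

lemma integrable_path:
  assumes "0 \<le> s"
  shows "p integrable_on {s..t}" "(\<lambda>s. V' (q s)) integrable_on {s..t}"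
    "(\<lambda>s. V' (q s) \<bullet> p s) integrable_on {s..t}"
proof -
  have "{s..t} \<subseteq> {0..}" using assms by auto
  then show "p integrable_on {s..t}" "(\<lambda>s. V' (q s)) integrable_on {s..t}"
    "(\<lambda>s. V' (q s) \<bullet> p s) integrable_on {s..t}"
    by (intro integrable_continuous_interval continuous_on_inner
        continuous_on_subset[OF cont_p] continuous_on_subset[OF cont_V'_q]; assumption)+
qed

lemma p_increment:
  assumes "0 \<le> s" "s \<le> t"
  shows "p t - p s = B t - B s - integral {s..t} (\<lambda>s. V' (q s))"
  using Henstock_Kurzweil_Integration.integral_combine[OF assms integrable_path(2)[of 0], symmetric] assms
  by (simp add: p_eq)

lemma q_increment:
  assumes "0 \<le> s" "s \<le> t"
  shows "q t - q s = integral {s..t} p"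
  using Henstock_Kurzweil_Integration.integral_combine[OF assms integrable_path(1)[of 0], symmetric] assms
  by (simp add: q_eq)

text \<open>Being an integral of the continuous \<open>p\<close>, the position is continuously
  differentiable, and the chain rule holds without an Ito correction.\<close>

lemma potential_increment:
  assumes st: "0 \<le> s" "s \<le> t"
  shows "V (q t) - V (q s) = integral {s..t} (\<lambda>\<tau>. V' (q \<tau>) \<bullet> p \<tau>)"
proof -
  have "((\<lambda>\<tau>. V (q \<tau>)) has_vector_derivative V' (q \<tau>) \<bullet> p \<tau>) (at \<tau> within {s..t})" if \<tau>: "\<tau> \<in> {s..t}" for \<tau>
  proof -
    have "((\<lambda>u. y + integral {0..u} p) has_vector_derivative p \<tau>) (at \<tau> within {0..t})"
      using \<tau> st by (auto intro!: derivative_eq_intros integral_has_vector_derivative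
          intro: continuous_on_subset[OF cont_p])
    then have "(q has_vector_derivative p \<tau>) (at \<tau> within {0..t})"
      by (rule has_vector_derivative_transform[rotated 2]) (use \<tau> st q_eq in auto)
    then have "(q has_vector_derivative p \<tau>) (at \<tau> within {s..t})"
      by (rule has_vector_derivative_within_subset) (use st in auto)
    then have "(q has_derivative (\<lambda>h. h *\<^sub>R p \<tau>)) (at \<tau> within {s..t})"
      by (simp add: has_vector_derivative_def)
    from has_derivative_compose[OF this gderiv[unfolded gderiv_def]]
    show ?thesis by (simp add: has_vector_derivative_def inner_commute)
  qed
  then have "((\<lambda>\<tau>. V' (q \<tau>) \<bullet> p \<tau>) has_integral (V (q t) - V (q s))) {s..t}"
    using st by (intro fundamental_theorem_of_calculus) auto
  then show ?thesis by (simp add: integral_unique)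
qed

definition energy :: "real \<Rightarrow> real" where
  "energy t = hamiltonian V (p t) (q t)"

text \<open>The failure of the exact solution to satisfy, over one cell, the energy identity that
  the scheme satisfies exactly.\<close>

definition energy_residual :: "real \<Rightarrow> real \<Rightarrow> real" where
  "energy_residual s t = energy t - energy s - p s \<bullet> (B t - B s) - (norm (B t - B s))\<^sup>2 / 2"

lemma continuous_on_energy: "continuous_on {0..} energy"
proof -
  have "continuous_on {0..} (\<lambda>t. V (q t))"
    by (rule continuous_on_compose2[OF gderiv_imp_continuous_on[OF gderiv] cont_q]) auto
  then show ?thesis
    unfolding energy_def[abs_def] hamiltonian_eq by (auto intro!: continuous_intros cont_p)
qed

text \<open>With \<open>r\<close> the integrated force, \<open>p t\<close> is \<open>p s\<close>
  plus noise minus \<open>r\<close>. Expanding the kinetic energy around the right end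
  \<open>p t\<close> absorbs the product of noise and force, and leaves the integral of
  \<open>V' (q \<tau>) \<bullet> (p \<tau> - p t)\<close> minus half the square of
  \<open>norm r\<close>. The first is small by continuity of \<open>p\<close>, the second is
  quadratic in the cell length.\<close>

lemma energy_residual_le:
  assumes st: "0 \<le> s" "s \<le> t"
    and K: "\<And>\<tau>. \<tau> \<in> {s..t} \<Longrightarrow> norm (V' (q \<tau>)) \<le> K"
    and e: "\<And>\<tau>. \<tau> \<in> {s..t} \<Longrightarrow> norm (p \<tau> - p t) \<le> e"
  shows "\<bar>energy_residual s t\<bar> \<le> K * e * (t - s) + K\<^sup>2 * (t - s)\<^sup>2 / 2"
proof -
  define r where "r = integral {s..t} (\<lambda>s. V' (q s))"
  have K0: "0 \<le> K" using K[of s] st norm_ge_zero order_trans by (metis atLeastAtMost_iff order_refl)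
  have pt: "p t = p s + (B t - B s) - r" using p_increment[OF st] by (simp add: r_def algebra_simps)
  have rp: "r \<bullet> p t = integral {s..t} (\<lambda>\<tau>. V' (q \<tau>) \<bullet> p t)"
    using integral_linear[OF integrable_path(2) bounded_linear_inner_left, of s t "p t"] st
    by (simp add: r_def o_def)
  have "energy_residual s t = integral {s..t} (\<lambda>\<tau>. V' (q \<tau>) \<bullet> p \<tau>) - r \<bullet> p t - (norm r)\<^sup>2 / 2"
    unfolding potential_increment[OF st, symmetric] energy_residual_def energy_def hamiltonian_eq
    by (simp add: pt power2_norm_eq_inner inner_add_left inner_add_right inner_diff_left inner_diff_right inner_commute field_simps)
  also have "integral {s..t} (\<lambda>\<tau>. V' (q \<tau>) \<bullet> p \<tau>) - r \<bullet> p t = integral {s..t} (\<lambda>\<tau>. V' (q \<tau>) \<bullet> (p \<tau> - p t))"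
    unfolding rp inner_diff_right
    using integral_diff[OF integrable_path(3)[OF st(1), of t]
        integrable_linear[OF integrable_path(2)[OF st(1), of t] bounded_linear_inner_left[of "p t"], unfolded o_def]]
    by simp
  finally have eq: "energy_residual s t = integral {s..t} (\<lambda>\<tau>. V' (q \<tau>) \<bullet> (p \<tau> - p t)) - (norm r)\<^sup>2 / 2" .
  have 1: "norm (integral {s..t} (\<lambda>\<tau>. V' (q \<tau>) \<bullet> (p \<tau> - p t))) \<le> (K * e) * (t - s)"
  proof (rule integral_bound[OF st(2)])
    show "continuous_on {s..t} (\<lambda>\<tau>. V' (q \<tau>) \<bullet> (p \<tau> - p t))"
      using st by (intro continuous_intros continuous_on_subset[OF cont_V'_q] continuous_on_subset[OF cont_p]) auto
    fix \<tau> assume \<tau>: "\<tau> \<in> {s..t}"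
    have "norm (V' (q \<tau>) \<bullet> (p \<tau> - p t)) \<le> norm (V' (q \<tau>)) * norm (p \<tau> - p t)"
      using Cauchy_Schwarz_ineq2 by simp
    also have "\<dots> \<le> K * e" using K[OF \<tau>] e[OF \<tau>] K0 by (intro mult_mono) auto
    finally show "norm (V' (q \<tau>) \<bullet> (p \<tau> - p t)) \<le> K * e" .
  qed
  have "norm r \<le> K * (t - s)"
    unfolding r_def using st K by (intro integral_bound continuous_on_subset[OF cont_V'_q]) auto
  then have "(norm r)\<^sup>2 \<le> (K * (t - s))\<^sup>2" by (intro power_mono) auto
  then have 2: "(norm r)\<^sup>2 / 2 \<le> K\<^sup>2 * (t - s)\<^sup>2 / 2" by (simp add: power_mult_distrib)
  have "0 \<le> (norm r)\<^sup>2 / 2" by simp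
  with 1 2 show ?thesis unfolding eq real_norm_def by linarith
qed

lemma energy_residual_sum_small:
  assumes T: "0 \<le> T" and \<epsilon>: "\<epsilon> > 0"
  obtains d where "d > 0"
    "\<And>u \<delta> n. 0 \<le> u \<Longrightarrow> 0 < \<delta> \<Longrightarrow> \<delta> < d \<Longrightarrow> u + real n * \<delta> \<le> T \<Longrightarrow>
      (\<Sum>k<n. \<bar>energy_residual (u + real k * \<delta>) (u + real (Suc k) * \<delta>)\<bar>) \<le> \<epsilon>"
proof -
  have "compact ((\<lambda>s. V' (q s)) ` {0..T})"
    by (intro compact_continuous_image continuous_on_subset[OF cont_V'_q]) auto
  from compact_imp_bounded[OF this, unfolded bounded_pos]
  obtain K where "K > 0" "\<forall>v\<in>(\<lambda>s. V' (q s)) ` {0..T}. norm v \<le> K" by blast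
  then have K: "K > 0" "\<And>\<tau>. \<tau> \<in> {0..T} \<Longrightarrow> norm (V' (q \<tau>)) \<le> K" by auto
  \<comment> \<open>Together with \<open>d\<close> below this splits \<open>\<epsilon>\<close>:
    summed over cells of total length at most \<open>T\<close>, the oscillation term and the
    quadratic term contribute at most half of it each. The \<open>T + 1\<close> avoids division by
    zero.\<close>
  define e where "e = \<epsilon> / (2 * K * (T + 1))"
  have e: "e > 0" using K(1) T \<epsilon> by (simp add: e_def)
  have "uniformly_continuous_on {0..T} p"
    by (intro compact_uniformly_continuous continuous_on_subset[OF cont_p]) auto
  then obtain d0 where d0: "d0 > 0" "\<And>s t. s \<in> {0..T} \<Longrightarrow> t \<in> {0..T} \<Longrightarrow> dist s t < d0 \<Longrightarrow> dist (p s) (p t) < e"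
    using e unfolding uniformly_continuous_on_def by metis
  define d where "d = min d0 (\<epsilon> / (K\<^sup>2 * (T + 1)))"
  have d: "d > 0" using d0 \<epsilon> K(1) T by (simp add: d_def)
  show thesis
  proof (rule that[OF d])
    fix u \<delta> :: real and n
    assume u: "0 \<le> u" and \<delta>: "0 < \<delta>" "\<delta> < d" and nT: "u + real n * \<delta> \<le> T"
    have "(\<Sum>k<n. \<bar>energy_residual (u + real k * \<delta>) (u + real (Suc k) * \<delta>)\<bar>)
      \<le> (\<Sum>k<n. K * e * \<delta> + K\<^sup>2 * \<delta>\<^sup>2 / 2)"
    proof (rule sum_mono)
      fix k assume "k \<in> {..<n}"
      then have k: "real (Suc k) \<le> real n" by auto
      let ?s = "u + real k * \<delta>" and ?t = "u + real (Suc k) * \<delta>"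
      have st: "0 \<le> ?s" "?s \<le> ?t" "?t - ?s = \<delta>" using u \<delta> by (auto simp: algebra_simps)
      have "?t \<le> T" using nT mult_right_mono[OF k, of \<delta>] \<delta> by linarith
      then have sub: "{?s..?t} \<subseteq> {0..T}" using st by auto
      have "\<bar>energy_residual ?s ?t\<bar> \<le> K * e * (?t - ?s) + K\<^sup>2 * (?t - ?s)\<^sup>2 / 2"
      proof (rule energy_residual_le[OF st(1,2)])
        fix \<tau> assume \<tau>: "\<tau> \<in> {?s..?t}"
        show "norm (V' (q \<tau>)) \<le> K" using K(2) \<tau> sub by auto
        have "dist \<tau> ?t < d0" using \<tau> st \<delta> by (auto simp: dist_real_def d_def abs_if)
        then have "dist (p \<tau>) (p ?t) < e" using \<tau> sub st by (intro d0(2)) auto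
        then show "norm (p \<tau> - p ?t) \<le> e" by (simp add: dist_norm)
      qed
      then show "\<bar>energy_residual ?s ?t\<bar> \<le> K * e * \<delta> + K\<^sup>2 * \<delta>\<^sup>2 / 2" by (simp only: st(3))
    qed
    also have "\<dots> = (real n * \<delta>) * (K * e + K\<^sup>2 * \<delta> / 2)" by (simp add: power2_eq_square algebra_simps)
    also have "\<dots> \<le> (T + 1) * (K * e + K\<^sup>2 * \<delta> / 2)"
      using nT u e K(1) \<delta> by (intro mult_right_mono) auto
    also have "\<dots> \<le> (T + 1) * (K * e + K\<^sup>2 * (\<epsilon> / (K\<^sup>2 * (T + 1))) / 2)"
      using \<delta> T K(1) by (intro mult_left_mono add_left_mono divide_right_mono) (auto simp: d_def)
    also have "\<dots> = \<epsilon>"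
    proof -
      have "K * e = \<epsilon> / (T + 1) / 2" "K\<^sup>2 * (\<epsilon> / (K\<^sup>2 * (T + 1))) = \<epsilon> / (T + 1)" "T + 1 \<noteq> 0"
        using K(1) T by (auto simp: e_def mult.commute)
      then show ?thesis by (simp only: field_sum_of_halves) simp
    qed
    finally show "(\<Sum>k<n. \<bar>energy_residual (u + real k * \<delta>) (u + real (Suc k) * \<delta>)\<bar>) \<le> \<epsilon>" .
  qed
qed

lemma energy_residual_sum_tendsto_0:
  assumes u: "\<And>n. 0 \<le> u n" and \<delta>: "\<And>n. 0 < \<delta> n" "\<delta> \<longlonglongrightarrow> 0" and T: "\<And>n. u n + real (m n) * \<delta> n \<le> T"
  shows "(\<lambda>n. \<Sum>k<m n. \<bar>energy_residual (u n + real k * \<delta> n) (u n + real (Suc k) * \<delta> n)\<bar>) \<longlonglongrightarrow> 0"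
proof (rule LIMSEQ_I)
  fix r :: real assume r: "0 < r"
  have T0: "0 \<le> T" using u[of 0] \<delta>(1)[of 0] T[of 0] by (smt (verit) mult_nonneg_nonneg of_nat_0_le_iff)
  obtain d where d: "d > 0" "\<And>u \<delta> n. 0 \<le> u \<Longrightarrow> 0 < \<delta> \<Longrightarrow> \<delta> < d \<Longrightarrow> u + real n * \<delta> \<le> T \<Longrightarrow>
      (\<Sum>k<n. \<bar>energy_residual (u + real k * \<delta>) (u + real (Suc k) * \<delta>)\<bar>) \<le> r / 2"
    using energy_residual_sum_small[OF T0 half_gt_zero[OF r]] by blast
  obtain n0 where n0: "\<And>n. n \<ge> n0 \<Longrightarrow> \<bar>\<delta> n\<bar> < d"
    using LIMSEQ_D[OF \<delta>(2) d(1)] by auto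
  show "\<exists>no. \<forall>n\<ge>no. norm ((\<Sum>k<m n. \<bar>energy_residual (u n + real k * \<delta> n) (u n + real (Suc k) * \<delta> n)\<bar>) - 0) < r"
  proof (intro exI[of _ n0] allI impI)
    fix n assume "n \<ge> n0"
    then have "\<delta> n < d" using n0[of n] by simp
    then have "(\<Sum>k<m n. \<bar>energy_residual (u n + real k * \<delta> n) (u n + real (Suc k) * \<delta> n)\<bar>) \<le> r / 2"
      using d(2) u \<delta>(1) T by blast
    then show "norm ((\<Sum>k<m n. \<bar>energy_residual (u n + real k * \<delta> n) (u n + real (Suc k) * \<delta> n)\<bar>) - 0) < r"
      using r by (simp add: sum_nonneg)
  qed
qed

end

section \<open>Measurability in time and the choice of a grid\<close>

lemma floor_grid_tendsto:
  fixes x :: real assumes "0 \<le> x"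
  shows "(\<lambda>n. real (nat \<lfloor>x * real (Suc n)\<rfloor>) / real (Suc n)) \<longlonglongrightarrow> x"
proof (rule real_tendsto_sandwich)
  have eq: "real (nat \<lfloor>x * real (Suc n)\<rfloor>) = of_int \<lfloor>x * real (Suc n)\<rfloor>" for n
    using assms by simp
  have "x - inverse (real (Suc n)) \<le> real (nat \<lfloor>x * real (Suc n)\<rfloor>) / real (Suc n)" for n
  proof -
    have "(x * real (Suc n) - 1) / real (Suc n) \<le> of_int \<lfloor>x * real (Suc n)\<rfloor> / real (Suc n)"
      using real_of_int_floor_add_one_ge[of "x * real (Suc n)"] by (intro divide_right_mono) auto
    moreover have "(x * real (Suc n) - 1) / real (Suc n) = x - inverse (real (Suc n))"
      by (simp add: field_simps)
    ultimately show ?thesis unfolding eq by (simp only:)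
  qed
  then show "\<forall>\<^sub>F n in sequentially. x - inverse (real (Suc n)) \<le> real (nat \<lfloor>x * real (Suc n)\<rfloor>) / real (Suc n)"
    by simp
  have "real (nat \<lfloor>x * real (Suc n)\<rfloor>) / real (Suc n) \<le> x" for n
    unfolding eq using of_int_floor_le[of "x * real (Suc n)"] by (simp add: field_simps del: of_int_floor_le)
  then show "\<forall>\<^sub>F n in sequentially. real (nat \<lfloor>x * real (Suc n)\<rfloor>) / real (Suc n) \<le> x"
    by simp
  show "(\<lambda>n. x - inverse (real (Suc n))) \<longlonglongrightarrow> x"
    using tendsto_diff[OF tendsto_const LIMSEQ_inverse_real_of_nat, of x] by simp
qed simp

text \<open>Tonelli needs joint measurability in time and sample point. It follows by evaluating at
  grid times that converge to \<open>s\<close>, after the paths in an exceptional null set are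
  replaced by zero. \<open>max 0 s\<close> extends the map to all reals, as nothing is assumed about
  negative times.\<close>

lemma (in prob_space) borel_measurable_second_moment_path:
  fixes X :: "real \<Rightarrow> 'a \<Rightarrow> 'b::euclidean_space"
  assumes X: "\<And>t. 0 \<le> t \<Longrightarrow> X t \<in> borel_measurable M"
    and cont: "AE \<omega> in M. continuous_on {0..} (\<lambda>t. X t \<omega>)"
  shows "(\<lambda>s. \<integral>\<^sup>+\<omega>. ennreal ((norm (X (max 0 s) \<omega>))\<^sup>2) \<partial>M) \<in> borel_measurable borel"
proof -
  obtain N where N: "{\<omega> \<in> space M. \<not> continuous_on {0..} (\<lambda>t. X t \<omega>)} \<subseteq> N" "N \<in> null_sets M"
    using AE_E[OF cont] by (metis null_setsI)
  define Y where "Y s \<omega> = (if \<omega> \<in> N then 0 else X (max 0 s) \<omega>)" for s \<omega>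
  have YM: "Y s \<in> borel_measurable M" for s
    unfolding Y_def[abs_def] using N(2) by (intro measurable_If_set X) auto
  have pair: "(\<lambda>z. Y (fst z) (snd z)) \<in> borel_measurable (borel \<Otimes>\<^sub>M M)"
  proof (rule borel_measurable_LIMSEQ_metric)
    fix n :: nat
    show "(\<lambda>z. Y (real (nat \<lfloor>max 0 (fst z) * real (Suc n)\<rfloor>) / real (Suc n)) (snd z)) \<in> borel_measurable (borel \<Otimes>\<^sub>M M)"
    proof (rule measurable_compose_countable[where f="\<lambda>k z. Y (real k / real (Suc n)) (snd z)"])
      show "(\<lambda>z. Y (real k / real (Suc n)) (snd z)) \<in> borel_measurable (borel \<Otimes>\<^sub>M M)" for k
        by (rule measurable_compose[OF measurable_snd YM])
    qed measurable
  next
    fix z :: "real \<times> 'a" assume z: "z \<in> space (borel \<Otimes>\<^sub>M M)"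
    show "(\<lambda>n. Y (real (nat \<lfloor>max 0 (fst z) * real (Suc n)\<rfloor>) / real (Suc n)) (snd z)) \<longlonglongrightarrow> Y (fst z) (snd z)"
    proof (cases "snd z \<in> N")
      case True then show ?thesis by (simp add: Y_def)
    next
      case False
      then have "continuous_on {0..} (\<lambda>t. X t (snd z))" using z N(1) by (auto simp: space_pair_measure)
      then have "(\<lambda>n. X (real (nat \<lfloor>max 0 (fst z) * real (Suc n)\<rfloor>) / real (Suc n)) (snd z)) \<longlonglongrightarrow> X (max 0 (fst z)) (snd z)"
        by (rule continuous_on_tendsto_compose[OF _ floor_grid_tendsto]) auto
      then show ?thesis using False by (simp add: Y_def)
    qed
  qed
  have "(\<lambda>s. \<integral>\<^sup>+\<omega>. ennreal ((norm (Y s \<omega>))\<^sup>2) \<partial>M) \<in> borel_measurable borel"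
  proof (rule borel_measurable_nn_integral)
    show "(\<lambda>(s, \<omega>). ennreal ((norm (Y s \<omega>))\<^sup>2)) \<in> borel_measurable (borel \<Otimes>\<^sub>M M)"
      using pair by (simp add: case_prod_unfold)
  qed
  moreover have "(\<integral>\<^sup>+\<omega>. ennreal ((norm (Y s \<omega>))\<^sup>2) \<partial>M) = (\<integral>\<^sup>+\<omega>. ennreal ((norm (X (max 0 s) \<omega>))\<^sup>2) \<partial>M)" for s
    by (rule nn_integral_cong_AE, use AE_not_in[OF N(2)] in eventually_elim) (simp add: Y_def)
  ultimately show ?thesis by simp
qed

text \<open>The cells are open, hence disjoint, so shared endpoints are never counted twice.\<close>

lemma sum_nn_integral_cells_le:
  assumes [measurable]: "g \<in> borel_measurable borel" and \<delta>: "(\<delta>::real) > 0"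
  shows "(\<Sum>k<n. \<integral>\<^sup>+s. g s * indicator {real k * \<delta><..<real (Suc k) * \<delta>} s \<partial>lborel)
    \<le> (\<integral>\<^sup>+s. g s * indicator {0..<real n * \<delta>} s \<partial>lborel)"
proof (induction n)
  case (Suc n)
  have "(\<Sum>k<Suc n. \<integral>\<^sup>+s. g s * indicator {real k * \<delta><..<real (Suc k) * \<delta>} s \<partial>lborel)
    \<le> (\<integral>\<^sup>+s. g s * indicator {0..<real n * \<delta>} s \<partial>lborel)
      + (\<integral>\<^sup>+s. g s * indicator {real n * \<delta><..<real (Suc n) * \<delta>} s \<partial>lborel)"
    using add_right_mono[OF Suc.IH] by simp
  also have "\<dots> = (\<integral>\<^sup>+s. g s * indicator {0..<real n * \<delta>} s + g s * indicator {real n * \<delta><..<real (Suc n) * \<delta>} s \<partial>lborel)"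
    by (rule nn_integral_add[symmetric]) measurable
  also have "\<dots> \<le> (\<integral>\<^sup>+s. g s * indicator {0..<real (Suc n) * \<delta>} s \<partial>lborel)"
  proof (intro nn_integral_mono)
    fix s
    have "0 \<le> real n * \<delta>" "real n * \<delta> \<le> real (Suc n) * \<delta>" using \<delta> by (auto simp: algebra_simps)
    then show "g s * indicator {0..<real n * \<delta>} s + g s * indicator {real n * \<delta><..<real (Suc n) * \<delta>} s
      \<le> g s * indicator {0..<real (Suc n) * \<delta>} s"
      by (auto simp: indicator_def)
  qed
  finally show ?case .
qed simp

text \<open>Averaging over the offset \<open>u\<close> of a grid recovers the integral, so some offset is no worse than average.\<close>

lemma exists_grid_offset:
  assumes g[measurable]: "g \<in> borel_measurable borel" and \<delta>: "\<delta> > 0" and K: "0 \<le> K"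
    and int: "(\<integral>\<^sup>+s. g s * indicator {0..real n * \<delta>} s \<partial>lborel) \<le> ennreal K"
  obtains u where "0 < u" "u < \<delta>" "(\<Sum>k<n. g (u + real k * \<delta>)) * ennreal \<delta> \<le> ennreal (K + 1)"
proof (rule ccontr)
  note witness = that
  assume "\<not> thesis"
  then have big: "ennreal (K + 1) \<le> (\<Sum>k<n. g (u + real k * \<delta>)) * ennreal \<delta>" if "0 < u" "u < \<delta>" for u
    using witness[of u] that \<open>\<not> thesis\<close> by (meson le_cases)
  have shift: "(\<integral>\<^sup>+u. g (u + real k * \<delta>) * indicator {0<..<\<delta>} u \<partial>lborel)
    = (\<integral>\<^sup>+s. g s * indicator {real k * \<delta><..<real (Suc k) * \<delta>} s \<partial>lborel)" for k
    by (subst nn_integral_real_affine[where c=1 and t="real k * \<delta>"])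
      (auto simp: indicator_def algebra_simps intro!: nn_integral_cong)
  \<comment> \<open>If all offsets were bad, integrating over them would give at least
    \<open>(K + 1) * \<delta>\<close>, while the cells together account for at most
    \<open>K * \<delta>\<close>; the 1 makes this contradictory.\<close>
  have "ennreal ((K + 1) * \<delta>) = (\<integral>\<^sup>+u. ennreal (K + 1) * indicator {0<..<\<delta>} u \<partial>lborel)"
    using \<delta> K by (simp add: nn_integral_cmult ennreal_mult)
  also have "\<dots> \<le> (\<integral>\<^sup>+u. (\<Sum>k<n. g (u + real k * \<delta>) * indicator {0<..<\<delta>} u) * ennreal \<delta> \<partial>lborel)"
    using big by (intro nn_integral_mono) (auto simp: indicator_def)
  also have "\<dots> = (\<Sum>k<n. \<integral>\<^sup>+u. g (u + real k * \<delta>) * indicator {0<..<\<delta>} u \<partial>lborel) * ennreal \<delta>"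
  proof -
    have "(\<lambda>u. g (u + real k * \<delta>) * indicator {0<..<\<delta>} u) \<in> borel_measurable lborel" for k
      by measurable
    then show ?thesis by (simp only: nn_integral_multc nn_integral_sum borel_measurable_sum)
  qed
  also have "\<dots> = (\<Sum>k<n. \<integral>\<^sup>+s. g s * indicator {real k * \<delta><..<real (Suc k) * \<delta>} s \<partial>lborel) * ennreal \<delta>"
    by (simp only: shift)
  also have "\<dots> \<le> (\<integral>\<^sup>+s. g s * indicator {0..<real n * \<delta>} s \<partial>lborel) * ennreal \<delta>"
    by (intro mult_right_mono sum_nn_integral_cells_le g \<delta>) simp
  also have "\<dots> \<le> (\<integral>\<^sup>+s. g s * indicator {0..real n * \<delta>} s \<partial>lborel) * ennreal \<delta>"
    by (intro mult_right_mono nn_integral_mono) (auto simp: indicator_def)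
  also have "\<dots> \<le> ennreal K * ennreal \<delta>" by (intro mult_right_mono int) simp
  also have "\<dots> = ennreal (K * \<delta>)" using K \<delta> by (simp add: ennreal_mult)
  finally show False using K \<delta> by (simp add: mult_right_mono)
qed

context brownian
begin

definition noise_increments :: "real^'d^'m \<Rightarrow> real \<Rightarrow> real \<Rightarrow> (nat \<Rightarrow> 'a \<Rightarrow> real^'m) \<Rightarrow> nat \<Rightarrow> 'a \<Rightarrow> real" where
  "noise_increments S u \<delta> \<psi> n \<omega> = noise_sum S u \<delta> \<psi> n \<omega> + half_quadratic_variation S u \<delta> n \<omega>"

text \<open>The second moment depends on the integrand only through \<open>sum_le\<close>, a Riemann
  sum for the time integral of its second moments. The mean comes from the quadratic variation
  alone.\<close>

lemma noise_increments_moments: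
  assumes u: "0 \<le> u" and \<delta>: "\<delta> > 0" and n\<delta>: "real n * \<delta> \<le> t" and K: "0 \<le> K"
    and \<psi>: "\<And>k. k < n \<Longrightarrow> \<psi> k \<in> borel_measurable (F (u + real k * \<delta>))"
    and sum_le: "(\<Sum>k<n. \<integral>\<^sup>+\<omega>. ennreal ((norm (\<psi> k \<omega>))\<^sup>2) \<partial>M) * ennreal \<delta> \<le> ennreal K"
  shows "integrable M (noise_increments S u \<delta> \<psi> n)"
    and "expectation (noise_increments S u \<delta> \<psi> n) = noise_rate S / 2 * (real n * \<delta>)"
    and "(\<integral>\<^sup>+\<omega>. ennreal ((noise_increments S u \<delta> \<psi> n \<omega>)\<^sup>2) \<partial>M)
      \<le> ennreal (2 * (K * noise_rate S) + 2 * (noise_fourth S * t\<^sup>2))"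
proof -
  let ?A = "noise_sum S u \<delta> \<psi> n" and ?Q = "half_quadratic_variation S u \<delta> n" and ?Y = "noise_increments S u \<delta> \<psi> n"
  have \<psi>fin: "(\<integral>\<^sup>+\<omega>. ennreal ((norm (\<psi> k \<omega>))\<^sup>2) \<partial>M) < \<infinity>" if "k < n" for k
  proof -
    have "(\<integral>\<^sup>+\<omega>. ennreal ((norm (\<psi> k \<omega>))\<^sup>2) \<partial>M) * ennreal \<delta> \<le> ennreal K"
      using that by (intro order_trans[OF mult_right_mono[OF member_le_sum] sum_le]) auto
    then have "(\<integral>\<^sup>+\<omega>. ennreal ((norm (\<psi> k \<omega>))\<^sup>2) \<partial>M) * ennreal \<delta> < \<infinity>"
      by (rule le_less_trans) simp
    then show ?thesis using \<delta> by (auto simp: ennreal_mult_less_top)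
  qed
  have ns: "integrable M ?A" "expectation ?A = 0"
    "(\<integral>\<^sup>+\<omega>. ennreal ((?A \<omega>)\<^sup>2) \<partial>M)
      \<le> (\<Sum>k<n. \<integral>\<^sup>+\<omega>. ennreal ((norm (\<psi> k \<omega>))\<^sup>2) \<partial>M) * ennreal (noise_rate S * \<delta>)"
    by (rule noise_sum_moments[OF u \<delta> \<psi> \<psi>fin]; assumption)+
  note hq = half_quadratic_variation_moments[OF u \<delta>, of S n]
  show "integrable M ?Y" "expectation ?Y = noise_rate S / 2 * (real n * \<delta>)"
    unfolding noise_increments_def[abs_def] using ns(1,2) hq(1,2) by simp_all
  have m: "?A \<in> borel_measurable M" "?Q \<in> borel_measurable M"
    using borel_measurable_integrable[OF ns(1)] borel_measurable_integrable[OF hq(1)] by auto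
  have "(\<integral>\<^sup>+\<omega>. ennreal ((?Y \<omega>)\<^sup>2) \<partial>M) \<le> (\<integral>\<^sup>+\<omega>. 2 * ennreal ((?A \<omega>)\<^sup>2) + 2 * ennreal ((?Q \<omega>)\<^sup>2) \<partial>M)"
    unfolding noise_increments_def[abs_def] by (intro nn_integral_mono ennreal_power2_add_le)
  also have "\<dots> = 2 * (\<integral>\<^sup>+\<omega>. ennreal ((?A \<omega>)\<^sup>2) \<partial>M) + 2 * (\<integral>\<^sup>+\<omega>. ennreal ((?Q \<omega>)\<^sup>2) \<partial>M)"
    using m by (simp add: nn_integral_add nn_integral_cmult)
  also have "\<dots> \<le> 2 * ennreal (K * noise_rate S) + 2 * ennreal (noise_fourth S * t\<^sup>2)"
  proof (intro add_mono mult_left_mono)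
    have "(\<integral>\<^sup>+\<omega>. ennreal ((?A \<omega>)\<^sup>2) \<partial>M)
      \<le> (\<Sum>k<n. \<integral>\<^sup>+\<omega>. ennreal ((norm (\<psi> k \<omega>))\<^sup>2) \<partial>M) * ennreal (noise_rate S * \<delta>)"
      by (rule ns(3))
    also have "\<dots> = (\<Sum>k<n. \<integral>\<^sup>+\<omega>. ennreal ((norm (\<psi> k \<omega>))\<^sup>2) \<partial>M) * ennreal \<delta> * ennreal (noise_rate S)"
      using \<delta> noise_rate_nonneg[of S] by (simp add: ennreal_mult mult_ac)
    also have "\<dots> \<le> ennreal K * ennreal (noise_rate S)"
      by (intro mult_right_mono sum_le) simp
    also have "\<dots> = ennreal (K * noise_rate S)"
      using K noise_rate_nonneg[of S] by (simp add: ennreal_mult)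
    finally show "(\<integral>\<^sup>+\<omega>. ennreal ((?A \<omega>)\<^sup>2) \<partial>M) \<le> ennreal (K * noise_rate S)" .
    show "(\<integral>\<^sup>+\<omega>. ennreal ((?Q \<omega>)\<^sup>2) \<partial>M) \<le> ennreal (noise_fourth S * t\<^sup>2)"
      using n\<delta> \<delta> noise_fourth_nonneg[of S]
      by (intro order_trans[OF hq(3)] ennreal_leI mult_left_mono power_mono) auto
  qed auto
  also have "\<dots> = ennreal (2 * (K * noise_rate S) + 2 * (noise_fourth S * t\<^sup>2))"
    using K noise_rate_nonneg[of S] noise_fourth_nonneg[of S] by (simp add: ennreal_mult ennreal_plus)
  finally show "(\<integral>\<^sup>+\<omega>. ennreal ((?Y \<omega>)\<^sup>2) \<partial>M) \<le> ennreal (2 * (K * noise_rate S) + 2 * (noise_fourth S * t\<^sup>2))" .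
qed

end

section \<open>Mean energy of the exact solution\<close>

locale hamiltonian_sde = brownian M F W
  for M :: "'a measure" and F and W :: "real \<Rightarrow> 'a \<Rightarrow> real^'d" +
  fixes V :: "real^'m \<Rightarrow> real" and V' :: "real^'m \<Rightarrow> real^'m" and S :: "real^'d^'m"
    and p0 q0 :: "'a \<Rightarrow> real^'m" and p q :: "real \<Rightarrow> 'a \<Rightarrow> real^'m"
  assumes gderiv: "\<And>x. GDERIV V x :> V' x" and cont_V': "continuous_on UNIV V'"
    and p0: "p0 \<in> borel_measurable (F 0)" and q0: "q0 \<in> borel_measurable (F 0)"
    and sol: "sde_solution M F W V' S p0 q0 p q"
begin

abbreviation B :: "'a \<Rightarrow> real \<Rightarrow> real^'m" where
  "B \<omega> t \<equiv> S *v W t \<omega>"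

abbreviation is_path :: "'a \<Rightarrow> bool" where
  "is_path \<omega> \<equiv> hamiltonian_path V V' (B \<omega>) (\<lambda>t. p t \<omega>) (\<lambda>t. q t \<omega>) (p0 \<omega>) (q0 \<omega>)"

abbreviation H :: "real \<Rightarrow> 'a \<Rightarrow> real" where
  "H t \<omega> \<equiv> hamiltonian V (p t \<omega>) (q t \<omega>)"

lemma hamiltonian_measurable:
  assumes [measurable]: "X \<in> borel_measurable N" "Y \<in> borel_measurable N"
  shows "(\<lambda>\<omega>. hamiltonian V (X \<omega>) (Y \<omega>)) \<in> borel_measurable N"
proof -
  have [measurable]: "V \<in> borel_measurable borel" by (rule borel_measurable_continuous_onI[OF gderiv_imp_continuous_on[OF gderiv]])
  show ?thesis unfolding hamiltonian_eq by measurable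
qed

lemma p_measurable_F: "0 \<le> t \<Longrightarrow> p t \<in> borel_measurable (F t)"
  and q_measurable_F: "0 \<le> t \<Longrightarrow> q t \<in> borel_measurable (F t)"
  using sol by (auto simp: sde_solution_def)

lemma p_measurable: "0 \<le> t \<Longrightarrow> p t \<in> borel_measurable M"
  and q_measurable: "0 \<le> t \<Longrightarrow> q t \<in> borel_measurable M"
  using p_measurable_F q_measurable_F measurable_F_imp by blast+

lemma H_measurable: "0 \<le> t \<Longrightarrow> H t \<in> borel_measurable M"
  by (intro hamiltonian_measurable p_measurable q_measurable)

lemma AE_path: "AE \<omega> in M. is_path \<omega>"
proof -
  have "AE \<omega> in M. continuous_on {0..} (\<lambda>t. p t \<omega>) \<and> continuous_on {0..} (\<lambda>t. q t \<omega>) \<and>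
        (\<forall>t\<ge>0. q t \<omega> = q0 \<omega> + integral {0..t} (\<lambda>s. p s \<omega>) \<and>
               p t \<omega> = p0 \<omega> - integral {0..t} (\<lambda>s. V' (q s \<omega>)) + S *v W t \<omega>)"
    using sol by (simp add: sde_solution_def)
  then show ?thesis
    by eventually_elim (unfold_locales, auto intro: gderiv cont_V')
qed

lemma AE_W_0: "AE \<omega> in M. W 0 \<omega> = 0"
  using bm by (simp add: brownian_motion_def)

lemma AE_H_0: "AE \<omega> in M. H 0 \<omega> = hamiltonian V (p0 \<omega>) (q0 \<omega>)"
  using AE_path AE_W_0
proof eventually_elim
  fix \<omega> assume "is_path \<omega>" and W0: "W 0 \<omega> = 0"
  then interpret hamiltonian_path V V' "B \<omega>" "\<lambda>t. p t \<omega>" "\<lambda>t. q t \<omega>" "p0 \<omega>" "q0 \<omega>" by simp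
  show "H 0 \<omega> = hamiltonian V (p0 \<omega>) (q0 \<omega>)" using p_eq[of 0] q_eq[of 0] W0 by simp
qed

abbreviation residual :: "'a \<Rightarrow> real \<Rightarrow> real \<Rightarrow> real" where
  "residual \<omega> \<equiv> hamiltonian_path.energy_residual V (B \<omega>) (\<lambda>t. p t \<omega>) (\<lambda>t. q t \<omega>)"

lemma H_increment:
  assumes "is_path \<omega>"
  shows "H t \<omega> - H s \<omega> = p s \<omega> \<bullet> noise S s t \<omega> + (norm (noise S s t \<omega>))\<^sup>2 / 2 + residual \<omega> s t"
proof -
  interpret hamiltonian_path V V' "B \<omega>" "\<lambda>t. p t \<omega>" "\<lambda>t. q t \<omega>" "p0 \<omega>" "q0 \<omega>" by fact
  show ?thesis
    by (simp add: energy_residual_def energy_def matrix_vector_mult_diff_distrib)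
qed

text \<open>The energy increments telescope; \<open>noise_increments\<close> with integrand
  \<open>p\<close> is the part of them explained by the noise.\<close>

lemma H_telescope:
  assumes "is_path \<omega>"
  shows "noise_increments S u \<delta> (\<lambda>k. p (u + real k * \<delta>)) n \<omega>
    = H (u + real n * \<delta>) \<omega> - H u \<omega> - (\<Sum>k<n. residual \<omega> (u + real k * \<delta>) (u + real (Suc k) * \<delta>))"
proof (induction n)
  case 0 show ?case by (simp add: noise_increments_def noise_sum_def half_quadratic_variation_def)
next
  case (Suc n)
  show ?case
    using Suc.IH H_increment[OF assms, of "u + real (Suc n) * \<delta>" "u + real n * \<delta>"]
    unfolding noise_increments_def noise_sum_def half_quadratic_variation_def sum.lessThan_Suc by linarith
qed

text \<open>On finer and finer grids the energy identity represents \<open>H t - H 0\<close> as an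
  almost sure limit of noise sums with known means and bounded second moments. Only this difference
  is shown to be square-integrable; \<open>H 0\<close> is merely integrable and is added at the
  end.\<close>

lemma expectation_energy:
  assumes H0: "integrable M (\<lambda>\<omega>. hamiltonian V (p0 \<omega>) (q0 \<omega>))" and t: "0 \<le> t"
    and fin: "(\<integral>\<^sup>+s\<in>{0..t}. (\<integral>\<^sup>+\<omega>. ennreal ((norm (p s \<omega>))\<^sup>2) \<partial>M) \<partial>lborel) < \<infinity>"
  shows "expectation (H t) = expectation (\<lambda>\<omega>. hamiltonian V (p0 \<omega>) (q0 \<omega>)) + noise_rate S / 2 * t"
proof -
  have iH0: "integrable M (H 0)"
    using integrable_cong_AE[of "H 0" M "\<lambda>\<omega>. hamiltonian V (p0 \<omega>) (q0 \<omega>)"] AE_H_0 H0 H_measurable[of 0] by auto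
  have eH0: "expectation (H 0) = expectation (\<lambda>\<omega>. hamiltonian V (p0 \<omega>) (q0 \<omega>))"
    using AE_H_0 H0 H_measurable[of 0] by (intro integral_cong_AE) auto
  show ?thesis
  proof (cases "t = 0")
    case True then show ?thesis by (simp add: eH0)
  next
    case False
    define g where "g s = (\<integral>\<^sup>+\<omega>. ennreal ((norm (p (max 0 s) \<omega>))\<^sup>2) \<partial>M)" for s
    have g_meas: "g \<in> borel_measurable borel"
      unfolding g_def[abs_def]
    proof (rule borel_measurable_second_moment_path[OF p_measurable])
      show "AE \<omega> in M. continuous_on {0..} (\<lambda>t. p t \<omega>)"
        using AE_path by eventually_elim (auto simp: hamiltonian_path_def)
    qed
    have gs: "g s = (\<integral>\<^sup>+\<omega>. ennreal ((norm (p s \<omega>))\<^sup>2) \<partial>M)" if "0 \<le> s" for s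
      using that by (simp add: g_def)
    have "(\<integral>\<^sup>+s. g s * indicator {0..t} s \<partial>lborel) < \<infinity>"
      using fin by (rule back_subst[of "\<lambda>x. x < \<infinity>"]) (auto intro!: nn_integral_cong simp: gs indicator_def)
    then obtain K where K: "0 \<le> K" "(\<integral>\<^sup>+s. g s * indicator {0..t} s \<partial>lborel) = ennreal K"
      by (metis ennreal_cases infinity_ennreal_def order_less_irrefl)
    define \<delta> where "\<delta> n = t / real (Suc n)" for n
    have \<delta>: "\<delta> n > 0" "real (Suc n) * \<delta> n = t" for n using False t by (auto simp: \<delta>_def)
    \<comment> \<open>Equidistant nodes starting at 0 might hit times with a large or infinite
      second moment of \<open>p\<close>; a suitable shift bounds the sum over the nodes by the time
      integral, up to 1.\<close>
    have "\<exists>u. 0 < u \<and> u < \<delta> n \<and> (\<Sum>k<Suc n. g (u + real k * \<delta> n)) * ennreal (\<delta> n) \<le> ennreal (K + 1)" for n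
      using exists_grid_offset[OF g_meas \<delta>(1)[of n] K(1), of "Suc n"] K(2) \<delta>(2)[of n] by (metis order_refl)
    then obtain u where u: "\<And>n. 0 < u n" "\<And>n. u n < \<delta> n"
      "\<And>n. (\<Sum>k<Suc n. g (u n + real k * \<delta> n)) * ennreal (\<delta> n) \<le> ennreal (K + 1)" by metis
    define \<psi> where "\<psi> n k = p (u n + real k * \<delta> n)" for n k
    define Y where "Y n = noise_increments S (u n) (\<delta> n) (\<psi> n) n" for n
    have nn: "0 \<le> u n + real k * \<delta> n" for n k using u(1)[of n] \<delta>(1)[of n] by simp
    have \<psi>F: "\<psi> n k \<in> borel_measurable (F (u n + real k * \<delta> n))" for n k
      unfolding \<psi>_def by (rule p_measurable_F[OF nn])
    have sum_le: "(\<Sum>k<n. \<integral>\<^sup>+\<omega>. ennreal ((norm (\<psi> n k \<omega>))\<^sup>2) \<partial>M) * ennreal (\<delta> n) \<le> ennreal (K + 1)" for n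
    proof -
      have "(\<Sum>k<n. \<integral>\<^sup>+\<omega>. ennreal ((norm (\<psi> n k \<omega>))\<^sup>2) \<partial>M) \<le> (\<Sum>k<Suc n. g (u n + real k * \<delta> n))"
        by (simp add: \<psi>_def gs[OF nn] add_increasing2)
      then show ?thesis by (rule order_trans[OF mult_right_mono u(3)]) simp
    qed
    have n\<delta>: "real n * \<delta> n \<le> t" for n using \<delta>[of n] by (simp add: algebra_simps)
    have K1: "0 \<le> K + 1" using K(1) by simp
    note Y = noise_increments_moments[OF less_imp_le[OF u(1)] \<delta>(1) n\<delta> K1 \<psi>F sum_le, of S, folded Y_def]
    have YM: "Y n \<in> borel_measurable M" for n
      using borel_measurable_integrable[OF Y(1)] .
    have \<delta>0: "\<delta> \<longlonglongrightarrow> 0"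
      using tendsto_mult[OF tendsto_const[of t] LIMSEQ_inverse_real_of_nat] by (simp add: \<delta>_def[abs_def] divide_inverse)
    have u0: "u \<longlonglongrightarrow> 0"
      by (rule real_tendsto_sandwich[OF _ _ tendsto_const \<delta>0]) (simp_all add: less_imp_le[OF u(1)] less_imp_le[OF u(2)])
    have n\<delta>t: "(\<lambda>n. real n * \<delta> n) \<longlonglongrightarrow> t"
    proof -
      have "real n * \<delta> n = t - \<delta> n" for n using \<delta>(2)[of n] by (simp add: algebra_simps)
      then show ?thesis using tendsto_diff[OF tendsto_const[of t] \<delta>0] by simp
    qed
    \<comment> \<open>The offset is below one mesh width, so \<open>n\<close> cells of length
      \<open>t / Suc n\<close> still fit into \<open>[0, t]\<close>; the two ends of the shifted
      grid converge to 0 and \<open>t\<close>.\<close>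
    have un: "u n + real n * \<delta> n \<le> t" for n using u(2)[of n] \<delta>(2)[of n] by (simp add: algebra_simps)
    have lim: "AE \<omega> in M. (\<lambda>n. Y n \<omega>) \<longlonglongrightarrow> H t \<omega> - H 0 \<omega>"
      using AE_path
    proof eventually_elim
      fix \<omega> assume path: "is_path \<omega>"
      then interpret hamiltonian_path V V' "B \<omega>" "\<lambda>t. p t \<omega>" "\<lambda>t. q t \<omega>" "p0 \<omega>" "q0 \<omega>" .
      let ?r = "\<lambda>n k. residual \<omega> (u n + real k * \<delta> n) (u n + real (Suc k) * \<delta> n)"
      have Yeq: "Y n \<omega> = energy (u n + real n * \<delta> n) - energy (u n) - (\<Sum>k<n. ?r n k)" for n
        using H_telescope[OF path] by (simp only: Y_def \<psi>_def[abs_def] energy_def)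
      have "(\<lambda>n. \<Sum>k<n. \<bar>?r n k\<bar>) \<longlonglongrightarrow> 0"
        by (rule energy_residual_sum_tendsto_0[OF less_imp_le[OF u(1)] \<delta>(1) \<delta>0 un])
      then have r0: "(\<lambda>n. \<Sum>k<n. ?r n k) \<longlonglongrightarrow> 0"
        by (rule Lim_null_comparison[rotated]) (simp add: sum_abs)
      have "(\<lambda>n. energy (u n + real n * \<delta> n)) \<longlonglongrightarrow> energy t"
        using tendsto_add[OF u0 n\<delta>t] t nn by (intro continuous_on_tendsto_compose[OF continuous_on_energy]) auto
      moreover have "(\<lambda>n. energy (u n)) \<longlonglongrightarrow> energy 0"
        using u0 by (intro continuous_on_tendsto_compose[OF continuous_on_energy]) (simp_all add: less_imp_le[OF u(1)])
      ultimately show "(\<lambda>n. Y n \<omega>) \<longlonglongrightarrow> H t \<omega> - H 0 \<omega>"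
        unfolding Yeq using r0 by (auto intro!: tendsto_eq_intros simp: energy_def)
    qed
    have ZM: "(\<lambda>\<omega>. H t \<omega> - H 0 \<omega>) \<in> borel_measurable M"
      using t by (intro borel_measurable_diff H_measurable) auto
    have C0: "0 \<le> 2 * ((K + 1) * noise_rate S) + 2 * (noise_fourth S * t\<^sup>2)"
      using K noise_rate_nonneg[of S] noise_fourth_nonneg[of S] by simp
    note L = expectation_LIMSEQ_of_bounded_second_moment[OF YM ZM lim C0 Y(3)]
    have "(\<lambda>n. expectation (Y n)) \<longlonglongrightarrow> noise_rate S / 2 * t"
      unfolding Y(2) by (intro tendsto_mult tendsto_const n\<delta>t)
    then have e: "expectation (\<lambda>\<omega>. H t \<omega> - H 0 \<omega>) = noise_rate S / 2 * t"
      using L(3) LIMSEQ_unique by blast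
    have "expectation (H t) = expectation (\<lambda>\<omega>. (H t \<omega> - H 0 \<omega>) + H 0 \<omega>)" by simp
    also have "\<dots> = noise_rate S / 2 * t + expectation (H 0)"
      using L(2) iH0 e by (subst Bochner_Integration.integral_add) auto
    finally show ?thesis by (simp add: eH0)
  qed
qed

end

section \<open>Saturated energy for potentials bounded below\<close>

definition saturate :: "real \<Rightarrow> real \<Rightarrow> real" where
  "saturate \<epsilon> x = x / (1 + \<epsilon> * x)"

lemma saturate_bounds:
  assumes "\<epsilon> > 0" "0 \<le> x"
  shows "0 \<le> saturate \<epsilon> x" "saturate \<epsilon> x \<le> 1 / \<epsilon>" "saturate \<epsilon> x \<le> x"
proof -
  have "1 + \<epsilon> * x > 0" using assms by (simp add: add_pos_nonneg)
  then show "0 \<le> saturate \<epsilon> x" "saturate \<epsilon> x \<le> 1 / \<epsilon>" "saturate \<epsilon> x \<le> x"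
    using assms by (auto simp: saturate_def field_simps)
qed

text \<open>The tangent inequality of a concave function; the gap is exactly
  \<open>\<epsilon> * (y - x)^2 / (a^2 * b)\<close>. The slope
  \<open>1 / (1 + \<epsilon> * x)^2\<close> decays fast enough to bound its product with a momentum
  of the order of the square root of \<open>x\<close>.\<close>

lemma saturate_concave:
  assumes \<epsilon>: "\<epsilon> > 0" and "0 \<le> x" "0 \<le> y"
  shows "saturate \<epsilon> y - saturate \<epsilon> x \<le> (1 / (1 + \<epsilon> * x)\<^sup>2) * (y - x)"
proof -
  define a where "a = 1 + \<epsilon> * x"
  define b where "b = 1 + \<epsilon> * y"
  have pos: "a > 0" "b > 0" using assms by (auto simp: a_def b_def add_pos_nonneg)
  have ab: "b - a = \<epsilon> * (y - x)" by (simp add: a_def b_def algebra_simps)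
  have "saturate \<epsilon> y - saturate \<epsilon> x = (y * a - x * b) / (b * a)"
    using pos by (simp add: saturate_def diff_frac_eq a_def b_def)
  also have "y * a - x * b = y - x" by (simp add: a_def b_def algebra_simps)
  finally have "(1 / a\<^sup>2) * (y - x) - (saturate \<epsilon> y - saturate \<epsilon> x) = (y - x) * (1 / a\<^sup>2 - 1 / (b * a))"
    by (simp add: algebra_simps)
  also have "1 / a\<^sup>2 - 1 / (b * a) = (b - a) / (a\<^sup>2 * b)"
    using pos by (simp add: field_simps power2_eq_square)
  also have "(y - x) * ((b - a) / (a\<^sup>2 * b)) = \<epsilon> * (y - x)\<^sup>2 / (a\<^sup>2 * b)"
    by (simp add: ab power2_eq_square)
  finally have "(1 / a\<^sup>2) * (y - x) - (saturate \<epsilon> y - saturate \<epsilon> x) = \<epsilon> * (y - x)\<^sup>2 / (a\<^sup>2 * b)" .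
  moreover have "0 \<le> \<epsilon> * (y - x)\<^sup>2 / (a\<^sup>2 * b)" using pos \<epsilon> by simp
  ultimately show ?thesis by (simp add: a_def)
qed

lemma saturate_tendsto:
  assumes "0 \<le> x" shows "(\<lambda>n. saturate (inverse (real (Suc n))) x) \<longlonglongrightarrow> x"
proof -
  have "(\<lambda>n. x / (1 + inverse (real (Suc n)) * x)) \<longlonglongrightarrow> x / (1 + 0 * x)"
    by (intro tendsto_intros LIMSEQ_inverse_real_of_nat) auto
  then show ?thesis by (simp add: saturate_def)
qed

context hamiltonian_sde
begin

text \<open>With only a lower bound on \<open>V\<close> the integrand \<open>p\<close> need not be square-integrable a priori. A bounded concave
  function of the energy has a bounded integrand and, by concavity, a drift that is at most that of the energy.\<close>

lemma saturated_energy_bound: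
  assumes H0: "integrable M (\<lambda>\<omega>. hamiltonian V (p0 \<omega>) (q0 \<omega>))" and t: "0 < t" and \<epsilon>: "\<epsilon> > 0"
    and c: "\<And>x. c \<le> V x"
  shows "expectation (\<lambda>\<omega>. saturate \<epsilon> (H t \<omega> - c))
    \<le> expectation (\<lambda>\<omega>. hamiltonian V (p0 \<omega>) (q0 \<omega>) - c) + noise_rate S / 2 * t"
proof -
  define G where "G s \<omega> = H s \<omega> - c" for s \<omega>
  have Gp: "(norm (p s \<omega>))\<^sup>2 \<le> 2 * G s \<omega>" for s \<omega>
    using c[of "q s \<omega>"] by (simp add: G_def hamiltonian_eq)
  have G0: "0 \<le> G s \<omega>" for s \<omega> using Gp[of s \<omega>] zero_le_power2[of "norm (p s \<omega>)"] by linarith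
  have GM: "G s \<in> borel_measurable (F s)" if "0 \<le> s" for s
    unfolding G_def[abs_def] using that by (intro borel_measurable_diff hamiltonian_measurable p_measurable_F q_measurable_F) auto
  define \<delta> where "\<delta> n = t / real (Suc n)" for n
  have \<delta>: "\<delta> n > 0" "real (Suc n) * \<delta> n = t" for n using t by (auto simp: \<delta>_def)
  have \<delta>0: "\<delta> \<longlonglongrightarrow> 0"
    using tendsto_mult[OF tendsto_const[of t] LIMSEQ_inverse_real_of_nat] by (simp add: \<delta>_def[abs_def] divide_inverse)
  have nn: "0 \<le> 0 + real k * \<delta> n" for n k using \<delta>(1)[of n] by simp
  \<comment> \<open>The slope of \<open>saturate \<epsilon>\<close> at the current energy; it
    becomes the weight of the noise term.\<close>
  define w where "w s \<omega> = 1 / (1 + \<epsilon> * G s \<omega>)\<^sup>2" for s \<omega>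
  have G1: "1 \<le> 1 + \<epsilon> * G s \<omega>" for s \<omega> using \<epsilon> G0[of s \<omega>] by simp
  have w: "0 \<le> w s \<omega>" "w s \<omega> \<le> 1" for s \<omega>
  proof -
    have 1: "1 \<le> (1 + \<epsilon> * G s \<omega>)\<^sup>2" by (rule one_le_power[OF G1])
    then have "0 < (1 + \<epsilon> * G s \<omega>)\<^sup>2" by linarith
    with 1 show "0 \<le> w s \<omega>" "w s \<omega> \<le> 1" unfolding w_def by (simp_all only: divide_le_eq_1_pos zero_le_divide_1_iff less_imp_le)
  qed
  define \<psi> where "\<psi> n k = (\<lambda>\<omega>. w (0 + real k * \<delta> n) \<omega> *\<^sub>R p (0 + real k * \<delta> n) \<omega>)" for n k
  have \<psi>F: "\<psi> n k \<in> borel_measurable (F (0 + real k * \<delta> n))" for n k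
    unfolding \<psi>_def w_def using GM[OF nn] p_measurable_F[OF nn] by measurable
  \<comment> \<open>The squared momentum is at most twice the energy \<open>G\<close>, and the
    squared weight times \<open>1 + \<epsilon> * G\<close> is at most 1, so the weighted momentum is
    bounded by a constant depending on \<open>\<epsilon>\<close> only.\<close>
  have \<psi>2: "(norm (w s \<omega> *\<^sub>R p s \<omega>))\<^sup>2 \<le> 2 / \<epsilon>" for s \<omega>
  proof -
    let ?a = "1 + \<epsilon> * G s \<omega>"
    have "(w s \<omega>)\<^sup>2 * ?a \<le> w s \<omega> * ?a" using w[of s \<omega>] G1[of s \<omega>]
      by (intro mult_right_mono) (auto simp: power2_eq_square mult_left_le)
    also have "w s \<omega> * ?a = 1 / ?a" using G1[of s \<omega>] by (simp add: w_def power2_eq_square)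
    also have "\<dots> \<le> 1" using G1[of s \<omega>] by simp
    finally have le: "(w s \<omega>)\<^sup>2 * ?a \<le> 1" .
    have "(norm (w s \<omega> *\<^sub>R p s \<omega>))\<^sup>2 = (w s \<omega>)\<^sup>2 * (norm (p s \<omega>))\<^sup>2" by (simp add: power_mult_distrib)
    also have "\<dots> \<le> (w s \<omega>)\<^sup>2 * (2 * G s \<omega>)" by (intro mult_left_mono Gp) simp
    also have "\<dots> = 2 / \<epsilon> * ((w s \<omega>)\<^sup>2 * (\<epsilon> * G s \<omega>))" using \<epsilon> by simp
    also have "\<dots> \<le> 2 / \<epsilon> * ((w s \<omega>)\<^sup>2 * ?a)" using \<epsilon> by (intro mult_left_mono) auto
    also have "\<dots> \<le> 2 / \<epsilon> * 1" using \<epsilon> by (intro mult_left_mono le) auto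
    finally show ?thesis by simp
  qed
  define K where "K = 2 / \<epsilon> * t"
  have K: "0 \<le> K" using \<epsilon> t by (simp add: K_def)
  have sum_le: "(\<Sum>k<Suc n. \<integral>\<^sup>+\<omega>. ennreal ((norm (\<psi> n k \<omega>))\<^sup>2) \<partial>M) * ennreal (\<delta> n) \<le> ennreal K" for n
  proof -
    have "(\<integral>\<^sup>+\<omega>. ennreal ((norm (\<psi> n k \<omega>))\<^sup>2) \<partial>M) \<le> (\<integral>\<^sup>+\<omega>. ennreal (2 / \<epsilon>) \<partial>M)" for k
      unfolding \<psi>_def by (intro nn_integral_mono ennreal_leI \<psi>2)
    then have "(\<integral>\<^sup>+\<omega>. ennreal ((norm (\<psi> n k \<omega>))\<^sup>2) \<partial>M) \<le> ennreal (2 / \<epsilon>)" for k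
      by (simp add: emeasure_space_1)
    then have "(\<Sum>k<Suc n. \<integral>\<^sup>+\<omega>. ennreal ((norm (\<psi> n k \<omega>))\<^sup>2) \<partial>M) * ennreal (\<delta> n) \<le> (\<Sum>k<Suc n. ennreal (2 / \<epsilon>)) * ennreal (\<delta> n)"
      by (intro mult_right_mono sum_mono) auto
    also have "\<dots> = ennreal (real (Suc n) * (2 / \<epsilon>) * \<delta> n)"
      using \<epsilon> \<delta>(1)[of n] by (simp add: ennreal_of_nat_eq_real_of_nat ennreal_mult[symmetric] del: of_nat_Suc)
    also have "real (Suc n) * (2 / \<epsilon>) * \<delta> n = K" by (simp only: K_def \<delta>(2)[of n, symmetric] mult_ac)
    finally show ?thesis .
  qed
  \<comment> \<open>The bounded integrand makes every node admissible, so the grid starts at 0 and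
    its \<open>Suc n\<close> cells fill \<open>[0, t]\<close> exactly.\<close>
  define Y where "Y n = noise_increments S 0 (\<delta> n) (\<psi> n) (Suc n)" for n
  note Y = noise_increments_moments[OF order_refl \<delta>(1) eq_refl[OF \<delta>(2)] K \<psi>F sum_le, of S, folded Y_def]
  note YM = borel_measurable_integrable[OF Y(1)]
  define X where "X \<omega> = saturate \<epsilon> (G t \<omega>) - saturate \<epsilon> (G 0 \<omega>)" for \<omega>
  have [measurable]: "G t \<in> borel_measurable M" "G 0 \<in> borel_measurable M"
    using t by (auto intro!: measurable_F_imp[OF _ GM])
  have sM: "(\<lambda>\<omega>. saturate \<epsilon> (G t \<omega>)) \<in> borel_measurable M" "(\<lambda>\<omega>. saturate \<epsilon> (G 0 \<omega>)) \<in> borel_measurable M"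
    unfolding saturate_def by measurable
  have XM[measurable]: "X \<in> borel_measurable M" unfolding X_def[abs_def] by (intro borel_measurable_diff sM)
  have Xb: "\<bar>X \<omega>\<bar> \<le> 1 / \<epsilon>" for \<omega>
    using saturate_bounds(1,2)[OF \<epsilon> G0[of t \<omega>]] saturate_bounds(1,2)[OF \<epsilon> G0[of 0 \<omega>]] by (simp add: X_def)
  \<comment> \<open>Concavity gives only an upper bound of \<open>X\<close> by \<open>Y n\<close>
    plus a residual. The positive part of the excess is squeezed to zero, and its mean follows by
    the bound on second moments.\<close>
  define Z where "Z n \<omega> = max 0 (X \<omega> - Y n \<omega>)" for n \<omega>
  have ZM: "Z n \<in> borel_measurable M" for n
    unfolding Z_def[abs_def] using YM[of n] by measurable
  have step: "saturate \<epsilon> (G (0 + real n * \<delta>) \<omega>) - saturate \<epsilon> (G 0 \<omega>)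
      \<le> noise_increments S 0 \<delta> (\<lambda>k \<omega>. w (0 + real k * \<delta>) \<omega> *\<^sub>R p (0 + real k * \<delta>) \<omega>) n \<omega>
        + (\<Sum>k<n. \<bar>residual \<omega> (0 + real k * \<delta>) (0 + real (Suc k) * \<delta>)\<bar>)"
    if path: "is_path \<omega>" for \<omega> \<delta> n
  proof (induction n)
    case 0 show ?case by (simp add: noise_increments_def noise_sum_def half_quadratic_variation_def)
  next
    case (Suc n)
    let ?s = "0 + real n * \<delta>" and ?t = "0 + real (Suc n) * \<delta>"
    let ?\<xi> = "noise S ?s ?t \<omega>"
    have "saturate \<epsilon> (G ?t \<omega>) - saturate \<epsilon> (G ?s \<omega>) \<le> w ?s \<omega> * (G ?t \<omega> - G ?s \<omega>)"
      unfolding w_def by (rule saturate_concave[OF \<epsilon> G0 G0])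
    also have "G ?t \<omega> - G ?s \<omega> = p ?s \<omega> \<bullet> ?\<xi> + (norm ?\<xi>)\<^sup>2 / 2 + residual \<omega> ?s ?t"
      using H_increment[OF path, of ?t ?s] by (simp only: G_def diff_diff_eq2 diff_add_cancel add_diff_cancel)
    also have "w ?s \<omega> * (p ?s \<omega> \<bullet> ?\<xi> + (norm ?\<xi>)\<^sup>2 / 2 + residual \<omega> ?s ?t)
      = (w ?s \<omega> *\<^sub>R p ?s \<omega>) \<bullet> ?\<xi> + w ?s \<omega> * ((norm ?\<xi>)\<^sup>2 / 2) + w ?s \<omega> * residual \<omega> ?s ?t"
      by (simp only: inner_scaleR_left distrib_left)
    \<comment> \<open>The weights lie between 0 and 1, so the quadratic variation and the modulus of
      the residual may be taken unweighted; the noise term has no sign and keeps its weight.\<close>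
    also have "\<dots> \<le> (w ?s \<omega> *\<^sub>R p ?s \<omega>) \<bullet> ?\<xi> + (norm ?\<xi>)\<^sup>2 / 2 + \<bar>residual \<omega> ?s ?t\<bar>"
    proof (intro add_mono order_refl)
      show "w ?s \<omega> * ((norm ?\<xi>)\<^sup>2 / 2) \<le> (norm ?\<xi>)\<^sup>2 / 2"
        using w[of ?s \<omega>] by (intro mult_left_le_one_le) auto
      have "w ?s \<omega> * residual \<omega> ?s ?t \<le> w ?s \<omega> * \<bar>residual \<omega> ?s ?t\<bar>" using w[of ?s \<omega>] by (intro mult_left_mono) auto
      also have "\<dots> \<le> \<bar>residual \<omega> ?s ?t\<bar>" using w[of ?s \<omega>] by (intro mult_left_le_one_le) auto
      finally show "w ?s \<omega> * residual \<omega> ?s ?t \<le> \<bar>residual \<omega> ?s ?t\<bar>" .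
    qed
    finally show ?case
      using Suc.IH unfolding noise_increments_def noise_sum_def half_quadratic_variation_def sum.lessThan_Suc by linarith
  qed
  have Zlim: "AE \<omega> in M. (\<lambda>n. Z n \<omega>) \<longlonglongrightarrow> 0"
    using AE_path
  proof eventually_elim
    fix \<omega> assume path: "is_path \<omega>"
    then interpret hamiltonian_path V V' "B \<omega>" "\<lambda>t. p t \<omega>" "\<lambda>t. q t \<omega>" "p0 \<omega>" "q0 \<omega>" .
    let ?r = "\<lambda>n. \<Sum>k<Suc n. \<bar>residual \<omega> (0 + real k * \<delta> n) (0 + real (Suc k) * \<delta> n)\<bar>"
    have r0: "?r \<longlonglongrightarrow> 0"
      by (rule energy_residual_sum_tendsto_0[OF order_refl \<delta>(1) \<delta>0, where T=t]) (simp only: \<delta>(2) add_0 order_refl)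
    have XY: "X \<omega> \<le> Y n \<omega> + ?r n" for n
      using step[OF path, of "Suc n" "\<delta> n"] by (simp only: X_def Y_def \<psi>_def[abs_def] \<delta>(2) add_0)
    have "0 \<le> ?r n" for n by (rule sum_nonneg) simp
    then have "0 \<le> Z n \<omega>" "Z n \<omega> \<le> ?r n" for n
      using XY[of n] unfolding Z_def by (simp, intro max.boundedI, blast, linarith)
    then show "(\<lambda>n. Z n \<omega>) \<longlonglongrightarrow> 0"
      by (intro real_tendsto_sandwich[OF _ _ tendsto_const r0]) (auto intro!: always_eventually)
  qed
  define C where "C = 2 * (1 / \<epsilon>)\<^sup>2 + 2 * (2 * (K * noise_rate S) + 2 * (noise_fourth S * t\<^sup>2))"
  have C0: "0 \<le> C" using K noise_rate_nonneg[of S] noise_fourth_nonneg[of S] by (simp add: C_def)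
  have Z2: "(\<integral>\<^sup>+\<omega>. ennreal ((Z n \<omega>)\<^sup>2) \<partial>M) \<le> ennreal C" for n
  proof -
    have "(\<integral>\<^sup>+\<omega>. ennreal ((Z n \<omega>)\<^sup>2) \<partial>M) \<le> (\<integral>\<^sup>+\<omega>. ennreal (2 * (1 / \<epsilon>)\<^sup>2) + 2 * ennreal ((Y n \<omega>)\<^sup>2) \<partial>M)"
    proof (intro nn_integral_mono)
      fix \<omega>
      have "(Z n \<omega>)\<^sup>2 \<le> (X \<omega> + - Y n \<omega>)\<^sup>2" by (auto simp: Z_def max_def)
      then have "ennreal ((Z n \<omega>)\<^sup>2) \<le> 2 * ennreal ((X \<omega>)\<^sup>2) + 2 * ennreal ((- Y n \<omega>)\<^sup>2)"
        by (rule order_trans[OF ennreal_leI ennreal_power2_add_le])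
      also have "\<dots> \<le> 2 * ennreal ((1 / \<epsilon>)\<^sup>2) + 2 * ennreal ((- Y n \<omega>)\<^sup>2)"
        using power_mono[OF Xb[of \<omega>], of 2] by (intro add_mono mult_left_mono ennreal_leI) auto
      finally show "ennreal ((Z n \<omega>)\<^sup>2) \<le> ennreal (2 * (1 / \<epsilon>)\<^sup>2) + 2 * ennreal ((Y n \<omega>)\<^sup>2)"
        by (simp add: ennreal_mult)
    qed
    also have "\<dots> = ennreal (2 * (1 / \<epsilon>)\<^sup>2) + 2 * (\<integral>\<^sup>+\<omega>. ennreal ((Y n \<omega>)\<^sup>2) \<partial>M)"
      using YM[of n] by (simp add: nn_integral_add nn_integral_cmult emeasure_space_1)
    also have "\<dots> \<le> ennreal (2 * (1 / \<epsilon>)\<^sup>2) + 2 * ennreal (2 * (K * noise_rate S) + 2 * (noise_fourth S * t\<^sup>2))"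
      by (intro add_left_mono mult_left_mono Y(3)) simp
    also have "\<dots> = ennreal C"
      using K noise_rate_nonneg[of S] noise_fourth_nonneg[of S] unfolding C_def
      by (subst ennreal_plus) (auto simp: ennreal_mult)
    finally show ?thesis .
  qed
  have iZ: "integrable M (Z n)" for n
    by (rule square_nn_finite_imp_integrable(2)[OF ZM le_less_trans[OF Z2]]) simp
  have "(\<lambda>n. expectation (Z n)) \<longlonglongrightarrow> expectation (\<lambda>\<omega>. 0)"
    by (rule expectation_LIMSEQ_of_bounded_second_moment(3)[OF ZM _ Zlim C0 Z2]) simp
  then have eZ: "(\<lambda>n. noise_rate S / 2 * t + expectation (Z n)) \<longlonglongrightarrow> noise_rate S / 2 * t"
    using tendsto_add[OF tendsto_const[of "noise_rate S / 2 * t"]] by fastforce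
  have iX: "integrable M X" by (rule integrable_const_bound[where B="1 / \<epsilon>"]) (use Xb in auto)
  have "expectation X \<le> noise_rate S / 2 * t + expectation (Z n)" for n
  proof -
    have "expectation X \<le> expectation (\<lambda>\<omega>. Y n \<omega> + Z n \<omega>)"
      using iX Y(1)[of n] iZ[of n] by (intro integral_mono) (auto simp: Z_def)
    then show ?thesis using Y(1,2)[of n] iZ[of n] by (simp add: \<delta>(2) del: of_nat_Suc)
  qed
  then have eX: "expectation X \<le> noise_rate S / 2 * t"
    by (intro LIMSEQ_le_const[OF eZ]) auto
  have iG0: "integrable M (G 0)" "expectation (G 0) = expectation (\<lambda>\<omega>. hamiltonian V (p0 \<omega>) (q0 \<omega>) - c)"
  proof -
    have ae: "AE \<omega> in M. G 0 \<omega> = hamiltonian V (p0 \<omega>) (q0 \<omega>) - c"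
      using AE_H_0 by eventually_elim (simp add: G_def)
    have int: "integrable M (\<lambda>\<omega>. hamiltonian V (p0 \<omega>) (q0 \<omega>) - c)" using H0 by simp
    show "integrable M (G 0)" using integrable_cong_AE[OF _ _ ae] int by auto
    show "expectation (G 0) = expectation (\<lambda>\<omega>. hamiltonian V (p0 \<omega>) (q0 \<omega>) - c)"
      using int ae by (intro integral_cong_AE) auto
  qed
  have isat: "integrable M (\<lambda>\<omega>. saturate \<epsilon> (G s \<omega>))" if "s = t \<or> s = 0" for s
    using that saturate_bounds(1,2)[OF \<epsilon> G0] sM by (intro integrable_const_bound[where B="1 / \<epsilon>"]) auto
  have "expectation (\<lambda>\<omega>. saturate \<epsilon> (G t \<omega>)) = expectation X + expectation (\<lambda>\<omega>. saturate \<epsilon> (G 0 \<omega>))"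
    unfolding X_def using isat by simp
  also have "\<dots> \<le> noise_rate S / 2 * t + expectation (G 0)"
    using saturate_bounds(3)[OF \<epsilon> G0] isat iG0 by (intro add_mono eX integral_mono) auto
  finally show ?thesis by (simp add: G_def iG0(2))
qed

text \<open>The bound for the saturated energy does not depend on \<open>\<epsilon>\<close>; along
  \<open>\<epsilon> = 1 / (n + 1)\<close>, Fatou's lemma transfers it to the energy itself.\<close>

lemma energy_bound:
  assumes H0: "integrable M (\<lambda>\<omega>. hamiltonian V (p0 \<omega>) (q0 \<omega>))" and t: "0 < t" and c: "\<And>x. c \<le> V x"
  shows "(\<integral>\<^sup>+\<omega>. ennreal (H t \<omega> - c) \<partial>M)
    \<le> ennreal (expectation (\<lambda>\<omega>. hamiltonian V (p0 \<omega>) (q0 \<omega>) - c) + noise_rate S / 2 * t)"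
proof (rule nn_integral_le_of_LIMSEQ)
  fix n :: nat
  let ?\<epsilon> = "inverse (real (Suc n))"
  have G0: "0 \<le> H t \<omega> - c" for \<omega>
    using c[of "q t \<omega>"] by (simp add: hamiltonian_eq add_increasing)
  have Hm[measurable]: "H t \<in> borel_measurable M" using t by (intro H_measurable) simp
  have sM: "(\<lambda>\<omega>. saturate ?\<epsilon> (H t \<omega> - c)) \<in> borel_measurable M" unfolding saturate_def by measurable
  then show "(\<lambda>\<omega>. ennreal (saturate ?\<epsilon> (H t \<omega> - c))) \<in> borel_measurable M" by measurable
  have "integrable M (\<lambda>\<omega>. saturate ?\<epsilon> (H t \<omega> - c))"
    using saturate_bounds(1,2)[OF _ G0, of ?\<epsilon>] sM by (intro integrable_const_bound[where B="1 / ?\<epsilon>"]) auto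
  then have "(\<integral>\<^sup>+\<omega>. ennreal (saturate ?\<epsilon> (H t \<omega> - c)) \<partial>M) = ennreal (expectation (\<lambda>\<omega>. saturate ?\<epsilon> (H t \<omega> - c)))"
    using saturate_bounds(1)[OF _ G0, of ?\<epsilon>] by (intro nn_integral_eq_integral) auto
  also have "\<dots> \<le> ennreal (expectation (\<lambda>\<omega>. hamiltonian V (p0 \<omega>) (q0 \<omega>) - c) + noise_rate S / 2 * t)"
    by (intro ennreal_leI saturated_energy_bound H0 t c) simp
  finally show "(\<integral>\<^sup>+\<omega>. ennreal (saturate ?\<epsilon> (H t \<omega> - c)) \<partial>M)
    \<le> ennreal (expectation (\<lambda>\<omega>. hamiltonian V (p0 \<omega>) (q0 \<omega>) - c) + noise_rate S / 2 * t)" .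
next
  have "0 \<le> H t \<omega> - c" for \<omega> using c[of "q t \<omega>"] by (simp add: hamiltonian_eq add_increasing)
  then show "AE \<omega> in M. (\<lambda>n. ennreal (saturate (inverse (real (Suc n))) (H t \<omega> - c))) \<longlonglongrightarrow> ennreal (H t \<omega> - c)"
    by (intro AE_I2 tendsto_ennrealI saturate_tendsto)
qed

lemma momentum_square_integrable:
  assumes H0: "integrable M (\<lambda>\<omega>. hamiltonian V (p0 \<omega>) (q0 \<omega>))" and t: "0 \<le> t" and c: "\<And>x. c \<le> V x"
  shows "(\<integral>\<^sup>+s\<in>{0..t}. (\<integral>\<^sup>+\<omega>. ennreal ((norm (p s \<omega>))\<^sup>2) \<partial>M) \<partial>lborel) < \<infinity>"
proof -
  define C where "C = expectation (\<lambda>\<omega>. hamiltonian V (p0 \<omega>) (q0 \<omega>) - c) + noise_rate S / 2 * t"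
  have "(\<integral>\<^sup>+\<omega>. ennreal ((norm (p s \<omega>))\<^sup>2) \<partial>M) \<le> 2 * ennreal C" if s: "0 < s" "s \<le> t" for s
  proof -
    have "(\<integral>\<^sup>+\<omega>. ennreal ((norm (p s \<omega>))\<^sup>2) \<partial>M) \<le> (\<integral>\<^sup>+\<omega>. 2 * ennreal (H s \<omega> - c) \<partial>M)"
    proof (intro nn_integral_mono)
      fix \<omega>
      have "(norm (p s \<omega>))\<^sup>2 \<le> 2 * (H s \<omega> - c)" using c[of "q s \<omega>"] by (simp add: hamiltonian_eq)
      then have "ennreal ((norm (p s \<omega>))\<^sup>2) \<le> ennreal (2 * (H s \<omega> - c))" by (rule ennreal_leI)
      moreover have "0 \<le> H s \<omega> - c" using c[of "q s \<omega>"] by (simp add: hamiltonian_eq add_increasing)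
      ultimately show "ennreal ((norm (p s \<omega>))\<^sup>2) \<le> 2 * ennreal (H s \<omega> - c)"
        by (simp only: ennreal_mult zero_le_numeral ennreal_numeral)
    qed
    also have "\<dots> = 2 * (\<integral>\<^sup>+\<omega>. ennreal (H s \<omega> - c) \<partial>M)"
    proof -
      have [measurable]: "H s \<in> borel_measurable M" using s by (intro H_measurable) simp
      show ?thesis by (intro nn_integral_cmult) measurable
    qed
    also have "\<dots> \<le> 2 * ennreal C"
      unfolding C_def using s noise_rate_nonneg[of S]
      by (intro mult_left_mono order_trans[OF energy_bound[OF H0 s(1) c]] ennreal_leI add_left_mono mult_left_mono) auto
    finally show ?thesis .
  qed
  \<comment> \<open>The moment bound speaks of positive times only; time 0 is a Lebesgue null
    set.\<close>
  then have "(\<integral>\<^sup>+s\<in>{0..t}. (\<integral>\<^sup>+\<omega>. ennreal ((norm (p s \<omega>))\<^sup>2) \<partial>M) \<partial>lborel)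
    \<le> (\<integral>\<^sup>+s. 2 * ennreal C * indicator {0..t} s \<partial>lborel)"
    by (intro nn_integral_mono_AE eventually_mono[OF AE_lborel_singleton[of 0]]) (auto simp: indicator_def)
  also have "\<dots> = 2 * ennreal C * ennreal t" using t by (simp add: nn_integral_cmult_indicator)
  also have "\<dots> < \<infinity>" by (simp add: ennreal_mult_less_top)
  finally show ?thesis .
qed

end

subsection \<open>Energy of the scheme\<close>

context hamiltonian_sde
begin

text \<open>The discrete gradient property: the fundamental theorem of calculus along the segment
  from \<open>a\<close> to \<open>a + v\<close>.\<close>

lemma potential_segment: "V (a + v) - V a = integral {0..1} (\<lambda>s. V' (a + s *\<^sub>R v)) \<bullet> v"
proof -
  have d: "((\<lambda>s. V (a + s *\<^sub>R v)) has_vector_derivative V' (a + s *\<^sub>R v) \<bullet> v) (at s within {0..1})" for s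
  proof -
    have "((\<lambda>s. a + s *\<^sub>R v) has_derivative (\<lambda>h. h *\<^sub>R v)) (at s within {0..1})"
      by (auto intro!: derivative_eq_intros)
    from has_derivative_compose[OF this gderiv[unfolded gderiv_def]]
    show ?thesis by (simp add: has_vector_derivative_def inner_commute)
  qed
  have "((\<lambda>s. V' (a + s *\<^sub>R v) \<bullet> v) has_integral (V (a + 1 *\<^sub>R v) - V (a + 0 *\<^sub>R v))) {0..1}"
    by (intro fundamental_theorem_of_calculus d) auto
  moreover have "(\<lambda>s. V' (a + s *\<^sub>R v)) integrable_on {0..1}"
    by (intro integrable_continuous_interval continuous_on_compose2[OF cont_V'] continuous_intros) auto
  from integral_linear[OF this bounded_linear_inner_left, of v]
  have "integral {0..1} (\<lambda>s. V' (a + s *\<^sub>R v) \<bullet> v) = integral {0..1} (\<lambda>s. V' (a + s *\<^sub>R v)) \<bullet> v"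
    by (simp add: o_def)
  ultimately show ?thesis by (simp add: integral_unique)
qed

text \<open>\<open>\<Psi>\<close> is the mean of \<open>P + \<xi>\<close> and \<open>P1\<close>, the
  momenta before and after the kick by \<open>h *\<^sub>R G\<close>. Hence the kinetic energy lost
  in the kick is \<open>G \<bullet> (h *\<^sub>R \<Psi>)\<close>, which by
  \<open>potential_segment\<close> is the potential energy gained; only the noise changes the
  total.\<close>

lemma scheme_step_energy:
  assumes G: "G = integral {0..1} (\<lambda>s. V' (Q + (s * h) *\<^sub>R \<Psi>))"
    and \<Psi>: "\<Psi> = P + \<xi> - (h / 2) *\<^sub>R G" and Q1: "Q1 = Q + h *\<^sub>R \<Psi>" and P1: "P1 = P + \<xi> - h *\<^sub>R G"
  shows "hamiltonian V P1 Q1 = hamiltonian V P Q + P \<bullet> \<xi> + (norm \<xi>)\<^sup>2 / 2"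
proof -
  have "V Q1 - V Q = G \<bullet> (h *\<^sub>R \<Psi>)"
    using potential_segment[of Q "h *\<^sub>R \<Psi>"] by (simp add: G Q1)
  also have "\<dots> = h * (G \<bullet> (P + \<xi>)) - h\<^sup>2 / 2 * (G \<bullet> G)"
    by (simp add: \<Psi> inner_diff_right inner_add_right power2_eq_square algebra_simps)
  finally have V: "V Q1 - V Q = h * (G \<bullet> (P + \<xi>)) - h\<^sup>2 / 2 * (G \<bullet> G)" .
  have "(norm P1)\<^sup>2 = (P + \<xi>) \<bullet> (P + \<xi>) - 2 * h * (G \<bullet> (P + \<xi>)) + h\<^sup>2 * (G \<bullet> G)"
    unfolding P1 power2_norm_eq_inner
    by (simp add: inner_diff_left inner_diff_right inner_commute power2_eq_square algebra_simps)
  moreover have "(P + \<xi>) \<bullet> (P + \<xi>) = (norm P)\<^sup>2 + 2 * (P \<bullet> \<xi>) + (norm \<xi>)\<^sup>2"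
    by (simp add: power2_norm_eq_inner inner_add_left inner_add_right inner_commute)
  ultimately show ?thesis using V by (simp add: hamiltonian_eq field_simps)
qed

lemma scheme_measurable_F:
  assumes "drift_preserving_scheme M F W V' S p0 q0 h P Q"
  shows "P n \<in> borel_measurable (F (real n * h))" "Q n \<in> borel_measurable (F (real n * h))"
  using assms by (auto simp: drift_preserving_scheme_def)

lemma scheme_measurable:
  assumes "drift_preserving_scheme M F W V' S p0 q0 h P Q" "0 \<le> h"
  shows "P n \<in> borel_measurable M" "Q n \<in> borel_measurable M"
  using scheme_measurable_F[OF assms(1), of n] assms(2) by (auto intro: measurable_F_imp[rotated])

text \<open>The implicit stages are collected into sequences by choice, for each sample path
  separately; the energy and error estimates use them only pathwise.\<close>

lemma AE_scheme_steps:
  assumes sch: "drift_preserving_scheme M F W V' S p0 q0 h P Q"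
  shows "AE \<omega> in M. P 0 \<omega> = p0 \<omega> \<and> Q 0 \<omega> = q0 \<omega> \<and> (\<exists>\<Psi> G. \<forall>n. G n = integral {0..1} (\<lambda>s. V' (Q n \<omega> + (s * h) *\<^sub>R \<Psi> n)) \<and>
    \<Psi> n = P n \<omega> + noise S (real n * h) (real (Suc n) * h) \<omega> - (h / 2) *\<^sub>R G n \<and>
    Q (Suc n) \<omega> = Q n \<omega> + h *\<^sub>R \<Psi> n \<and>
    P (Suc n) \<omega> = P n \<omega> + noise S (real n * h) (real (Suc n) * h) \<omega> - h *\<^sub>R G n)"
proof -
  have "AE \<omega> in M. P 0 \<omega> = p0 \<omega> \<and> Q 0 \<omega> = q0 \<omega> \<and> (\<forall>n. \<exists>\<Psi>. let \<Delta>W = W (real (Suc n) * h) \<omega> - W (real n * h) \<omega>;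
                     G = integral {0..1} (\<lambda>s. V' (Q n \<omega> + (s * h) *\<^sub>R \<Psi>))
         in \<Psi> = P n \<omega> + S *v \<Delta>W - (h / 2) *\<^sub>R G \<and>
            Q (Suc n) \<omega> = Q n \<omega> + h *\<^sub>R \<Psi> \<and>
            P (Suc n) \<omega> = P n \<omega> + S *v \<Delta>W - h *\<^sub>R G)"
    using sch unfolding drift_preserving_scheme_def by blast
  then show ?thesis
  proof eventually_elim
    case (elim \<omega>)
    then have "\<forall>n. \<exists>\<Psi>. \<Psi> = P n \<omega> + noise S (real n * h) (real (Suc n) * h) \<omega> - (h / 2) *\<^sub>R integral {0..1} (\<lambda>s. V' (Q n \<omega> + (s * h) *\<^sub>R \<Psi>)) \<and>
      Q (Suc n) \<omega> = Q n \<omega> + h *\<^sub>R \<Psi> \<and>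
      P (Suc n) \<omega> = P n \<omega> + noise S (real n * h) (real (Suc n) * h) \<omega> - h *\<^sub>R integral {0..1} (\<lambda>s. V' (Q n \<omega> + (s * h) *\<^sub>R \<Psi>))"
      (is "\<forall>n. \<exists>\<Psi>. ?R n \<Psi>") unfolding Let_def by blast
    from choice[OF this] obtain \<Psi> where \<Psi>: "\<forall>n. ?R n (\<Psi> n)" by blast
    have "\<exists>\<Psi> G. \<forall>n. G n = integral {0..1} (\<lambda>s. V' (Q n \<omega> + (s * h) *\<^sub>R \<Psi> n)) \<and>
      \<Psi> n = P n \<omega> + noise S (real n * h) (real (Suc n) * h) \<omega> - (h / 2) *\<^sub>R G n \<and>
      Q (Suc n) \<omega> = Q n \<omega> + h *\<^sub>R \<Psi> n \<and>
      P (Suc n) \<omega> = P n \<omega> + noise S (real n * h) (real (Suc n) * h) \<omega> - h *\<^sub>R G n"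
      by (rule exI[of _ \<Psi>], rule exI[of _ "\<lambda>n. integral {0..1} (\<lambda>s. V' (Q n \<omega> + (s * h) *\<^sub>R \<Psi> n))"])
        (use \<Psi> in blast)
    with elim show ?case by blast
  qed
qed

lemma AE_scheme_energy:
  assumes sch: "drift_preserving_scheme M F W V' S p0 q0 h P Q"
  shows "AE \<omega> in M. hamiltonian V (P (Suc n) \<omega>) (Q (Suc n) \<omega>) = hamiltonian V (P n \<omega>) (Q n \<omega>)
    + P n \<omega> \<bullet> noise S (real n * h) (real (Suc n) * h) \<omega> + (norm (noise S (real n * h) (real (Suc n) * h) \<omega>))\<^sup>2 / 2"
  using AE_scheme_steps[OF sch] by eventually_elim (elim conjE exE allE[of _ n], rule scheme_step_energy)

lemma AE_scheme_0:
  assumes "drift_preserving_scheme M F W V' S p0 q0 h P Q"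
  shows "AE \<omega> in M. P 0 \<omega> = p0 \<omega> \<and> Q 0 \<omega> = q0 \<omega>"
  using AE_scheme_steps[OF assms] by eventually_elim blast

text \<open>The lower bound converts an integrable energy at step \<open>n\<close> into a
  square-integrable momentum \<open>P n\<close>; by independence its product with the next noise
  increment is then square-integrable.\<close>

lemma scheme_energy_integrable:
  assumes sch: "drift_preserving_scheme M F W V' S p0 q0 h P Q" and h: "h > 0" and c: "\<And>x. c \<le> V x"
    and H0: "integrable M (\<lambda>\<omega>. hamiltonian V (p0 \<omega>) (q0 \<omega>))"
  shows "integrable M (\<lambda>\<omega>. hamiltonian V (P n \<omega>) (Q n \<omega>))"
proof (induction n)
  case 0
  have "AE \<omega> in M. hamiltonian V (P 0 \<omega>) (Q 0 \<omega>) = hamiltonian V (p0 \<omega>) (q0 \<omega>)"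
    using AE_scheme_0[OF sch] by eventually_elim simp
  moreover have "(\<lambda>\<omega>. hamiltonian V (P 0 \<omega>) (Q 0 \<omega>)) \<in> borel_measurable M"
    using h by (intro hamiltonian_measurable scheme_measurable[OF sch]) auto
  ultimately show ?case using integrable_cong_AE H0 borel_measurable_integrable[OF H0] by blast
next
  case (Suc n)
  let ?\<xi> = "noise S (real n * h) (real (Suc n) * h)"
  have st: "0 \<le> real n * h" "real n * h < real (Suc n) * h" using h by auto
  have Pm: "P n \<in> borel_measurable M" using h by (intro scheme_measurable[OF sch]) auto
  have "integrable M (\<lambda>\<omega>. (norm (P n \<omega>))\<^sup>2)"
  proof (rule Bochner_Integration.integrable_bound)
    show "integrable M (\<lambda>\<omega>. 2 * (hamiltonian V (P n \<omega>) (Q n \<omega>) - c))" using Suc.IH by simp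
    show "(\<lambda>\<omega>. (norm (P n \<omega>))\<^sup>2) \<in> borel_measurable M" using Pm by measurable
    have "(norm (P n \<omega>))\<^sup>2 \<le> 2 * (hamiltonian V (P n \<omega>) (Q n \<omega>) - c)" for \<omega>
      using c[of "Q n \<omega>"] by (simp add: hamiltonian_eq)
    then show "AE \<omega> in M. norm ((norm (P n \<omega>))\<^sup>2) \<le> norm (2 * (hamiltonian V (P n \<omega>) (Q n \<omega>) - c))"
      by (intro AE_I2) (metis abs_ge_self abs_of_nonneg order_trans real_norm_def zero_le_power2)
  qed
  then have "(\<integral>\<^sup>+\<omega>. ennreal ((norm (P n \<omega>))\<^sup>2) \<partial>M) < \<infinity>"
    by (simp add: nn_integral_eq_integral)
  then have "(\<integral>\<^sup>+\<omega>. ennreal ((P n \<omega> \<bullet> ?\<xi> \<omega>)\<^sup>2) \<partial>M) < \<infinity>"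
    by (intro le_less_trans[OF inner_noise_square[OF st scheme_measurable_F(1)[OF sch]]]) (simp add: ennreal_mult_less_top)
  then have iP: "integrable M (\<lambda>\<omega>. P n \<omega> \<bullet> ?\<xi> \<omega>)"
    using h by (intro square_nn_finite_imp_integrable borel_measurable_inner Pm noise_measurable) auto
  have i: "integrable M (\<lambda>\<omega>. hamiltonian V (P n \<omega>) (Q n \<omega>) + P n \<omega> \<bullet> ?\<xi> \<omega> + (norm (?\<xi> \<omega>))\<^sup>2 / 2)"
    using Suc.IH iP noise_square(1)[OF st, of S] by (intro Bochner_Integration.integrable_add integrable_divide)
  have "(\<lambda>\<omega>. hamiltonian V (P (Suc n) \<omega>) (Q (Suc n) \<omega>)) \<in> borel_measurable M"
    using h by (intro hamiltonian_measurable scheme_measurable[OF sch]) auto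
  then show ?case
    using integrable_cong_AE[OF _ borel_measurable_integrable[OF i] AE_scheme_energy[OF sch]] i by blast
qed

lemma expectation_scheme_energy:
  assumes sch: "drift_preserving_scheme M F W V' S p0 q0 h P Q" and h: "h > 0"
    and int: "\<And>n. integrable M (\<lambda>\<omega>. hamiltonian V (P n \<omega>) (Q n \<omega>))"
  shows "expectation (\<lambda>\<omega>. hamiltonian V (P n \<omega>) (Q n \<omega>))
    = expectation (\<lambda>\<omega>. hamiltonian V (p0 \<omega>) (q0 \<omega>)) + noise_rate S / 2 * (real n * h)"
proof (induction n)
  case 0
  have ae: "AE \<omega> in M. hamiltonian V (P 0 \<omega>) (Q 0 \<omega>) = hamiltonian V (p0 \<omega>) (q0 \<omega>)"
    using AE_scheme_0[OF sch] by eventually_elim simp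
  have m: "(\<lambda>\<omega>. hamiltonian V (p0 \<omega>) (q0 \<omega>)) \<in> borel_measurable M"
    by (intro hamiltonian_measurable measurable_F_imp[OF order_refl p0] measurable_F_imp[OF order_refl q0])
  show ?case using integral_cong_AE[OF borel_measurable_integrable[OF int] m ae] by simp
next
  case (Suc n)
  let ?\<xi> = "noise S (real n * h) (real (Suc n) * h)"
  \<comment> \<open>Up to the squared noise, the product of \<open>P n\<close> with the noise is a
    difference of energies and therefore integrable; the hypotheses here provide no second moment of
    \<open>P n\<close>.\<close>
  let ?Y = "\<lambda>\<omega>. hamiltonian V (P (Suc n) \<omega>) (Q (Suc n) \<omega>) - hamiltonian V (P n \<omega>) (Q n \<omega>) - (norm (?\<xi> \<omega>))\<^sup>2 / 2"
  have st: "0 \<le> real n * h" "real n * h < real (Suc n) * h" using h by auto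
  have iY: "integrable M ?Y"
    by (intro Bochner_Integration.integrable_diff int integrable_divide noise_square(1)[OF st])
  have ae: "AE \<omega> in M. ?Y \<omega> = P n \<omega> \<bullet> ?\<xi> \<omega>"
    using AE_scheme_energy[OF sch, of n] by eventually_elim simp
  have m: "(\<lambda>\<omega>. P n \<omega> \<bullet> ?\<xi> \<omega>) \<in> borel_measurable M"
    using h by (intro borel_measurable_inner scheme_measurable[OF sch] noise_measurable) auto
  have iP: "integrable M (\<lambda>\<omega>. P n \<omega> \<bullet> ?\<xi> \<omega>)"
    using integrable_cong_AE[OF borel_measurable_integrable[OF iY] m ae] iY by blast
  have "expectation ?Y = expectation (\<lambda>\<omega>. P n \<omega> \<bullet> ?\<xi> \<omega>)"
    by (rule integral_cong_AE[OF borel_measurable_integrable[OF iY] m ae])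
  also have "\<dots> = 0"
    by (rule expectation_inner_noise[OF st scheme_measurable_F(1)[OF sch] iP])
  finally have "expectation ?Y = 0" .
  moreover have "expectation ?Y = expectation (\<lambda>\<omega>. hamiltonian V (P (Suc n) \<omega>) (Q (Suc n) \<omega>))
      - expectation (\<lambda>\<omega>. hamiltonian V (P n \<omega>) (Q n \<omega>)) - expectation (\<lambda>\<omega>. (norm (?\<xi> \<omega>))\<^sup>2) / 2"
    using int noise_square(1)[OF st, of S]
    by (simp only: Bochner_Integration.integral_diff Bochner_Integration.integrable_diff integrable_divide integral_divide_zero)
  moreover have "expectation (\<lambda>\<omega>. (norm (?\<xi> \<omega>))\<^sup>2) = noise_rate S * h"
    unfolding noise_square(2)[OF st] by (simp add: algebra_simps)
  moreover have "noise_rate S / 2 * (real (Suc n) * h) = noise_rate S / 2 * (real n * h) + noise_rate S * h / 2"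
    by (simp add: algebra_simps add_divide_distrib)
  ultimately show ?case using Suc.IH by linarith
qed

text \<open>Both mean energies equal the initial one plus \<open>noise_rate S / 2\<close> times the
  elapsed time, so the estimator is unbiased. Under a lower bound on \<open>V\<close>, the
  integrability required by the second alternative is a consequence.\<close>

lemma energy_monte_carlo_error:
  assumes sch: "drift_preserving_scheme M F W V' S p0 q0 h P Q" and h: "h > 0"
    and H0: "integrable M (\<lambda>\<omega>. hamiltonian V (p0 \<omega>) (q0 \<omega>))"
    and hyp: "(\<exists>c. \<forall>x. c \<le> V x) \<or>
       ((\<forall>t\<ge>0. (\<integral>\<^sup>+s\<in>{0..t}. (\<integral>\<^sup>+\<omega>. ennreal ((norm (p s \<omega>))\<^sup>2) \<partial>M) \<partial>lborel) < \<infinity>) \<and>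
        (\<forall>n. integrable M (\<lambda>\<omega>. hamiltonian V (P n \<omega>) (Q n \<omega>))))"
    and m: "m \<ge> 1" and iid: "iid_samples M m (\<lambda>\<omega>. hamiltonian V (P n \<omega>) (Q n \<omega>)) Yhat"
  shows "l2norm M (\<lambda>\<omega>. expectation (H (real n * h)) - mc_estimator m Yhat \<omega>)
    = ennreal (real m powr (-1/2)) * ennreal_sqrt (var M (\<lambda>\<omega>. hamiltonian V (P n \<omega>) (Q n \<omega>)))"
proof -
  have fin: "(\<integral>\<^sup>+s\<in>{0..real n * h}. (\<integral>\<^sup>+\<omega>. ennreal ((norm (p s \<omega>))\<^sup>2) \<partial>M) \<partial>lborel) < \<infinity>"
    using hyp momentum_square_integrable[OF H0] h by (meson less_imp_le mult_nonneg_nonneg of_nat_0_le_iff)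
  have int: "integrable M (\<lambda>\<omega>. hamiltonian V (P n \<omega>) (Q n \<omega>))" for n
    using hyp scheme_energy_integrable[OF sch h _ H0] by blast
  have "expectation (H (real n * h)) = expectation (\<lambda>\<omega>. hamiltonian V (P n \<omega>) (Q n \<omega>))"
    using expectation_energy[OF H0 _ fin] expectation_scheme_energy[OF sch h int] h by simp
  then show ?thesis using mc_estimator_l2_error[OF m int iid] by simp
qed

end

subsection \<open>Strong error under a Lipschitz force\<close>

text \<open>Bounding the integral of \<open>\<phi>\<close> instead of its values lets the
  inhomogeneity enter through its integral and not its supremum. The proof differentiates the
  integral of \<open>\<phi>\<close> damped by \<open>exp (- c * s)\<close>.\<close>

lemma integral_gronwall:
  fixes \<phi> b :: "real \<Rightarrow> real"
  assumes \<phi>: "continuous_on {0..T} \<phi>" and b: "continuous_on {0..T} b" and c: "0 \<le> c"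
    and b0: "\<And>s. s \<in> {0..T} \<Longrightarrow> 0 \<le> b s"
    and le: "\<And>s. s \<in> {0..T} \<Longrightarrow> \<phi> s \<le> b s + c * integral {0..s} \<phi>" and t: "t \<in> {0..T}"
  shows "integral {0..t} \<phi> \<le> exp (c * T) * integral {0..T} b"
proof -
  define D where "D s = exp (- c * s) * integral {0..s} \<phi>" for s
  have hD: "((\<lambda>s. exp (- c * s) * (\<phi> s - c * integral {0..s} \<phi>)) has_integral (D t - D 0)) {0..t}"
  proof (rule fundamental_theorem_of_calculus)
    fix s assume s: "s \<in> {0..t}"
    have "((\<lambda>s. integral {0..s} \<phi>) has_real_derivative \<phi> s) (at s within {0..t})"
      using s t integral_has_vector_derivative[OF continuous_on_subset[OF \<phi>], of 0 t s]
      by (auto simp: has_real_derivative_iff_has_vector_derivative)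
    then have "(D has_real_derivative exp (- c * s) * (\<phi> s - c * integral {0..s} \<phi>)) (at s within {0..t})"
      unfolding D_def[abs_def] by (auto intro!: derivative_eq_intros simp: algebra_simps)
    then show "(D has_vector_derivative exp (- c * s) * (\<phi> s - c * integral {0..s} \<phi>)) (at s within {0..t})"
      by (simp add: has_real_derivative_iff_has_vector_derivative)
  qed (use t in auto)
  have ib: "b integrable_on {0..t}" "b integrable_on {0..T}"
    using t by (auto intro!: integrable_continuous_interval continuous_on_subset[OF b])
  have "D t - D 0 \<le> integral {0..t} b"
  proof (rule has_integral_le[OF hD integrable_integral[OF ib(1)]])
    fix s assume s: "s \<in> {0..t}"
    then have sT: "s \<in> {0..T}" using t by auto
    have "exp (- c * s) * (\<phi> s - c * integral {0..s} \<phi>) \<le> exp (- c * s) * b s"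
      using le[OF sT] by (intro mult_left_mono) auto
    also have "\<dots> \<le> 1 * b s" using s c b0[OF sT] by (intro mult_right_mono) auto
    finally show "exp (- c * s) * (\<phi> s - c * integral {0..s} \<phi>) \<le> b s" by simp
  qed
  also have "integral {0..t} b \<le> integral {0..T} b"
    using t ib b0 by (intro integral_subset_le) auto
  finally have "exp (- c * t) * integral {0..t} \<phi> \<le> integral {0..T} b" by (simp add: D_def)
  then have "exp (c * t) * (exp (- c * t) * integral {0..t} \<phi>) \<le> exp (c * t) * integral {0..T} b"
    by (intro mult_left_mono) auto
  also have "exp (c * t) * (exp (- c * t) * integral {0..t} \<phi>) = integral {0..t} \<phi>"
    by (simp add: mult.assoc[symmetric] exp_add[symmetric])
  also have "exp (c * t) * integral {0..T} b \<le> exp (c * T) * integral {0..T} b"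
    using t c ib b0 by (intro mult_right_mono integral_nonneg) (auto intro: mult_left_mono)
  finally show ?thesis .
qed

text \<open>The inhomogeneity carries the same factor \<open>a\<close> as the growth: for
  \<open>a\<close> proportional to the step size, \<open>a\<close> times the sum of \<open>g\<close>
  is a Riemann sum.\<close>

lemma discrete_gronwall:
  fixes u g :: "nat \<Rightarrow> real"
  assumes u0: "u 0 = 0" and a: "0 \<le> a" and g: "\<And>k. 0 \<le> g k"
    and step: "\<And>n. n < N \<Longrightarrow> u (Suc n) \<le> (1 + a) * u n + a * g n" and n: "n \<le> N"
  shows "u n \<le> exp (a * real n) * (a * (\<Sum>k<n. g k))"
  using n
proof (induction n)
  case (Suc n)
  let ?s = "a * (\<Sum>k<n. g k)"
  have s0: "0 \<le> ?s" using a g by (simp add: sum_nonneg)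
  have "u (Suc n) \<le> (1 + a) * u n + a * g n" using Suc.prems by (intro step) auto
  also have "\<dots> \<le> exp a * (exp (a * real n) * ?s) + exp (a * real (Suc n)) * (a * g n)"
  proof (intro add_mono)
    have "(1 + a) * u n \<le> (1 + a) * (exp (a * real n) * ?s)" using Suc a by (intro mult_left_mono) auto
    also have "\<dots> \<le> exp a * (exp (a * real n) * ?s)"
      using s0 a exp_ge_add_one_self[of a] by (intro mult_right_mono) auto
    finally show "(1 + a) * u n \<le> exp a * (exp (a * real n) * ?s)" .
    have "1 * (a * g n) \<le> exp (a * real (Suc n)) * (a * g n)" using a g by (intro mult_right_mono) auto
    then show "a * g n \<le> exp (a * real (Suc n)) * (a * g n)" by simp
  qed
  also have "\<dots> = exp (a * real (Suc n)) * (a * (\<Sum>k<Suc n. g k))"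
  proof -
    have "exp (a * real (Suc n)) = exp a * exp (a * real n)"
      by (simp add: exp_add[symmetric] distrib_left)
    then show ?thesis by (simp only: sum.lessThan_Suc distrib_left mult.assoc)
  qed
  finally show ?case .
qed (simp add: u0)

lemma sum_integral_cells:
  fixes g :: "real \<Rightarrow> real"
  assumes g: "continuous_on {0..} g" and h: "0 \<le> h"
  shows "(\<Sum>k<n. integral {real k * h..real (Suc k) * h} g) = integral {0..real n * h} g"
proof (induction n)
  case (Suc n)
  have "real n * h \<le> real (Suc n) * h" "0 \<le> real n * h" using h by (auto intro: mult_right_mono)
  then have "integral {0..real n * h} g + integral {real n * h..real (Suc n) * h} g = integral {0..real (Suc n) * h} g"
    by (intro Henstock_Kurzweil_Integration.integral_combine integrable_continuous_interval continuous_on_subset[OF g]) auto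
  then show ?case using Suc.IH by simp
qed simp

lemma integral_norm_mono:
  fixes g :: "real \<Rightarrow> real"
  assumes g: "continuous_on {0..} g" and g0: "\<And>s. 0 \<le> s \<Longrightarrow> 0 \<le> g s" and st: "0 \<le> s" "s \<le> t" "t \<le> T"
  shows "integral {s..t} g \<le> integral {s..T} g"
proof (rule integral_subset_le)
  show "g integrable_on {s..t}" "g integrable_on {s..T}"
    using st by (auto intro!: integrable_continuous_interval continuous_on_subset[OF g])
qed (use st g0 in auto)

text \<open>A time integral of \<open>norm (B s)\<close> stands where a maximum might be expected:
  its moments follow from Gaussian moments at fixed times, without a maximal inequality. The 1 lets
  additive constants be absorbed into multiples of the scale.\<close>

definition path_scale :: "(real \<Rightarrow> real^'m) \<Rightarrow> real^'m \<Rightarrow> real^'m \<Rightarrow> real \<Rightarrow> real" where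
  "path_scale B x y T = 1 + norm x + norm y + integral {0..T} (\<lambda>s. norm (B s))"

text \<open>The first product serves the values of position and momentum at single times, the second
  their time integral; both come from Gronwall with rate \<open>L + 1\<close>.\<close>

definition growth_bound :: "(real^'m \<Rightarrow> real^'m) \<Rightarrow> real \<Rightarrow> real \<Rightarrow> real" where
  "growth_bound V' L T = (1 + norm (V' 0) * T) * (1 + (L + 1) * exp ((L + 1) * T) * (T + 1))
    + exp ((L + 1) * T) * (T + 1) * (1 + norm (V' 0) * T)"

lemma growth_bound_nonneg: "0 \<le> L \<Longrightarrow> 0 \<le> T \<Longrightarrow> 0 \<le> growth_bound V' L T"
  unfolding growth_bound_def by (intro add_nonneg_nonneg mult_nonneg_nonneg) auto

locale lipschitz_path = hamiltonian_path V V' B p q x y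
  for V :: "real^'m \<Rightarrow> real" and V' B p q x y +
  fixes L :: real
  assumes lip: "L-lipschitz_on UNIV V'" and cont_B: "continuous_on {0..} B"
begin

lemma L0: "0 \<le> L" using lip by (simp add: lipschitz_on_def)

lemma V'_diff: "norm (V' a - V' b) \<le> L * norm (a - b)"
  using lipschitz_onD[OF lip, of a b] by (simp add: dist_norm)

lemma V'_growth: "norm (V' a) \<le> norm (V' 0) + L * norm a"
  using V'_diff[of a 0] norm_triangle_ineq2[of "V' a" "V' 0"] by simp

lemma integrable_norms:
  assumes "0 \<le> s"
  shows "(\<lambda>\<tau>. norm (p \<tau>)) integrable_on {s..t}" "(\<lambda>\<tau>. norm (q \<tau>)) integrable_on {s..t}"
    "(\<lambda>\<tau>. norm (V' (q \<tau>))) integrable_on {s..t}" "(\<lambda>\<tau>. norm (B \<tau>)) integrable_on {s..t}"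
proof -
  have "{s..t} \<subseteq> {0..}" using assms by auto
  then show "(\<lambda>\<tau>. norm (p \<tau>)) integrable_on {s..t}" "(\<lambda>\<tau>. norm (q \<tau>)) integrable_on {s..t}"
    "(\<lambda>\<tau>. norm (V' (q \<tau>))) integrable_on {s..t}" "(\<lambda>\<tau>. norm (B \<tau>)) integrable_on {s..t}"
    by (intro integrable_continuous_interval continuous_on_norm continuous_on_subset[OF cont_p]
        continuous_on_subset[OF cont_q] continuous_on_subset[OF cont_V'_q] continuous_on_subset[OF cont_B]; assumption)+
qed

abbreviation path_size :: "real \<Rightarrow> real" where
  "path_size \<equiv> path_scale B x y"

lemma path_size_ge: "0 \<le> T \<Longrightarrow> 1 \<le> path_size T" "0 \<le> T \<Longrightarrow> integral {0..T} (\<lambda>s. norm (B s)) \<le> path_size T"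
  using integral_nonneg[OF integrable_norms(4)[of 0 T]] by (auto simp: path_scale_def)

abbreviation growth_const :: "real \<Rightarrow> real" where
  "growth_const \<equiv> growth_bound V' L"

text \<open>As \<open>V'\<close> grows at most linearly, \<open>norm p + norm q\<close> satisfies a
  linear integral inequality. Feeding the bound for the integral back into it gives the bound at
  time \<open>t\<close>, with \<open>B t\<close> as the only noise term outside the scale.\<close>

lemma path_growth:
  assumes T: "0 \<le> T" and t: "t \<in> {0..T}"
  shows "integral {0..T} (\<lambda>s. norm (p s) + norm (q s)) \<le> growth_const T * path_size T"
    and "norm (p t) + norm (q t) \<le> growth_const T * path_size T + norm (B t)"
proof -
  let ?\<phi> = "\<lambda>s. norm (p s) + norm (q s)"
  define a where "a = norm x + norm y + norm (V' 0) * T"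
  have a0: "0 \<le> a" using T by (simp add: a_def)
  have \<phi>c: "continuous_on {0..} ?\<phi>" by (intro continuous_intros cont_p cont_q)
  have le: "?\<phi> s \<le> (a + norm (B s)) + (L + 1) * integral {0..s} ?\<phi>" if s: "s \<in> {0..T}" for s
  proof -
    have s0: "0 \<le> s" using s by simp
    have "norm (integral {0..s} (\<lambda>\<tau>. V' (q \<tau>))) \<le> integral {0..s} (\<lambda>\<tau>. norm (V' 0) + L * norm (q \<tau>))"
      by (intro integral_norm_bound_integral integrable_path Henstock_Kurzweil_Integration.integrable_add
          integrable_on_mult_right integrable_norms V'_growth) auto
    also have "\<dots> = norm (V' 0) * s + L * integral {0..s} (\<lambda>\<tau>. norm (q \<tau>))"
      using s by (subst Henstock_Kurzweil_Integration.integral_add) (auto intro: integrable_on_mult_right integrable_norms)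
    finally have 1: "norm (integral {0..s} (\<lambda>\<tau>. V' (q \<tau>))) \<le> norm (V' 0) * T + L * integral {0..s} (\<lambda>\<tau>. norm (q \<tau>))"
      using s mult_left_mono[of s T "norm (V' 0)"] by simp
    have 2: "norm (integral {0..s} p) \<le> integral {0..s} (\<lambda>\<tau>. norm (p \<tau>))"
      by (intro integral_norm_bound_integral integrable_path integrable_norms) auto
    have "norm (p s) \<le> norm x + norm (integral {0..s} (\<lambda>\<tau>. V' (q \<tau>))) + norm (B s)"
      unfolding p_eq[OF s0] by (intro order_trans[OF norm_triangle_ineq] add_right_mono norm_triangle_ineq4)
    moreover have "norm (q s) \<le> norm y + norm (integral {0..s} p)"
      unfolding q_eq[OF s0] by (rule norm_triangle_ineq)
    moreover have "L * integral {0..s} (\<lambda>\<tau>. norm (q \<tau>)) + integral {0..s} (\<lambda>\<tau>. norm (p \<tau>)) \<le> (L + 1) * integral {0..s} ?\<phi>"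
    proof -
      have "integral {0..s} ?\<phi> = integral {0..s} (\<lambda>\<tau>. norm (p \<tau>)) + integral {0..s} (\<lambda>\<tau>. norm (q \<tau>))"
        by (intro Henstock_Kurzweil_Integration.integral_add integrable_norms) auto
      moreover have "0 \<le> integral {0..s} (\<lambda>\<tau>. norm (p \<tau>))" "0 \<le> integral {0..s} (\<lambda>\<tau>. norm (q \<tau>))"
        by (intro integral_nonneg integrable_norms; simp)+
      ultimately show ?thesis using L0 by (simp add: distrib_left distrib_right)
    qed
    ultimately show ?thesis using 1 2 by (simp add: a_def)
  qed
  have ia: "integral {0..T} (\<lambda>s. a + norm (B s)) = a * T + integral {0..T} (\<lambda>s. norm (B s))"
    using T by (subst Henstock_Kurzweil_Integration.integral_add) (auto intro: integrable_norms)
  have int: "integral {0..s} ?\<phi> \<le> exp ((L + 1) * T) * integral {0..T} (\<lambda>s. a + norm (B s))" if "s \<in> {0..T}" for s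
    by (rule integral_gronwall[OF _ _ _ _ le that])
      (use L0 a0 in \<open>auto intro!: continuous_intros intro: continuous_on_subset[OF \<phi>c] continuous_on_subset[OF cont_p] continuous_on_subset[OF cont_q] continuous_on_subset[OF cont_B]\<close>)
  have a_le: "a \<le> (1 + norm (V' 0) * T) * path_size T"
  proof -
    have "norm x + norm y \<le> path_size T" using integral_nonneg[OF integrable_norms(4)[of 0 T]] by (simp add: path_scale_def)
    moreover have "norm (V' 0) * T * 1 \<le> norm (V' 0) * T * path_size T" using T path_size_ge by (intro mult_left_mono) auto
    ultimately show ?thesis by (simp add: a_def distrib_right)
  qed
  define k where "k = 1 + norm (V' 0) * T"
  have k1: "1 \<le> k" using T by (simp add: k_def)
  have "1 * path_size T \<le> k * path_size T" using k1 path_size_ge[OF T] by (intro mult_right_mono) auto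
  then have "integral {0..T} (\<lambda>s. norm (B s)) \<le> k * path_size T" using path_size_ge(2)[OF T] by linarith
  moreover have "a * T \<le> (k * path_size T) * T" unfolding k_def using a_le T by (rule mult_right_mono)
  ultimately have "a * T + integral {0..T} (\<lambda>s. norm (B s)) \<le> k * (T + 1) * path_size T"
    by (simp add: algebra_simps)
  then have int': "integral {0..s} ?\<phi> \<le> exp ((L + 1) * T) * (k * (T + 1) * path_size T)" if "s \<in> {0..T}" for s
    unfolding ia[symmetric] by (intro order_trans[OF int[OF that]] mult_left_mono) auto
  have s0: "0 \<le> path_size T" using path_size_ge[OF T] by simp
  have gc: "growth_const T * path_size T = k * path_size T + (L + 1) * (exp ((L + 1) * T) * (k * (T + 1) * path_size T)) + exp ((L + 1) * T) * (k * (T + 1) * path_size T)"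
    by (simp add: growth_bound_def k_def algebra_simps)
  have nn: "0 \<le> k * path_size T" "0 \<le> (L + 1) * (exp ((L + 1) * T) * (k * (T + 1) * path_size T))" "0 \<le> exp ((L + 1) * T) * (k * (T + 1) * path_size T)"
    using k1 T s0 L0 by auto
  show "integral {0..T} ?\<phi> \<le> growth_const T * path_size T"
    using int'[of T] T nn unfolding gc by simp
  have "(L + 1) * integral {0..t} ?\<phi> \<le> (L + 1) * (exp ((L + 1) * T) * (k * (T + 1) * path_size T))"
    using L0 int'[OF t] by (intro mult_left_mono) auto
  then show "norm (p t) + norm (q t) \<le> growth_const T * path_size T + norm (B t)"
    using le[OF t] a_le nn unfolding gc by (simp add: k_def)
qed

end

section \<open>Pathwise error of the scheme\<close>

definition driving_lag :: "(real \<Rightarrow> real^'m) \<Rightarrow> real \<Rightarrow> nat \<Rightarrow> real^'m" where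
  "driving_lag B h n = integral {real n * h..real (Suc n) * h} (\<lambda>s. B (real (Suc n) * h) - B s)"

definition driving_lag_sum :: "(real \<Rightarrow> real^'m) \<Rightarrow> real \<Rightarrow> nat \<Rightarrow> real^'m" where
  "driving_lag_sum B h n = (\<Sum>j<n. driving_lag B h j)"

text \<open>\<open>6 * L + 2\<close> is the rate in \<open>error_step\<close>, the last factor
  bounds the accumulated defects, and the leading 1 pays for removing \<open>driving_lag_sum\<close>
  from the compensated position error.\<close>

definition scheme_error_const :: "(real^'m \<Rightarrow> real^'m) \<Rightarrow> real \<Rightarrow> real \<Rightarrow> real" where
  "scheme_error_const V' L T = 1 + exp ((6 * L + 2) * T) * (6 * L + 2)
    * (2 + growth_bound V' L T + norm (V' 0) * T + L * growth_bound V' L T)"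

context lipschitz_path
begin

abbreviation lag :: "real \<Rightarrow> nat \<Rightarrow> real^'m" where "lag \<equiv> driving_lag B"
abbreviation lag_sum :: "real \<Rightarrow> nat \<Rightarrow> real^'m" where "lag_sum \<equiv> driving_lag_sum B"
abbreviation error_const :: "real \<Rightarrow> real" where "error_const \<equiv> scheme_error_const V' L"

lemma norm_integral_le:
  fixes g :: "real \<Rightarrow> real^'m"
  assumes "continuous_on {0..} g" "0 \<le> s"
  shows "norm (integral {s..t} g) \<le> integral {s..t} (\<lambda>\<tau>. norm (g \<tau>))"
proof -
  have "{s..t} \<subseteq> {0..}" using assms(2) by auto
  then have "continuous_on {s..t} g" using assms(1) by (rule continuous_on_subset[rotated])
  then show ?thesis
    by (intro integral_norm_bound_integral integrable_continuous_interval continuous_on_norm) auto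
qed

text \<open>A crude bound suffices: single lags enter only through \<open>defect\<close>, where a
  further factor \<open>h\<close> is available.\<close>

lemma norm_lag_le:
  assumes h: "0 \<le> h"
  shows "norm (lag h n) \<le> integral {real n * h..real (Suc n) * h} (\<lambda>s. norm (B s)) + h * norm (B (real (Suc n) * h))"
proof -
  let ?s = "real n * h" and ?t = "real (Suc n) * h"
  have st: "0 \<le> ?s" "?s \<le> ?t" "?t - ?s = h" using h by (auto simp: algebra_simps)
  have iB: "B integrable_on {?s..?t}"
    using st by (intro integrable_continuous_interval continuous_on_subset[OF cont_B]) auto
  have "lag h n = h *\<^sub>R B ?t - integral {?s..?t} B"
    unfolding driving_lag_def using iB st by (subst Henstock_Kurzweil_Integration.integral_diff) auto
  also have "norm \<dots> \<le> norm (h *\<^sub>R B ?t) + norm (integral {?s..?t} B)" by (rule norm_triangle_ineq4)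
  also have "\<dots> \<le> h * norm (B ?t) + integral {?s..?t} (\<lambda>s. norm (B s))"
    using norm_integral_le[OF cont_B st(1)] h by (intro add_mono) auto
  finally show ?thesis by simp
qed

end

text \<open>The conditions \<open>h \<le> 1\<close> and \<open>h * L \<le> 1\<close> allow the
  implicit stage to be absorbed in \<open>error_step\<close>.\<close>

locale scheme_path = lipschitz_path V V' B p q x y L
  for V :: "real^'m \<Rightarrow> real" and V' B p q x y L +
  fixes h :: real and P Q \<Psi> G :: "nat \<Rightarrow> real^'m"
  assumes B0: "B 0 = 0" and h: "0 < h" "h \<le> 1" "h * L \<le> 1"
    and P0: "P 0 = x" and Q0: "Q 0 = y"
    and G: "\<And>n. G n = integral {0..1} (\<lambda>s. V' (Q n + (s * h) *\<^sub>R \<Psi> n))"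
    and \<Psi>: "\<And>n. \<Psi> n = P n + (B (real (Suc n) * h) - B (real n * h)) - (h / 2) *\<^sub>R G n"
    and QS: "\<And>n. Q (Suc n) = Q n + h *\<^sub>R \<Psi> n"
    and PS: "\<And>n. P (Suc n) = P n + (B (real (Suc n) * h) - B (real n * h)) - h *\<^sub>R G n"
begin

abbreviation ep :: "nat \<Rightarrow> real^'m" where "ep n \<equiv> p (real n * h) - P n"
abbreviation eq :: "nat \<Rightarrow> real^'m" where "eq n \<equiv> q (real n * h) - Q n"
abbreviation cell :: "(real \<Rightarrow> real) \<Rightarrow> nat \<Rightarrow> real" where
  "cell g n \<equiv> integral {real n * h..real (Suc n) * h} g"

text \<open>Adding the accumulated lag to the position error removes its only contribution of order \<open>h powr (3/2)\<close> per step.\<close>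

abbreviation total_error :: "nat \<Rightarrow> real" where
  "total_error n \<equiv> norm (ep n) + norm (eq n + lag_sum h n)"

abbreviation defect :: "nat \<Rightarrow> real" where
  "defect n \<equiv> norm (lag_sum h n) + cell (\<lambda>s. norm (p s)) n + norm (lag h n) + cell (\<lambda>s. norm (V' (q s))) n"

text \<open>Every point of the averaging segment lies within \<open>h * norm (\<Psi> n)\<close> of
  \<open>Q n\<close>, which in turn is compared with the exact position at the start of the
  cell.\<close>

lemma scheme_force_diff:
  "norm (h *\<^sub>R G n - h *\<^sub>R V' (q (real n * h))) \<le> h * L * (norm (eq n) + h * norm (\<Psi> n))"
proof -
  let ?c = "V' (q (real n * h))"
  have c: "continuous_on {0..1} (\<lambda>s. V' (Q n + (s * h) *\<^sub>R \<Psi> n))"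
    by (intro continuous_on_compose2[OF cont_V'] continuous_intros) auto
  have "G n - ?c = integral {0..1} (\<lambda>s. V' (Q n + (s * h) *\<^sub>R \<Psi> n) - ?c)"
    unfolding G using integrable_continuous_interval[OF c]
    by (subst Henstock_Kurzweil_Integration.integral_diff) auto
  also have "norm \<dots> \<le> L * (norm (eq n) + h * norm (\<Psi> n)) * (1 - 0)"
  proof (rule integral_bound)
    show "continuous_on {0..1} (\<lambda>s. V' (Q n + (s * h) *\<^sub>R \<Psi> n) - ?c)" by (intro continuous_intros c)
    fix s :: real assume s: "s \<in> {0..1}"
    have "norm (V' (Q n + (s * h) *\<^sub>R \<Psi> n) - ?c) \<le> L * norm (Q n + (s * h) *\<^sub>R \<Psi> n - q (real n * h))"
      by (rule V'_diff)
    also have "norm (Q n + (s * h) *\<^sub>R \<Psi> n - q (real n * h)) \<le> norm (eq n) + norm ((s * h) *\<^sub>R \<Psi> n)"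
      using norm_triangle_ineq[of "- eq n" "(s * h) *\<^sub>R \<Psi> n"] by (simp only: norm_minus_cancel) (simp add: algebra_simps)
    also have "norm ((s * h) *\<^sub>R \<Psi> n) \<le> h * norm (\<Psi> n)"
      using s h(1) by (auto simp: abs_mult intro!: mult_right_mono mult_left_le_one_le)
    finally show "norm (V' (Q n + (s * h) *\<^sub>R \<Psi> n) - ?c) \<le> L * (norm (eq n) + h * norm (\<Psi> n))"
      using L0 by (simp add: mult_left_mono)
  qed simp
  finally have le: "norm (G n - ?c) \<le> L * (norm (eq n) + h * norm (\<Psi> n))" by simp
  have "norm (h *\<^sub>R G n - h *\<^sub>R ?c) = h * norm (G n - ?c)"
    using h(1) by (simp add: scaleR_diff_right[symmetric])
  also have "\<dots> \<le> h * (L * (norm (eq n) + h * norm (\<Psi> n)))" using h(1) by (intro mult_left_mono le) auto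
  finally show ?thesis by (simp add: mult.assoc)
qed

text \<open>Within the cell the exact position moves by at most the integral of
  \<open>norm (p s)\<close>; again an integral takes the place of a maximum.\<close>

lemma exact_force_diff:
  "norm (integral {real n * h..real (Suc n) * h} (\<lambda>s. V' (q s)) - h *\<^sub>R V' (q (real n * h)))
    \<le> h * L * cell (\<lambda>s. norm (p s)) n"
proof -
  let ?s = "real n * h" and ?t = "real (Suc n) * h"
  have st: "0 \<le> ?s" "?s \<le> ?t" "?t - ?s = h" using h by (auto simp: algebra_simps)
  have "integral {?s..?t} (\<lambda>s. V' (q s)) - h *\<^sub>R V' (q ?s) = integral {?s..?t} (\<lambda>s. V' (q s) - V' (q ?s))"
    using integrable_path(2)[OF st(1), of ?t] st by (subst Henstock_Kurzweil_Integration.integral_diff) auto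
  also have "norm \<dots> \<le> L * cell (\<lambda>s. norm (p s)) n * (?t - ?s)"
  proof (rule integral_bound[OF st(2)])
    show "continuous_on {?s..?t} (\<lambda>s. V' (q s) - V' (q ?s))"
      using st by (intro continuous_intros continuous_on_subset[OF cont_V'_q]) auto
    fix \<tau> assume \<tau>: "\<tau> \<in> {?s..?t}"
    have "norm (V' (q \<tau>) - V' (q ?s)) \<le> L * norm (q \<tau> - q ?s)" by (rule V'_diff)
    also have "norm (q \<tau> - q ?s) = norm (integral {?s..\<tau>} p)" using \<tau> st by (subst q_increment) auto
    also have "\<dots> \<le> integral {?s..\<tau>} (\<lambda>s. norm (p s))" by (rule norm_integral_le[OF cont_p st(1)])
    also have "\<dots> \<le> cell (\<lambda>s. norm (p s)) n"
      using \<tau> st by (intro integral_norm_mono continuous_on_norm cont_p) auto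
    finally show "norm (V' (q \<tau>) - V' (q ?s)) \<le> L * cell (\<lambda>s. norm (p s)) n"
      using L0 by (simp add: mult_left_mono)
  qed
  finally show ?thesis unfolding st(3) by (simp only: mult_ac)
qed

lemma p_error_step:
  "ep (Suc n) = ep n + (h *\<^sub>R G n - integral {real n * h..real (Suc n) * h} (\<lambda>s. V' (q s)))"
  using p_increment[of "real n * h" "real (Suc n) * h"] h by (simp add: PS algebra_simps mult_right_mono)

text \<open>Over a cell the scheme moves the position with the full noise increment, the exact
  solution only with the noise received so far. The surplus is exactly \<open>lag h n\<close>; it is
  kept with its sign, while the force terms collect in \<open>b\<close>, which is of second order in
  \<open>h\<close>.\<close>

lemma q_error_step:
  defines "b n \<equiv> integral {real n * h..real (Suc n) * h} (\<lambda>s. (h / 2) *\<^sub>R G n - integral {real n * h..s} (\<lambda>\<tau>. V' (q \<tau>)))"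
  shows "eq (Suc n) = eq n + h *\<^sub>R ep n - lag h n + b n"
    and "norm (b n) \<le> h * (h / 2 * norm (G n) + cell (\<lambda>s. norm (V' (q s))) n)"
proof -
  let ?s = "real n * h" and ?t = "real (Suc n) * h"
  have st: "0 \<le> ?s" "?s \<le> ?t" "?t - ?s = h" using h by (auto simp: algebra_simps)
  have sub: "{?s..?t} \<subseteq> {0..}" using st by auto
  have cI: "continuous_on {?s..?t} (\<lambda>s. integral {?s..s} (\<lambda>\<tau>. V' (q \<tau>)))"
    by (rule indefinite_integral_continuous_1[OF integrable_path(2)[OF st(1)]])
  have pt: "p s - \<Psi> n = ep n - (B ?t - B s) + ((h / 2) *\<^sub>R G n - integral {?s..s} (\<lambda>\<tau>. V' (q \<tau>)))" if "s \<in> {?s..?t}" for s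
    using p_increment[of ?s s] that st by (simp add: \<Psi> algebra_simps)
  have iL: "(\<lambda>s. B ?t - B s) integrable_on {?s..?t}"
    by (intro integrable_continuous_interval continuous_intros continuous_on_subset[OF cont_B sub])
  have iR: "(\<lambda>s. (h / 2) *\<^sub>R G n - integral {?s..s} (\<lambda>\<tau>. V' (q \<tau>))) integrable_on {?s..?t}"
    by (intro integrable_continuous_interval continuous_intros cI)
  have "eq (Suc n) - eq n = integral {?s..?t} p - h *\<^sub>R \<Psi> n"
    using q_increment[OF st(1,2)] by (simp add: QS algebra_simps)
  also have "\<dots> = integral {?s..?t} (\<lambda>s. p s - \<Psi> n)"
    using integrable_path(1)[OF st(1), of ?t] st by (subst Henstock_Kurzweil_Integration.integral_diff) auto
  also have "\<dots> = integral {?s..?t} (\<lambda>s. ep n - (B ?t - B s) + ((h / 2) *\<^sub>R G n - integral {?s..s} (\<lambda>\<tau>. V' (q \<tau>))))"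
    by (rule Henstock_Kurzweil_Integration.integral_cong[OF pt])
  also have "\<dots> = integral {?s..?t} (\<lambda>s. ep n - (B ?t - B s)) + b n"
    unfolding b_def by (intro Henstock_Kurzweil_Integration.integral_add iR Henstock_Kurzweil_Integration.integrable_diff iL) auto
  also have "integral {?s..?t} (\<lambda>s. ep n - (B ?t - B s)) = h *\<^sub>R ep n - lag h n"
    unfolding driving_lag_def using iL st by (subst Henstock_Kurzweil_Integration.integral_diff) auto
  finally show "eq (Suc n) = eq n + h *\<^sub>R ep n - lag h n + b n" by (simp add: algebra_simps)
  have "norm (b n) \<le> (h / 2 * norm (G n) + cell (\<lambda>s. norm (V' (q s))) n) * (?t - ?s)"
    unfolding b_def
  proof (rule integral_bound[OF st(2)])
    show "continuous_on {?s..?t} (\<lambda>s. (h / 2) *\<^sub>R G n - integral {?s..s} (\<lambda>\<tau>. V' (q \<tau>)))"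
      by (intro continuous_intros cI)
    fix s assume s: "s \<in> {?s..?t}"
    have "norm (integral {?s..s} (\<lambda>\<tau>. V' (q \<tau>))) \<le> integral {?s..s} (\<lambda>\<tau>. norm (V' (q \<tau>)))"
      by (rule norm_integral_le[OF cont_V'_q st(1)])
    also have "\<dots> \<le> cell (\<lambda>s. norm (V' (q s))) n"
      using s st by (intro integral_norm_mono continuous_on_norm cont_V'_q) auto
    finally show "norm ((h / 2) *\<^sub>R G n - integral {?s..s} (\<lambda>\<tau>. V' (q \<tau>))) \<le> h / 2 * norm (G n) + cell (\<lambda>s. norm (V' (q s))) n"
      using h(1) norm_triangle_ineq4[of "(h / 2) *\<^sub>R G n" "integral {?s..s} (\<lambda>\<tau>. V' (q \<tau>))"] by simp
  qed
  then show "norm (b n) \<le> h * (h / 2 * norm (G n) + cell (\<lambda>s. norm (V' (q s))) n)"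
    unfolding st(3) by (simp only: mult.commute)
qed

text \<open>The implicit stage makes the force error \<open>a\<close> appear on both sides: it is
  bounded through \<open>h * norm (\<Psi> n)\<close>, which again contains \<open>a / 2\<close>. As
  \<open>h * L \<le> 1\<close>, at most half of \<open>a\<close> returns and can be absorbed. In the
  rate, \<open>6 * L\<close> stems from the force error, counted three halves times, and 2 from the
  momentum error and the integrated force acting on the position.\<close>

lemma error_step: "total_error (Suc n) \<le> (1 + (6 * L + 2) * h) * total_error n + (6 * L + 2) * h * defect n"
proof -
  let ?s = "real n * h" and ?t = "real (Suc n) * h"
  define I where "I = integral {?s..?t} (\<lambda>s. V' (q s))"
  define b where "b = integral {?s..?t} (\<lambda>s. (h / 2) *\<^sub>R G n - integral {?s..s} (\<lambda>\<tau>. V' (q \<tau>)))"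
  define A where "A = cell (\<lambda>s. norm (p s)) n"
  define D where "D = cell (\<lambda>s. norm (V' (q s))) n"
  define J where "J = norm (lag h n)"
  define a where "a = norm (h *\<^sub>R G n - I)"
  define e where "e = norm (ep n)"
  define f where "f = norm (eq n)"
  define S where "S = norm (lag_sum h n)"
  define z where "z = norm (eq n + lag_sum h n)"
  have st: "0 \<le> ?s" "?s \<le> ?t" using h by (auto simp: algebra_simps)
  have A0: "0 \<le> A" unfolding A_def by (intro integral_nonneg integrable_norms st) auto
  have D0: "0 \<le> D" unfolding D_def by (intro integral_nonneg integrable_norms st) auto
  have nn: "0 \<le> a" "0 \<le> e" "0 \<le> f" "0 \<le> J" "0 \<le> S" "0 \<le> z" by (simp_all add: a_def e_def f_def J_def S_def z_def)
  have ID: "norm I \<le> D" unfolding I_def D_def by (rule norm_integral_le[OF cont_V'_q st(1)])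
  have qs: "eq (Suc n) = eq n + h *\<^sub>R ep n - lag h n + b" and nb: "norm b \<le> h * (h / 2 * norm (G n) + D)"
    using q_error_step[of n] by (simp_all only: b_def D_def)
  have hG: "h * norm (G n) \<le> a + D"
  proof -
    have "h * norm (G n) = norm ((h *\<^sub>R G n - I) + I)" using h(1) by simp
    also have "\<dots> \<le> a + norm I" unfolding a_def by (rule norm_triangle_ineq)
    finally show ?thesis using ID by simp
  qed
  have b1: "norm b \<le> h * (a / 2) + h * (3 / 2 * D)"
  proof -
    have "h * (h / 2 * norm (G n) + D) = h * ((h * norm (G n)) / 2 + D)" by simp
    also have "\<dots> \<le> h * ((a + D) / 2 + D)" using hG h(1) by (intro mult_left_mono) auto
    also have "\<dots> = h * (a / 2) + h * (3 / 2 * D)" by (simp add: field_simps)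
    finally show ?thesis using nb by linarith
  qed
  have ha: "h * (a / 2) \<le> a / 2" using h nn(1) by (intro mult_left_le_one_le) auto
  have hD: "h * (3 / 2 * D) \<le> 3 / 2 * D" using h D0 by (intro mult_left_le_one_le) auto
  have he: "h * e \<le> e" using h nn(2) by (intro mult_left_le_one_le) auto
  \<comment> \<open>The stage is recovered from the exact displacement and the position error step,
    so the bound involves the exact path and the errors, but no a priori size of the scheme.\<close>
  have \<psi>: "h * norm (\<Psi> n) \<le> A + e + J + a / 2 + 3 / 2 * D"
  proof -
    have "h *\<^sub>R \<Psi> n = integral {?s..?t} p - (h *\<^sub>R ep n - lag h n + b)"
      using q_increment[OF st] qs by (simp add: QS algebra_simps)
    then have "norm (h *\<^sub>R \<Psi> n) \<le> norm (integral {?s..?t} p) + norm (h *\<^sub>R ep n - lag h n + b)"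
      by (simp only: norm_triangle_ineq4)
    also have "norm (integral {?s..?t} p) \<le> A" unfolding A_def by (rule norm_integral_le[OF cont_p st(1)])
    finally have "h * norm (\<Psi> n) \<le> A + norm (h *\<^sub>R ep n - lag h n + b)" using h(1) by simp
    moreover have "norm (h *\<^sub>R ep n - lag h n + b) \<le> h * e + J + norm b"
      using norm_triangle_ineq[of "h *\<^sub>R ep n - lag h n" b] norm_triangle_ineq4[of "h *\<^sub>R ep n" "lag h n"] h(1)
      by (simp add: e_def J_def)
    ultimately show ?thesis using b1 ha hD he by linarith
  qed
  define X where "X = f + 2 * A + e + J + 3 / 2 * D"
  have hL: "0 \<le> h * L" using h(1) L0 by simp
  have a1: "a \<le> h * L * (f + h * norm (\<Psi> n)) + h * L * A"
  proof -
    have "a = norm ((h *\<^sub>R G n - h *\<^sub>R V' (q ?s)) - (I - h *\<^sub>R V' (q ?s)))" by (simp add: a_def)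
    also have "\<dots> \<le> norm (h *\<^sub>R G n - h *\<^sub>R V' (q ?s)) + norm (I - h *\<^sub>R V' (q ?s))" by (rule norm_triangle_ineq4)
    also have "\<dots> \<le> h * L * (f + h * norm (\<Psi> n)) + h * L * A"
      unfolding f_def I_def A_def by (intro add_mono scheme_force_diff exact_force_diff)
    finally show ?thesis .
  qed
  have "h * L * (f + h * norm (\<Psi> n)) + h * L * A = h * L * (f + h * norm (\<Psi> n) + A)" by (simp add: distrib_left)
  also have "\<dots> \<le> h * L * (X + a / 2)" using \<psi> hL by (intro mult_left_mono) (auto simp: X_def)
  also have "\<dots> = h * L * X + h * L * (a / 2)" by (simp add: distrib_left)
  also have "h * L * (a / 2) \<le> a / 2" using hL h(3) nn(1) by (intro mult_left_le_one_le) auto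
  finally have a2: "a \<le> 2 * (h * L * X)" using a1 by simp
  have f_le: "f \<le> z + S" using norm_triangle_ineq4[of "eq n + lag_sum h n" "lag_sum h n"] by (simp add: f_def z_def S_def)
  have "norm (ep (Suc n)) \<le> e + a"
    unfolding p_error_step a_def e_def I_def by (rule norm_triangle_ineq)
  moreover have "norm (eq (Suc n) + lag_sum h (Suc n)) \<le> z + h * e + norm b"
  proof -
    \<comment> \<open>The new lag in \<open>lag_sum h (Suc n)\<close> cancels the one in the error
      step, which is the purpose of the compensation.\<close>
    have "eq (Suc n) + lag_sum h (Suc n) = (eq n + lag_sum h n) + h *\<^sub>R ep n + b"
      by (simp only: qs driving_lag_sum_def sum.lessThan_Suc) (simp add: algebra_simps)
    then show ?thesis
      using norm_triangle_ineq[of "(eq n + lag_sum h n) + h *\<^sub>R ep n" b] norm_triangle_ineq[of "eq n + lag_sum h n" "h *\<^sub>R ep n"] h(1)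
      by (simp only: norm_scaleR z_def e_def)
  qed
  ultimately have "total_error (Suc n) \<le> (e + z) + (3 / 2 * a + h * e + h * (3 / 2 * D))"
    using b1 ha by linarith
  also have "\<dots> \<le> (e + z) + (6 * L + 2) * h * ((e + z) + (S + A + J + D))"
  proof (rule add_left_mono)
    have XL: "X \<le> (e + z) + S + 2 * A + J + 3 / 2 * D" using f_le by (simp add: X_def)
    have "3 / 2 * a \<le> 3 * (h * L * X)" using a2 by linarith
    also have "\<dots> \<le> 3 * (h * L * ((e + z) + S + 2 * A + J + 3 / 2 * D))"
      using hL XL by (intro mult_left_mono) auto
    also have "\<dots> \<le> 3 * (h * L * (2 * ((e + z) + (S + A + J + D))))"
      using hL nn A0 D0 by (intro mult_left_mono) auto
    finally have 1: "3 / 2 * a \<le> 6 * L * h * ((e + z) + (S + A + J + D))" by (simp add: mult_ac)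
    have "h * e + h * (3 / 2 * D) = h * (e + 3 / 2 * D)" by (simp add: distrib_left)
    also have "\<dots> \<le> h * (2 * ((e + z) + (S + A + J + D)))"
      using h(1) nn A0 D0 by (intro mult_left_mono) auto
    finally have 2: "h * e + h * (3 / 2 * D) \<le> 2 * h * ((e + z) + (S + A + J + D))" by (simp only: mult_ac)
    have "(6 * L + 2) * h * ((e + z) + (S + A + J + D)) = 6 * L * h * ((e + z) + (S + A + J + D)) + 2 * h * ((e + z) + (S + A + J + D))"
      by (simp only: distrib_right)
    then show "3 / 2 * a + h * e + h * (3 / 2 * D) \<le> (6 * L + 2) * h * ((e + z) + (S + A + J + D))"
      using 1 2 by linarith
  qed
  also have "\<dots> = (1 + (6 * L + 2) * h) * (e + z) + (6 * L + 2) * h * (S + A + J + D)"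
    by (simp only: distrib_right distrib_left mult_1 add.assoc)
  finally show ?thesis by (simp only: e_def z_def S_def A_def J_def D_def)
qed

text \<open>Summed over the steps, the cells in \<open>defect\<close> become time integrals over
  \<open>[0, T]\<close>, controlled by \<open>path_growth\<close>, and the factor \<open>h\<close>
  from \<open>error_step\<close> remains in front. Only the accumulated lag is left without such a
  factor.\<close>

lemma error_bound:
  assumes hN: "real N * h = T" and n: "n \<le> N"
  shows "norm (ep n) + norm (eq n) \<le> error_const T * (norm (lag_sum h n) + (\<Sum>k<N. h * norm (lag_sum h k))
    + h * (path_size T + (\<Sum>k<N. h * norm (B (real (Suc k) * h)))))"
proof -
  define c where "c = 6 * L + 2"
  have c: "0 \<le> c" using L0 by (simp add: c_def)
  have T: "0 \<le> T" using hN h(1) by (metis less_imp_le mult_nonneg_nonneg of_nat_0_le_iff)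
  define Ss where "Ss = (\<Sum>k<N. norm (lag_sum h k))"
  define Bs where "Bs = (\<Sum>k<N. h * norm (B (real (Suc k) * h)))"
  have nn: "0 \<le> Ss" "0 \<le> Bs" using h(1) by (auto simp: Ss_def Bs_def intro!: sum_nonneg)
  have gc: "0 \<le> growth_const T" by (rule growth_bound_nonneg[OF L0 T])
  have ps: "1 \<le> path_size T" by (rule path_size_ge(1)[OF T])
  have cell0: "0 \<le> cell (\<lambda>s. norm (p s)) k" "0 \<le> cell (\<lambda>s. norm (V' (q s))) k" for k
    using h(1) by (intro integral_nonneg integrable_norms; simp)+
  have int_p: "integral {0..T} (\<lambda>s. norm (p s)) \<le> growth_const T * path_size T"
    and int_q: "integral {0..T} (\<lambda>s. norm (q s)) \<le> growth_const T * path_size T"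
  proof -
    have "integral {0..T} (\<lambda>s. norm (p s) + norm (q s)) = integral {0..T} (\<lambda>s. norm (p s)) + integral {0..T} (\<lambda>s. norm (q s))"
      by (intro Henstock_Kurzweil_Integration.integral_add integrable_norms) auto
    moreover have "0 \<le> integral {0..T} (\<lambda>s. norm (p s))" "0 \<le> integral {0..T} (\<lambda>s. norm (q s))"
      by (intro integral_nonneg integrable_norms; simp)+
    ultimately show "integral {0..T} (\<lambda>s. norm (p s)) \<le> growth_const T * path_size T"
      "integral {0..T} (\<lambda>s. norm (q s)) \<le> growth_const T * path_size T"
      using path_growth(1)[OF T, of 0] T by auto
  qed
  have int_V: "integral {0..T} (\<lambda>s. norm (V' (q s))) \<le> norm (V' 0) * T + L * (growth_const T * path_size T)"
  proof -
    have "integral {0..T} (\<lambda>s. norm (V' (q s))) \<le> integral {0..T} (\<lambda>s. norm (V' 0) + L * norm (q s))"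
      by (intro integral_le integrable_norms Henstock_Kurzweil_Integration.integrable_add
          integrable_on_mult_right V'_growth) auto
    also have "\<dots> = norm (V' 0) * T + L * integral {0..T} (\<lambda>s. norm (q s))"
      using T by (subst Henstock_Kurzweil_Integration.integral_add) (auto intro: integrable_on_mult_right integrable_norms)
    finally show ?thesis using mult_left_mono[OF int_q L0] by linarith
  qed
  have "(\<Sum>k<n. defect k) \<le> (\<Sum>k<N. defect k)"
    using n cell0 by (intro sum_mono2) (auto intro!: add_nonneg_nonneg)
  also have "\<dots> = Ss + (\<Sum>k<N. cell (\<lambda>s. norm (p s)) k) + (\<Sum>k<N. norm (lag h k)) + (\<Sum>k<N. cell (\<lambda>s. norm (V' (q s))) k)"
    by (simp add: Ss_def sum.distrib)
  also have "(\<Sum>k<N. cell (\<lambda>s. norm (p s)) k) = integral {0..T} (\<lambda>s. norm (p s))"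
    unfolding hN[symmetric] using h(1) by (intro sum_integral_cells continuous_on_norm cont_p) auto
  also have "(\<Sum>k<N. cell (\<lambda>s. norm (V' (q s))) k) = integral {0..T} (\<lambda>s. norm (V' (q s)))"
    unfolding hN[symmetric] using h(1) by (intro sum_integral_cells continuous_on_norm cont_V'_q) auto
  finally have 1: "(\<Sum>k<n. defect k) \<le> Ss + integral {0..T} (\<lambda>s. norm (p s)) + (\<Sum>k<N. norm (lag h k)) + integral {0..T} (\<lambda>s. norm (V' (q s)))" .
  have "(\<Sum>k<N. norm (lag h k)) \<le> (\<Sum>k<N. cell (\<lambda>s. norm (B s)) k + h * norm (B (real (Suc k) * h)))"
    using h(1) by (intro sum_mono norm_lag_le) auto
  also have "\<dots> = (\<Sum>k<N. cell (\<lambda>s. norm (B s)) k) + Bs" by (simp only: sum.distrib Bs_def)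
  also have "(\<Sum>k<N. cell (\<lambda>s. norm (B s)) k) = integral {0..T} (\<lambda>s. norm (B s))"
    unfolding hN[symmetric] using h(1) by (intro sum_integral_cells continuous_on_norm cont_B) auto
  finally have 2: "(\<Sum>k<N. norm (lag h k)) \<le> path_size T + Bs" using path_size_ge(2)[OF T] by linarith
  define C1 where "C1 = 2 + growth_const T + norm (V' 0) * T + L * growth_const T"
  have C1: "1 \<le> C1" using gc T L0 by (simp add: C1_def)
  have "(\<Sum>k<n. defect k) \<le> Ss + Bs + (growth_const T * path_size T + path_size T + norm (V' 0) * T + L * (growth_const T * path_size T))"
    using 1 2 int_p int_V by linarith
  also have "\<dots> \<le> C1 * Ss + C1 * Bs + C1 * path_size T"
  proof (intro add_mono)
    show "Ss \<le> C1 * Ss" "Bs \<le> C1 * Bs" using mult_right_mono[OF C1 nn(1)] mult_right_mono[OF C1 nn(2)] by auto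
    have "norm (V' 0) * T * 1 \<le> norm (V' 0) * T * path_size T" using T ps by (intro mult_left_mono) auto
    moreover have "C1 * path_size T = 2 * path_size T + growth_const T * path_size T + norm (V' 0) * T * path_size T + L * (growth_const T * path_size T)"
      by (simp add: C1_def algebra_simps)
    ultimately show "growth_const T * path_size T + path_size T + norm (V' 0) * T + L * (growth_const T * path_size T) \<le> C1 * path_size T"
      using ps by linarith
  qed
  also have "\<dots> = C1 * (Ss + (path_size T + Bs))" by (simp add: algebra_simps)
  finally have def_le: "(\<Sum>k<n. defect k) \<le> C1 * (Ss + (path_size T + Bs))" .
  have "total_error n \<le> exp (c * h * real n) * (c * h * (\<Sum>k<n. defect k))"
  proof (rule discrete_gronwall[where N=N])
    show "total_error 0 = 0" using p_eq[of 0] q_eq[of 0] by (simp add: B0 P0 Q0 driving_lag_sum_def)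
    show "0 \<le> c * h" using c h(1) by simp
    show "0 \<le> defect k" for k using cell0[of k] by (intro add_nonneg_nonneg) auto
    show "total_error (Suc m) \<le> (1 + c * h) * total_error m + c * h * defect m" for m
      unfolding c_def by (rule error_step)
  qed (rule n)
  also have "\<dots> \<le> exp (c * T) * (c * h * (C1 * (Ss + (path_size T + Bs))))"
  proof (rule mult_mono)
    have "real n * h \<le> T" using n h(1) by (simp add: hN[symmetric])
    then have "c * (real n * h) \<le> c * T" using c by (rule mult_left_mono)
    then show "exp (c * h * real n) \<le> exp (c * T)" by (simp add: mult_ac)
    show "c * h * (\<Sum>k<n. defect k) \<le> c * h * (C1 * (Ss + (path_size T + Bs)))"
      using c h(1) by (intro mult_left_mono def_le) auto
    have "0 \<le> (\<Sum>k<n. defect k)" using cell0 by (intro sum_nonneg add_nonneg_nonneg) auto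
    then show "0 \<le> c * h * (\<Sum>k<n. defect k)" using c h(1) by simp
  qed simp
  finally have te: "total_error n \<le> exp (c * T) * c * C1 * (h * Ss + h * (path_size T + Bs))"
    by (simp add: algebra_simps)
  define K where "K = exp (c * T) * c * C1"
  have K: "0 \<le> K" using c C1 by (simp add: K_def)
  have eqn: "norm (eq n) \<le> norm (eq n + lag_sum h n) + norm (lag_sum h n)"
    using norm_triangle_ineq4[of "eq n + lag_sum h n" "lag_sum h n"] by simp
  have "norm (ep n) + norm (eq n) \<le> norm (lag_sum h n) + K * (h * Ss + h * (path_size T + Bs))"
    using te eqn by (simp add: K_def)
  also have "\<dots> \<le> (1 + K) * norm (lag_sum h n) + (1 + K) * (h * Ss + h * (path_size T + Bs))"
    using K h(1) nn ps by (intro add_mono) (auto simp: distrib_right)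
  also have "\<dots> = (1 + K) * (norm (lag_sum h n) + h * Ss + h * (path_size T + Bs))" by (simp add: algebra_simps)
  also have "1 + K = error_const T" by (simp add: K_def scheme_error_const_def c_def C1_def)
  also have "h * Ss = (\<Sum>k<N. h * norm (lag_sum h k))" by (simp add: Ss_def sum_distrib_left)
  finally show ?thesis by (simp only: Bs_def)
qed

end

section \<open>Moment inequalities for sums and path integrals\<close>

lemma (in prob_space) borel_measurable_path_integral:
  fixes X :: "real \<Rightarrow> 'a \<Rightarrow> 'b::euclidean_space"
  assumes X: "\<And>t. 0 \<le> t \<Longrightarrow> X t \<in> borel_measurable M"
    and cont: "\<And>\<omega>. \<omega> \<in> space M \<Longrightarrow> continuous_on {0..} (\<lambda>t. X t \<omega>)" and ab: "0 \<le> a" "a \<le> b"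
  shows "(\<lambda>\<omega>. integral {a..b} (\<lambda>s. X s \<omega>)) \<in> borel_measurable M"
proof (rule borel_measurable_LIMSEQ_metric)
  fix m :: nat
  show "(\<lambda>\<omega>. \<Sum>i<Suc m. ((b - a) / real (Suc m)) *\<^sub>R X (a + real i * ((b - a) / real (Suc m))) \<omega>) \<in> borel_measurable M"
    using ab by (intro borel_measurable_sum borel_measurable_scaleR borel_measurable_const X) auto
next
  fix \<omega> assume "\<omega> \<in> space M"
  then have "continuous_on {a..b} (\<lambda>t. X t \<omega>)"
    using ab by (intro continuous_on_subset[OF cont]) auto
  then show "(\<lambda>m. \<Sum>i<Suc m. ((b - a) / real (Suc m)) *\<^sub>R X (a + real i * ((b - a) / real (Suc m))) \<omega>)
    \<longlonglongrightarrow> integral {a..b} (\<lambda>s. X s \<omega>)"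
    by (rule riemann_sum_tendsto[OF _ ab(2)])
qed

lemma nn_integral_power_add_le:
  fixes X Y :: "'a \<Rightarrow> real"
  assumes [measurable]: "X \<in> borel_measurable M" "Y \<in> borel_measurable M"
    and nn: "\<And>\<omega>. 0 \<le> X \<omega>" "\<And>\<omega>. 0 \<le> Y \<omega>"
    and X: "(\<integral>\<^sup>+\<omega>. ennreal (X \<omega> ^ r) \<partial>M) \<le> ennreal a" and Y: "(\<integral>\<^sup>+\<omega>. ennreal (Y \<omega> ^ r) \<partial>M) \<le> ennreal b"
    and ab: "0 \<le> a" "0 \<le> b"
  shows "(\<integral>\<^sup>+\<omega>. ennreal ((X \<omega> + Y \<omega>) ^ r) \<partial>M) \<le> ennreal (2 ^ r * (a + b))"
proof -
  have "(\<integral>\<^sup>+\<omega>. ennreal ((X \<omega> + Y \<omega>) ^ r) \<partial>M) \<le> (\<integral>\<^sup>+\<omega>. ennreal (2 ^ r) * (ennreal (X \<omega> ^ r) + ennreal (Y \<omega> ^ r)) \<partial>M)"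
  proof (intro nn_integral_mono)
    fix \<omega>
    have "ennreal ((X \<omega> + Y \<omega>) ^ r) \<le> ennreal (2 ^ r * (X \<omega> ^ r + Y \<omega> ^ r))"
      by (intro ennreal_leI power_add_le nn)
    also have "\<dots> = ennreal (2 ^ r) * (ennreal (X \<omega> ^ r) + ennreal (Y \<omega> ^ r))"
      using nn by (simp add: ennreal_mult ennreal_plus[symmetric] del: ennreal_plus)
    finally show "ennreal ((X \<omega> + Y \<omega>) ^ r) \<le> ennreal (2 ^ r) * (ennreal (X \<omega> ^ r) + ennreal (Y \<omega> ^ r))" .
  qed
  also have "\<dots> = ennreal (2 ^ r) * ((\<integral>\<^sup>+\<omega>. ennreal (X \<omega> ^ r) \<partial>M) + (\<integral>\<^sup>+\<omega>. ennreal (Y \<omega> ^ r) \<partial>M))"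
    by (simp add: nn_integral_cmult nn_integral_add)
  also have "\<dots> \<le> ennreal (2 ^ r) * (ennreal a + ennreal b)"
    by (intro mult_left_mono add_mono X Y) simp
  also have "\<dots> = ennreal (2 ^ r * (a + b))" using ab by (simp add: ennreal_mult ennreal_plus[symmetric] del: ennreal_plus)
  finally show ?thesis .
qed

lemma nn_integral_power_mult:
  fixes X :: "'a \<Rightarrow> real"
  assumes [measurable]: "X \<in> borel_measurable M" and nn: "\<And>\<omega>. 0 \<le> X \<omega>" and c: "0 \<le> c" and a: "0 \<le> a"
    and X: "(\<integral>\<^sup>+\<omega>. ennreal (X \<omega> ^ r) \<partial>M) \<le> ennreal a"
  shows "(\<integral>\<^sup>+\<omega>. ennreal ((c * X \<omega>) ^ r) \<partial>M) \<le> ennreal (c ^ r * a)"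
proof -
  have "(\<integral>\<^sup>+\<omega>. ennreal ((c * X \<omega>) ^ r) \<partial>M) = ennreal (c ^ r) * (\<integral>\<^sup>+\<omega>. ennreal (X \<omega> ^ r) \<partial>M)"
    using c nn by (simp add: power_mult_distrib ennreal_mult nn_integral_cmult)
  also have "\<dots> \<le> ennreal (c ^ r) * ennreal a" by (intro mult_left_mono X) simp
  also have "\<dots> = ennreal (c ^ r * a)" using c a by (simp add: ennreal_mult)
  finally show ?thesis .
qed

text \<open>Jensen's inequality yields \<open>c ^ (r - 1)\<close> and the total weight
  \<open>n * w\<close> the remaining factor \<open>c\<close>; the number of summands enters in no
  other way.\<close>

lemma nn_integral_power_weighted_sum_le:
  fixes X :: "nat \<Rightarrow> 'a \<Rightarrow> real"
  assumes X: "\<And>k. k < n \<Longrightarrow> X k \<in> borel_measurable M" and nn: "\<And>k \<omega>. 0 \<le> X k \<omega>" and w: "0 \<le> w" "real n * w \<le> c"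
    and C: "0 \<le> C" "\<And>k. k < n \<Longrightarrow> (\<integral>\<^sup>+\<omega>. ennreal (X k \<omega> ^ r) \<partial>M) \<le> ennreal C" and r: "r > 0"
  shows "(\<integral>\<^sup>+\<omega>. ennreal ((\<Sum>k<n. w * X k \<omega>) ^ r) \<partial>M) \<le> ennreal (c ^ r * C)"
proof -
  have c: "0 \<le> c" using w by (meson mult_nonneg_nonneg of_nat_0_le_iff order_trans)
  have "(\<integral>\<^sup>+\<omega>. ennreal ((\<Sum>k<n. w * X k \<omega>) ^ r) \<partial>M) \<le> (\<integral>\<^sup>+\<omega>. (\<Sum>k<n. ennreal (c ^ (r - 1) * w) * ennreal (X k \<omega> ^ r)) \<partial>M)"
  proof (intro nn_integral_mono)
    fix \<omega>
    have "(\<Sum>k<n. w * X k \<omega>) ^ r \<le> c ^ (r - 1) * (\<Sum>k<n. w * X k \<omega> ^ r)"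
      using w nn r by (intro power_sum_le_sum_power) auto
    then have "ennreal ((\<Sum>k<n. w * X k \<omega>) ^ r) \<le> ennreal (\<Sum>k<n. c ^ (r - 1) * w * X k \<omega> ^ r)"
      by (intro ennreal_leI) (simp add: sum_distrib_left mult.assoc)
    also have "\<dots> = (\<Sum>k<n. ennreal (c ^ (r - 1) * w) * ennreal (X k \<omega> ^ r))"
      using c w nn by (subst sum_ennreal[symmetric]) (auto simp: ennreal_mult[symmetric])
    finally show "ennreal ((\<Sum>k<n. w * X k \<omega>) ^ r) \<le> (\<Sum>k<n. ennreal (c ^ (r - 1) * w) * ennreal (X k \<omega> ^ r))" .
  qed
  also have "\<dots> = (\<Sum>k<n. \<integral>\<^sup>+\<omega>. ennreal (c ^ (r - 1) * w) * ennreal (X k \<omega> ^ r) \<partial>M)"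
    using X by (intro nn_integral_sum) simp
  also have "\<dots> = (\<Sum>k<n. ennreal (c ^ (r - 1) * w) * (\<integral>\<^sup>+\<omega>. ennreal (X k \<omega> ^ r) \<partial>M))"
    using X by (intro sum.cong refl nn_integral_cmult) simp
  also have "\<dots> \<le> (\<Sum>k<n. ennreal (c ^ (r - 1) * w) * ennreal C)"
    using C by (intro sum_mono mult_left_mono) auto
  also have "\<dots> = ennreal (c ^ (r - 1) * (real n * w) * C)"
    using c w C by (simp add: ennreal_mult[symmetric] ennreal_of_nat_eq_real_of_nat mult_ac)
  also have "\<dots> \<le> ennreal (c ^ (r - 1) * c * C)"
    using c w C by (intro ennreal_leI mult_right_mono mult_left_mono) auto
  also have "c ^ (r - 1) * c = c ^ r" using r by (cases r) auto
  finally show ?thesis .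
qed

text \<open>Summation by parts: the increment from \<open>l\<close> to \<open>Suc l\<close> is
  contained in \<open>g m - g i\<close> for each \<open>i \<le> l\<close>, that is
  \<open>Suc l\<close> times.\<close>

lemma sum_lag_telescope:
  fixes g :: "nat \<Rightarrow> 'b::real_vector"
  shows "(\<Sum>i<m. g m - g i) = (\<Sum>l<m. real (Suc l) *\<^sub>R (g (Suc l) - g l))"
proof (induction m)
  case (Suc m)
  have "(\<Sum>i<Suc m. g (Suc m) - g i) = (\<Sum>i<m. (g m - g i) + (g (Suc m) - g m)) + (g (Suc m) - g m)" by simp
  also have "\<dots> = (\<Sum>i<m. g m - g i) + real m *\<^sub>R (g (Suc m) - g m) + (g (Suc m) - g m)"
    by (simp only: sum.distrib sum_constant_scaleR card_lessThan)
  also have "\<dots> = (\<Sum>i<m. g m - g i) + real (Suc m) *\<^sub>R (g (Suc m) - g m)"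
    by (simp add: scaleR_left_distrib)
  finally show ?case using Suc.IH by simp
qed simp

text \<open>When cells and subcells are flattened into one index \<open>k\<close>, the position
  inside the cell is \<open>k mod m\<close>. The weight never exceeds \<open>\<delta> * m\<close>,
  the length of a cell, whatever the number \<open>n\<close> of cells.\<close>

lemma double_sum_lag_telescope:
  fixes g :: "nat \<Rightarrow> 'b::real_vector"
  assumes m: "m > 0"
  shows "(\<Sum>j<n. \<Sum>i<m. \<delta> *\<^sub>R (g (j * m + m) - g (j * m + i)))
    = (\<Sum>k<n * m. (\<delta> * real (Suc (k mod m))) *\<^sub>R (g (Suc k) - g k))"
proof -
  have "(\<Sum>i<m. \<delta> *\<^sub>R (g (j * m + m) - g (j * m + i)))
      = (\<Sum>k\<in>{j * m..<j * m + m}. (\<delta> * real (Suc (k mod m))) *\<^sub>R (g (Suc k) - g k))" for j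
  proof -
    have "(\<Sum>i<m. \<delta> *\<^sub>R (g (j * m + m) - g (j * m + i))) = \<delta> *\<^sub>R (\<Sum>l<m. real (Suc l) *\<^sub>R (g (j * m + Suc l) - g (j * m + l)))"
      using sum_lag_telescope[of "\<lambda>i. g (j * m + i)" m] by (simp only: scaleR_sum_right[symmetric])
    also have "\<dots> = (\<Sum>l<m. (\<delta> * real (Suc ((j * m + l) mod m))) *\<^sub>R (g (Suc (j * m + l)) - g (j * m + l)))"
      by (simp add: scaleR_sum_right)
    also have "\<dots> = (\<Sum>k\<in>{j * m..<j * m + m}. (\<delta> * real (Suc (k mod m))) *\<^sub>R (g (Suc k) - g k))"
      using sum.atLeastLessThan_shift_0[of "\<lambda>k. (\<delta> * real (Suc (k mod m))) *\<^sub>R (g (Suc k) - g k)" "j * m" "j * m + m"]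
      by (simp add: atLeast0LessThan add.commute)
    finally show ?thesis .
  qed
  then show ?thesis by (simp add: sum.nat_group)
qed

section \<open>Gaussian moments of the driving path\<close>

locale lipschitz_sde = hamiltonian_sde M F W V V' S p0 q0 p q
  for M :: "'a measure" and F and W :: "real \<Rightarrow> 'a \<Rightarrow> real^'d"
    and V :: "real^'m \<Rightarrow> real" and V' :: "real^'m \<Rightarrow> real^'m" and S :: "real^'d^'m"
    and p0 q0 :: "'a \<Rightarrow> real^'m" and p q :: "real \<Rightarrow> 'a \<Rightarrow> real^'m" +
  fixes L :: real
  assumes lip: "L-lipschitz_on UNIV V'"
begin

lemma L0: "0 \<le> L" using lip by (simp add: lipschitz_on_def)

lemma continuous_on_B: "\<omega> \<in> space M \<Longrightarrow> continuous_on {0..} (B \<omega>)"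
  by (intro bounded_linear.continuous_on[OF matrix_vector_mul_bounded_linear] continuous_on_W)

lemma B_measurable: "0 \<le> t \<Longrightarrow> (\<lambda>\<omega>. B \<omega> t) \<in> borel_measurable M"
  by (intro measurable_compose[OF W_measurable]
      borel_measurable_continuous_onI linear_continuous_on matrix_vector_mul_bounded_linear)

lemma norm_B_measurable: "0 \<le> t \<Longrightarrow> (\<lambda>\<omega>. norm (B \<omega> t)) \<in> borel_measurable M"
  by (rule measurable_compose[OF B_measurable borel_measurable_norm])

definition gauss_const :: "nat \<Rightarrow> real \<Rightarrow> real" where
  "gauss_const r T = onorm (\<lambda>v. S *v v) ^ r * (real CARD('d) ^ r * (2 * fact r * exp (T / 2)))"

lemma onorm_S_nonneg: "0 \<le> onorm (\<lambda>v. S *v v)"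
  by (intro onorm_pos_le matrix_vector_mul_bounded_linear)

lemma gauss_const_nonneg: "0 \<le> gauss_const r T"
  unfolding gauss_const_def using onorm_S_nonneg by simp

lemma transformed_gaussian_sum_moment:
  assumes \<delta>: "\<delta> > 0" and a: "\<And>k. \<bar>a k\<bar> \<le> A" and A: "A > 0" and T: "real n * \<delta> \<le> T" and r: "r > 0"
  shows "(\<integral>\<^sup>+\<omega>. ennreal (norm (\<Sum>k<n. a k *\<^sub>R (B \<omega> (real (Suc k) * \<delta>) - B \<omega> (real k * \<delta>))) ^ r) \<partial>M)
    \<le> ennreal (gauss_const r T * A ^ r)"
proof -
  let ?o = "onorm (\<lambda>v. S *v v)"
  let ?X = "\<lambda>\<omega>. \<Sum>k<n. a k *\<^sub>R (W (0 + real (Suc k) * \<delta>) \<omega> - W (0 + real k * \<delta>) \<omega>)"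
  have [measurable]: "?X \<in> borel_measurable M"
    using \<delta> by (intro borel_measurable_sum borel_measurable_scaleR borel_measurable_const borel_measurable_diff W_measurable) auto
  have nX: "(\<lambda>\<omega>. norm (?X \<omega>)) \<in> borel_measurable M" by measurable
  have pt: "norm (\<Sum>k<n. a k *\<^sub>R (B \<omega> (real (Suc k) * \<delta>) - B \<omega> (real k * \<delta>))) \<le> ?o * norm (?X \<omega>)" for \<omega>
  proof -
    have "(\<Sum>k<n. a k *\<^sub>R (B \<omega> (real (Suc k) * \<delta>) - B \<omega> (real k * \<delta>))) = S *v ?X \<omega>"
      by (simp add: linear_sum[OF matrix_vector_mul_linear] matrix_vector_mult_scaleR matrix_vector_mult_diff_distrib)
    then show ?thesis by (simp only: onorm[OF matrix_vector_mul_bounded_linear])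
  qed
  have "(\<integral>\<^sup>+\<omega>. ennreal (norm (\<Sum>k<n. a k *\<^sub>R (B \<omega> (real (Suc k) * \<delta>) - B \<omega> (real k * \<delta>))) ^ r) \<partial>M)
     \<le> (\<integral>\<^sup>+\<omega>. ennreal ((?o * norm (?X \<omega>)) ^ r) \<partial>M)"
    by (intro nn_integral_mono ennreal_leI power_mono pt) simp
  also have "\<dots> \<le> ennreal (?o ^ r * (real CARD('d) ^ r * (2 * fact r * exp (T / 2)) * A ^ r))"
    using A by (intro nn_integral_power_mult[OF nX] onorm_S_nonneg gaussian_sum_moment[OF order_refl \<delta> a A T r]) auto
  finally show ?thesis by (simp only: gauss_const_def mult.assoc)
qed

lemma B_moment:
  assumes t: "0 \<le> t" "t \<le> T" and r: "r > 0"
  shows "(\<integral>\<^sup>+\<omega>. ennreal (norm (B \<omega> t) ^ r) \<partial>M) \<le> ennreal (gauss_const r T)"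
proof (cases "t = 0")
  \<comment> \<open>Time 0 is treated apart: the other case uses a grid of mesh \<open>t\<close>,
    which has to be positive.\<close>
  case True
  have "(\<integral>\<^sup>+\<omega>. ennreal (norm (B \<omega> t) ^ r) \<partial>M) = (\<integral>\<^sup>+\<omega>. 0 \<partial>M)"
    by (rule nn_integral_cong_AE, use AE_W_0 in eventually_elim) (use r True in \<open>simp add: zero_power\<close>)
  then show ?thesis by simp
next
  case False
  have "(\<integral>\<^sup>+\<omega>. ennreal (norm (B \<omega> t) ^ r) \<partial>M)
    = (\<integral>\<^sup>+\<omega>. ennreal (norm (\<Sum>k<1. 1 *\<^sub>R (B \<omega> (real (Suc k) * t) - B \<omega> (real k * t))) ^ r) \<partial>M)"
    by (rule nn_integral_cong_AE, use AE_W_0 in eventually_elim) simp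
  also have "\<dots> \<le> ennreal (gauss_const r T * 1 ^ r)"
    using False t r by (intro transformed_gaussian_sum_moment) auto
  finally show ?thesis by simp
qed

lemma path_integral_B_measurable:
  "0 \<le> T \<Longrightarrow> (\<lambda>\<omega>. integral {0..T} (\<lambda>s. norm (B \<omega> s))) \<in> borel_measurable M"
  by (rule borel_measurable_path_integral)
    (auto intro!: continuous_on_norm continuous_on_B norm_B_measurable)

text \<open>For each Riemann sum Jensen's inequality reduces the claim to moments at fixed times;
  Fatou's lemma passes to the integral.\<close>

lemma path_integral_B_moment:
  assumes T: "0 \<le> T" and r: "r > 0"
  shows "(\<integral>\<^sup>+\<omega>. ennreal ((integral {0..T} (\<lambda>s. norm (B \<omega> s))) ^ r) \<partial>M) \<le> ennreal (T ^ r * gauss_const r T)"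
proof (rule nn_integral_le_of_LIMSEQ)
  fix m :: nat
  let ?w = "T / real (Suc m)"
  let ?X = "\<lambda>i \<omega>. norm (B \<omega> (real i * ?w))"
  have Xm: "?X i \<in> borel_measurable M" for i using T by (intro norm_B_measurable) auto
  then show "(\<lambda>\<omega>. ennreal ((\<Sum>i<Suc m. ?w * ?X i \<omega>) ^ r)) \<in> borel_measurable M" by measurable
  have "real i * ?w \<le> T" if "i < Suc m" for i
  proof -
    have "real i * ?w \<le> real (Suc m) * ?w" using that T by (intro mult_right_mono) auto
    then show ?thesis by simp
  qed
  then show "(\<integral>\<^sup>+\<omega>. ennreal ((\<Sum>i<Suc m. ?w * ?X i \<omega>) ^ r) \<partial>M) \<le> ennreal (T ^ r * gauss_const r T)"
    using T r Xm by (intro nn_integral_power_weighted_sum_le gauss_const_nonneg B_moment) auto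
next
  show "AE \<omega> in M. (\<lambda>m. ennreal ((\<Sum>i<Suc m. T / real (Suc m) * norm (B \<omega> (real i * (T / real (Suc m))))) ^ r))
    \<longlonglongrightarrow> ennreal ((integral {0..T} (\<lambda>s. norm (B \<omega> s))) ^ r)"
  proof (rule AE_I2)
    fix \<omega> assume \<omega>: "\<omega> \<in> space M"
    have "continuous_on {0..T} (\<lambda>s. norm (B \<omega> s))"
      by (intro continuous_on_norm continuous_on_subset[OF continuous_on_B[OF \<omega>]]) auto
    from riemann_sum_tendsto[OF this T]
    have "(\<lambda>m. \<Sum>i<Suc m. T / real (Suc m) * norm (B \<omega> (real i * (T / real (Suc m))))) \<longlonglongrightarrow> integral {0..T} (\<lambda>s. norm (B \<omega> s))"
      by (simp only: diff_zero add_0 real_scaleR_def)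
    then show "(\<lambda>m. ennreal ((\<Sum>i<Suc m. T / real (Suc m) * norm (B \<omega> (real i * (T / real (Suc m))))) ^ r))
      \<longlonglongrightarrow> ennreal ((integral {0..T} (\<lambda>s. norm (B \<omega> s))) ^ r)"
      by (intro tendsto_ennrealI tendsto_power)
  qed
qed

end

subsection \<open>Moments of the strong error\<close>

context lipschitz_sde
begin

lemma driving_lag_sum_measurable:
  assumes h: "0 \<le> h"
  shows "(\<lambda>\<omega>. driving_lag_sum (B \<omega>) h n) \<in> borel_measurable M"
  unfolding driving_lag_sum_def driving_lag_def
proof (intro borel_measurable_sum)
  fix j
  show "(\<lambda>\<omega>. integral {real j * h..real (Suc j) * h} (\<lambda>s. B \<omega> (real (Suc j) * h) - B \<omega> s)) \<in> borel_measurable M"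
  proof (rule borel_measurable_path_integral)
    show "(\<lambda>\<omega>. B \<omega> (real (Suc j) * h) - B \<omega> t) \<in> borel_measurable M" if "0 \<le> t" for t
      using h that by (intro borel_measurable_diff B_measurable) auto
    show "continuous_on {0..} (\<lambda>t. B \<omega> (real (Suc j) * h) - B \<omega> t)" if "\<omega> \<in> space M" for \<omega>
      by (intro continuous_on_diff continuous_on_const continuous_on_B[OF that])
  qed (use h in \<open>auto intro: mult_right_mono\<close>)
qed

lemma norm_driving_lag_sum_measurable:
  "0 \<le> h \<Longrightarrow> (\<lambda>\<omega>. norm (driving_lag_sum (B \<omega>) h n)) \<in> borel_measurable M"
  by (rule measurable_compose[OF driving_lag_sum_measurable borel_measurable_norm])

text \<open>A single lag has size \<open>h powr (3/2)\<close>, and adding norms over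
  \<open>T / h\<close> cells would give only the square root of \<open>h\<close>. Treating the whole
  double Riemann sum as one sum of independent increments, with weights at most \<open>h\<close>
  over a total time at most \<open>T\<close>, gives \<open>h\<close>.\<close>

lemma driving_lag_sum_moment:
  assumes h: "h > 0" and T: "real n * h \<le> T" and r: "r > 0"
  shows "(\<integral>\<^sup>+\<omega>. ennreal (norm (driving_lag_sum (B \<omega>) h n) ^ r) \<partial>M) \<le> ennreal (gauss_const r T * h ^ r)"
proof -
  define \<delta> where "\<delta> m = h / real (Suc m)" for m
  have \<delta>: "\<delta> m > 0" "real (Suc m) * \<delta> m = h" for m using h by (auto simp: \<delta>_def)
  define f where "f m \<omega> = (\<Sum>k<n * Suc m. (\<delta> m * real (Suc (k mod Suc m))) *\<^sub>R (B \<omega> (real (Suc k) * \<delta> m) - B \<omega> (real k * \<delta> m)))" for m \<omega>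
  have fm: "f m \<in> borel_measurable M" for m
    unfolding f_def[abs_def] using \<delta>(1)[of m]
    by (intro borel_measurable_sum borel_measurable_scaleR borel_measurable_const borel_measurable_diff B_measurable) auto
  show ?thesis
  proof (rule nn_integral_le_of_LIMSEQ)
    fix m
    have "(\<lambda>\<omega>. norm (f m \<omega>)) \<in> borel_measurable M" by (rule measurable_compose[OF fm borel_measurable_norm])
    then show "(\<lambda>\<omega>. ennreal (norm (f m \<omega>) ^ r)) \<in> borel_measurable M" by measurable
    show "(\<integral>\<^sup>+\<omega>. ennreal (norm (f m \<omega>) ^ r) \<partial>M) \<le> ennreal (gauss_const r T * h ^ r)"
      unfolding f_def
    proof (rule transformed_gaussian_sum_moment[OF \<delta>(1) _ h _ r])
      fix k
      have "real (Suc (k mod Suc m)) \<le> real (Suc m)" using mod_less_divisor[of "Suc m" k] by linarith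
      then have "\<delta> m * real (Suc (k mod Suc m)) \<le> \<delta> m * real (Suc m)"
        using \<delta>(1)[of m] by (intro mult_left_mono) auto
      then have "\<delta> m * real (Suc (k mod Suc m)) \<le> h" using \<delta>(2)[of m] by (simp only: mult.commute)
      moreover have "0 \<le> \<delta> m * real (Suc (k mod Suc m))" using \<delta>(1)[of m] by simp
      ultimately show "\<bar>\<delta> m * real (Suc (k mod Suc m))\<bar> \<le> h" by (simp only: abs_of_nonneg)
      show "real (n * Suc m) * \<delta> m \<le> T" using T \<delta>(2)[of m] by (simp only: of_nat_mult mult.assoc)
    qed
  next
    show "AE \<omega> in M. (\<lambda>m. ennreal (norm (f m \<omega>) ^ r)) \<longlonglongrightarrow> ennreal (norm (driving_lag_sum (B \<omega>) h n) ^ r)"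
    proof (rule AE_I2)
      fix \<omega> assume \<omega>: "\<omega> \<in> space M"
      have "f m \<omega> = (\<Sum>j<n. \<Sum>i<Suc m. ((real (Suc j) * h - real j * h) / real (Suc m)) *\<^sub>R
          (B \<omega> (real (Suc j) * h) - B \<omega> (real j * h + real i * ((real (Suc j) * h - real j * h) / real (Suc m)))))" for m
      proof -
        have e0: "(real (Suc j) * h - real j * h) / real (Suc m) = \<delta> m" for j
          by (simp add: \<delta>_def algebra_simps)
        have e1: "real j * h + real (Suc m) * \<delta> m = real (Suc j) * h" for j
          unfolding \<delta>(2) by (simp add: algebra_simps)
        have e2: "real (j * Suc m + i) * \<delta> m = real j * h + real i * \<delta> m" for i j
        proof -
          have "real (j * Suc m + i) * \<delta> m = real j * (real (Suc m) * \<delta> m) + real i * \<delta> m" by (simp add: algebra_simps)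
          then show ?thesis by (simp only: \<delta>(2))
        qed
        show ?thesis
          unfolding f_def e0
          using double_sum_lag_telescope[OF zero_less_Suc[of m], where n=n and \<delta>="\<delta> m" and g="\<lambda>k. B \<omega> (real k * \<delta> m)", symmetric]
          by (simp only: e1 e2)
      qed
      moreover have "(\<lambda>m. \<Sum>j<n. \<Sum>i<Suc m. ((real (Suc j) * h - real j * h) / real (Suc m)) *\<^sub>R
          (B \<omega> (real (Suc j) * h) - B \<omega> (real j * h + real i * ((real (Suc j) * h - real j * h) / real (Suc m)))))
        \<longlonglongrightarrow> driving_lag_sum (B \<omega>) h n"
        unfolding driving_lag_sum_def driving_lag_def
      proof (intro tendsto_sum riemann_sum_tendsto)
        fix j
        have "0 \<le> real j * h" using h by simp
        then show "continuous_on {real j * h..real (Suc j) * h} (\<lambda>s. B \<omega> (real (Suc j) * h) - B \<omega> s)"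
          by (intro continuous_on_diff continuous_on_const continuous_on_subset[OF continuous_on_B[OF \<omega>]]) auto
        show "real j * h \<le> real (Suc j) * h" using h by (intro mult_right_mono) auto
      qed
      ultimately have "(\<lambda>m. f m \<omega>) \<longlonglongrightarrow> driving_lag_sum (B \<omega>) h n" by simp
      then show "(\<lambda>m. ennreal (norm (f m \<omega>) ^ r)) \<longlonglongrightarrow> ennreal (norm (driving_lag_sum (B \<omega>) h n) ^ r)"
        by (intro tendsto_ennrealI tendsto_power tendsto_norm)
    qed
  qed
qed

lemma AE_lipschitz_path:
  "AE \<omega> in M. lipschitz_path V V' (B \<omega>) (\<lambda>t. p t \<omega>) (\<lambda>t. q t \<omega>) (p0 \<omega>) (q0 \<omega>) L"
  using AE_path AE_space
  by eventually_elim (auto simp: lipschitz_path_def lipschitz_path_axioms_def lip intro: continuous_on_B)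

lemma AE_scheme_path:
  assumes sch: "drift_preserving_scheme M F W V' S p0 q0 h P Q" and h: "0 < h" "h \<le> 1" "h * L \<le> 1"
  shows "AE \<omega> in M. \<exists>\<Psi> G. scheme_path V V' (B \<omega>) (\<lambda>t. p t \<omega>) (\<lambda>t. q t \<omega>) (p0 \<omega>) (q0 \<omega>) L h (\<lambda>n. P n \<omega>) (\<lambda>n. Q n \<omega>) \<Psi> G"
  using AE_lipschitz_path AE_W_0 AE_scheme_steps[OF sch]
proof eventually_elim
  case (elim \<omega>)
  then obtain \<Psi> G where R: "\<forall>n. G n = integral {0..1} (\<lambda>s. V' (Q n \<omega> + (s * h) *\<^sub>R \<Psi> n)) \<and>
    \<Psi> n = P n \<omega> + noise S (real n * h) (real (Suc n) * h) \<omega> - (h / 2) *\<^sub>R G n \<and>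
    Q (Suc n) \<omega> = Q n \<omega> + h *\<^sub>R \<Psi> n \<and>
    P (Suc n) \<omega> = P n \<omega> + noise S (real n * h) (real (Suc n) * h) \<omega> - h *\<^sub>R G n" by blast
  have "B \<omega> 0 = 0" using elim(2) by simp
  then have "scheme_path_axioms V' (B \<omega>) (p0 \<omega>) (q0 \<omega>) L h (\<lambda>n. P n \<omega>) (\<lambda>n. Q n \<omega>) \<Psi> G"
    using elim(3) h R unfolding matrix_vector_mult_diff_distrib by (intro scheme_path_axioms.intro) blast+
  with elim(1) show ?case by (blast intro: scheme_path.intro)
qed

abbreviation scale :: "real \<Rightarrow> 'a \<Rightarrow> real" where
  "scale T \<omega> \<equiv> path_scale (B \<omega>) (p0 \<omega>) (q0 \<omega>) T"

lemma scale_measurable: "0 \<le> T \<Longrightarrow> scale T \<in> borel_measurable M"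
  unfolding path_scale_def
  using measurable_F_imp[OF order_refl p0] measurable_F_imp[OF order_refl q0] path_integral_B_measurable by measurable

lemma path_integral_B_nonneg: "0 \<le> integral {0..T} (\<lambda>s. norm (B \<omega> s))"
  by (cases "(\<lambda>s. norm (B \<omega> s)) integrable_on {0..T}") (auto intro: integral_nonneg simp: not_integrable_integral)

lemma scale_nonneg: "0 \<le> scale T \<omega>"
  unfolding path_scale_def using path_integral_B_nonneg[of T \<omega>] by simp

lemma scale_moment:
  assumes T: "0 \<le> T" and r: "r > 0" and m0: "0 \<le> m0" "(\<integral>\<^sup>+\<omega>. ennreal ((norm (p0 \<omega>) + norm (q0 \<omega>)) ^ r) \<partial>M) \<le> ennreal m0"
  shows "(\<integral>\<^sup>+\<omega>. ennreal (scale T \<omega> ^ r) \<partial>M) \<le> ennreal (2 ^ r * (2 ^ r * (1 + m0) + T ^ r * gauss_const r T))"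
proof -
  have [measurable]: "p0 \<in> borel_measurable M" "q0 \<in> borel_measurable M"
    using measurable_F_imp[OF order_refl p0] measurable_F_imp[OF order_refl q0] by auto
  have 1: "(\<integral>\<^sup>+\<omega>. ennreal ((1 + (norm (p0 \<omega>) + norm (q0 \<omega>))) ^ r) \<partial>M) \<le> ennreal (2 ^ r * (1 + m0))"
    by (rule nn_integral_power_add_le) (use m0 in \<open>auto simp: emeasure_space_1\<close>)
  have "(\<integral>\<^sup>+\<omega>. ennreal (((1 + (norm (p0 \<omega>) + norm (q0 \<omega>))) + integral {0..T} (\<lambda>s. norm (B \<omega> s))) ^ r) \<partial>M)
    \<le> ennreal (2 ^ r * (2 ^ r * (1 + m0) + T ^ r * gauss_const r T))"
  proof (rule nn_integral_power_add_le[OF _ path_integral_B_measurable[OF T] _ path_integral_B_nonneg 1 path_integral_B_moment[OF T r]])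
    show "0 \<le> 2 ^ r * (1 + m0)" "0 \<le> T ^ r * gauss_const r T" using m0 T gauss_const_nonneg[of r T] by auto
  qed auto
  then show ?thesis by (simp add: path_scale_def add.assoc)
qed

lemma scheme_error_const_nonneg: "0 \<le> T \<Longrightarrow> 0 \<le> scheme_error_const V' L T"
  unfolding scheme_error_const_def using L0 growth_bound_nonneg[OF L0, of T V']
  by (intro add_nonneg_nonneg mult_nonneg_nonneg) auto

lemma solution_moment:
  assumes T: "0 \<le> T" and r: "r > 0" and m: "0 \<le> m" "(\<integral>\<^sup>+\<omega>. ennreal (scale T \<omega> ^ r) \<partial>M) \<le> ennreal m"
    and t: "t \<in> {0..T}"
  shows "(\<integral>\<^sup>+\<omega>. ennreal ((norm (p t \<omega>) + norm (q t \<omega>)) ^ r) \<partial>M) \<le> ennreal (2 ^ r * (growth_bound V' L T ^ r * m + gauss_const r T))"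
proof -
  have "(\<integral>\<^sup>+\<omega>. ennreal ((norm (p t \<omega>) + norm (q t \<omega>)) ^ r) \<partial>M)
    \<le> (\<integral>\<^sup>+\<omega>. ennreal ((growth_bound V' L T * scale T \<omega> + norm (B \<omega> t)) ^ r) \<partial>M)"
  proof (rule nn_integral_mono_AE, use AE_lipschitz_path in eventually_elim)
    fix \<omega> assume "lipschitz_path V V' (B \<omega>) (\<lambda>t. p t \<omega>) (\<lambda>t. q t \<omega>) (p0 \<omega>) (q0 \<omega>) L"
    from lipschitz_path.path_growth(2)[OF this T t]
    show "ennreal ((norm (p t \<omega>) + norm (q t \<omega>)) ^ r) \<le> ennreal ((growth_bound V' L T * scale T \<omega> + norm (B \<omega> t)) ^ r)"
      by (intro ennreal_leI power_mono) auto
  qed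
  also have "\<dots> \<le> ennreal (2 ^ r * (growth_bound V' L T ^ r * m + gauss_const r T))"
    using scale_measurable[OF T] scale_nonneg growth_bound_nonneg[OF L0 T, of V'] m t r gauss_const_nonneg
    by (intro nn_integral_power_add_le nn_integral_power_mult B_moment norm_B_measurable borel_measurable_times borel_measurable_const) auto
  finally show ?thesis .
qed

text \<open>Every term of the pathwise bound scales like \<open>h\<close>: the lags by
  \<open>driving_lag_sum_moment\<close>, uniformly in the step, so that summing them with weights
  \<open>h\<close> costs only \<open>T ^ r\<close>; the rest by its explicit factor. Hence the
  constant in front of \<open>h ^ r\<close> is free of \<open>h\<close>, \<open>N\<close> and the
  scheme.\<close>

lemma scheme_error_moment:
  assumes T: "0 \<le> T" and r: "r > 0" and m: "0 \<le> m" "(\<integral>\<^sup>+\<omega>. ennreal (scale T \<omega> ^ r) \<partial>M) \<le> ennreal m"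
    and sch: "drift_preserving_scheme M F W V' S p0 q0 h P Q" and h: "0 < h" "h \<le> 1" "h * L \<le> 1"
    and hN: "real N * h = T" and n: "n \<le> N"
  shows "(\<integral>\<^sup>+\<omega>. ennreal ((norm (p (real n * h) \<omega> - P n \<omega>) + norm (q (real n * h) \<omega> - Q n \<omega>)) ^ r) \<partial>M)
    \<le> ennreal (scheme_error_const V' L T ^ r * (2 ^ r * (2 ^ r * (gauss_const r T + T ^ r * gauss_const r T)
        + 2 ^ r * (m + T ^ r * gauss_const r T))) * h ^ r)"
proof -
  let ?g = "gauss_const r T"
  let ?S = "\<lambda>k \<omega>. norm (driving_lag_sum (B \<omega>) h k)"
  let ?R = "\<lambda>\<omega>. scale T \<omega> + (\<Sum>k<N. h * norm (B \<omega> (real (Suc k) * h)))"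
  let ?Z = "\<lambda>\<omega>. (?S n \<omega> + (\<Sum>k<N. h * ?S k \<omega>)) + h * ?R \<omega>"
  have g: "0 \<le> ?g" by (rule gauss_const_nonneg)
  have kT: "real k * h \<le> T" if "k \<le> N" for k using that h(1) by (simp add: hN[symmetric])
  have Sm: "?S k \<in> borel_measurable M" for k using h by (intro norm_driving_lag_sum_measurable) auto
  have Bm: "(\<lambda>\<omega>. norm (B \<omega> (real (Suc k) * h))) \<in> borel_measurable M" for k using h by (intro norm_B_measurable) auto
  have S2m: "(\<lambda>\<omega>. \<Sum>k<N. h * ?S k \<omega>) \<in> borel_measurable M" using Sm by measurable
  have B2m: "(\<lambda>\<omega>. \<Sum>k<N. h * norm (B \<omega> (real (Suc k) * h))) \<in> borel_measurable M" using Bm by measurable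
  have Rm: "?R \<in> borel_measurable M" by (intro borel_measurable_add scale_measurable T B2m)
  have S1: "(\<integral>\<^sup>+\<omega>. ennreal (?S k \<omega> ^ r) \<partial>M) \<le> ennreal (?g * h ^ r)" if "k \<le> N" for k
    using that by (intro driving_lag_sum_moment h kT r)
  have S2: "(\<integral>\<^sup>+\<omega>. ennreal ((\<Sum>k<N. h * ?S k \<omega>) ^ r) \<partial>M) \<le> ennreal (T ^ r * (?g * h ^ r))"
    using h hN g r by (intro nn_integral_power_weighted_sum_le Sm S1) auto
  have SS: "(\<integral>\<^sup>+\<omega>. ennreal ((?S n \<omega> + (\<Sum>k<N. h * ?S k \<omega>)) ^ r) \<partial>M) \<le> ennreal (2 ^ r * (?g * h ^ r + T ^ r * (?g * h ^ r)))"
    using h T g by (intro nn_integral_power_add_le Sm S2m S1 S2 n) (auto intro!: sum_nonneg)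
  have B1: "(\<integral>\<^sup>+\<omega>. ennreal (norm (B \<omega> (real (Suc k) * h)) ^ r) \<partial>M) \<le> ennreal ?g" if "k < N" for k
    using that h(1) kT[of "Suc k"] by (intro B_moment r) auto
  have B2: "(\<integral>\<^sup>+\<omega>. ennreal ((\<Sum>k<N. h * norm (B \<omega> (real (Suc k) * h))) ^ r) \<partial>M) \<le> ennreal (T ^ r * ?g)"
    using h hN g r by (intro nn_integral_power_weighted_sum_le Bm B1) auto
  have R1: "(\<integral>\<^sup>+\<omega>. ennreal (?R \<omega> ^ r) \<partial>M) \<le> ennreal (2 ^ r * (m + T ^ r * ?g))"
    using h T g m scale_nonneg by (intro nn_integral_power_add_le scale_measurable B2m B2) (auto intro!: sum_nonneg)
  have R0: "0 \<le> ?R \<omega>" for \<omega> using scale_nonneg[where T=T and \<omega>=\<omega>] h by (auto intro!: add_nonneg_nonneg sum_nonneg)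
  have R2: "(\<integral>\<^sup>+\<omega>. ennreal ((h * ?R \<omega>) ^ r) \<partial>M) \<le> ennreal (h ^ r * (2 ^ r * (m + T ^ r * ?g)))"
    by (rule nn_integral_power_mult[OF Rm R0 _ _ R1]) (use h T g m in auto)
  have Zm: "?Z \<in> borel_measurable M"
    by (intro borel_measurable_add[OF borel_measurable_add[OF Sm S2m] borel_measurable_times[OF borel_measurable_const Rm]])
  have Z0: "0 \<le> ?Z \<omega>" for \<omega> using R0[of \<omega>] h by (auto intro!: add_nonneg_nonneg sum_nonneg mult_nonneg_nonneg)
  have Z1: "(\<integral>\<^sup>+\<omega>. ennreal (?Z \<omega> ^ r) \<partial>M)
    \<le> ennreal (2 ^ r * (2 ^ r * (?g * h ^ r + T ^ r * (?g * h ^ r)) + h ^ r * (2 ^ r * (m + T ^ r * ?g))))"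
  proof (rule nn_integral_power_add_le[OF borel_measurable_add[OF Sm S2m] borel_measurable_times[OF borel_measurable_const Rm] _ _ SS R2])
    show "0 \<le> ?S n \<omega> + (\<Sum>k<N. h * ?S k \<omega>)" for \<omega> using h by (auto intro!: add_nonneg_nonneg sum_nonneg)
    show "0 \<le> h * ?R \<omega>" for \<omega> using R0[of \<omega>] h by (intro mult_nonneg_nonneg) auto
  qed (use h T g m in auto)
  have "(\<integral>\<^sup>+\<omega>. ennreal ((norm (p (real n * h) \<omega> - P n \<omega>) + norm (q (real n * h) \<omega> - Q n \<omega>)) ^ r) \<partial>M)
    \<le> (\<integral>\<^sup>+\<omega>. ennreal ((scheme_error_const V' L T * ?Z \<omega>) ^ r) \<partial>M)"
  proof (rule nn_integral_mono_AE, use AE_scheme_path[OF sch h] in eventually_elim)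
    fix \<omega> assume "\<exists>\<Psi> G. scheme_path V V' (B \<omega>) (\<lambda>t. p t \<omega>) (\<lambda>t. q t \<omega>) (p0 \<omega>) (q0 \<omega>) L h (\<lambda>n. P n \<omega>) (\<lambda>n. Q n \<omega>) \<Psi> G"
    then obtain \<Psi> G where "scheme_path V V' (B \<omega>) (\<lambda>t. p t \<omega>) (\<lambda>t. q t \<omega>) (p0 \<omega>) (q0 \<omega>) L h (\<lambda>n. P n \<omega>) (\<lambda>n. Q n \<omega>) \<Psi> G"
      by blast
    from scheme_path.error_bound[OF this hN n]
    show "ennreal ((norm (p (real n * h) \<omega> - P n \<omega>) + norm (q (real n * h) \<omega> - Q n \<omega>)) ^ r)
      \<le> ennreal ((scheme_error_const V' L T * ?Z \<omega>) ^ r)"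
      by (intro ennreal_leI power_mono) auto
  qed
  also have "\<dots> \<le> ennreal (scheme_error_const V' L T ^ r *
      (2 ^ r * (2 ^ r * (?g * h ^ r + T ^ r * (?g * h ^ r)) + h ^ r * (2 ^ r * (m + T ^ r * ?g)))))"
    by (rule nn_integral_power_mult[OF Zm Z0 scheme_error_const_nonneg[OF T] _ Z1]) (use h T g m in auto)
  also have "2 ^ r * (2 ^ r * (?g * h ^ r + T ^ r * (?g * h ^ r)) + h ^ r * (2 ^ r * (m + T ^ r * ?g)))
    = 2 ^ r * (2 ^ r * (?g + T ^ r * ?g) + 2 ^ r * (m + T ^ r * ?g)) * h ^ r"
    by (simp add: algebra_simps)
  finally show ?thesis by (simp only: mult.assoc)
qed

end

text \<open>The mean value inequality is applied on a ball of radius \<open>R = X + E / h\<close>,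
  which contains both points because \<open>h \<le> 1\<close>. Writing \<open>E = h * A\<close>
  isolates the order \<open>h\<close>. The squared slope, of degree \<open>2 * \<kappa>\<close> in
  \<open>R\<close>, times \<open>A\<close> squared has total degree \<open>2 * \<kappa> + 2\<close>,
  which explains the moment order assumed of the initial values.\<close>

lemma test_function_difference:
  fixes f :: "'b::euclidean_space \<Rightarrow> real"
  assumes der: "\<And>x. GDERIV f x :> f' x" and gr: "\<And>x. norm (f' x) \<le> K * (1 + norm x ^ \<kappa>)"
    and h: "0 < h" "h \<le> 1" and X: "norm x \<le> X" and E: "norm (y - x) \<le> E"
  shows "(f y - f x)\<^sup>2 \<le> h\<^sup>2 * (2 * K\<^sup>2 * (1 + 2 ^ (2 * \<kappa> + 3) * (X ^ (2 * \<kappa> + 2) + (E / h) ^ (2 * \<kappa> + 2))))"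
proof -
  define A where "A = E / h"
  define R where "R = X + A"
  define r where "r = 2 * \<kappa> + 2"
  have X0: "0 \<le> X" and E0: "0 \<le> E" using X E norm_ge_zero order_trans by blast+
  have A0: "0 \<le> A" and EA: "E = h * A" using h E0 by (auto simp: A_def)
  have AR: "A \<le> R" "0 \<le> R" using X0 A0 by (auto simp: R_def)
  have EleA: "E \<le> A" unfolding EA using h A0 by (intro mult_left_le_one_le) auto
  have K0: "0 \<le> K"
  proof -
    have "0 \<le> K * (1 + norm (0::'b) ^ \<kappa>)" using gr[of 0] norm_ge_zero order_trans by blast
    moreover have "0 < 1 + norm (0::'b) ^ \<kappa>" by (simp add: add_pos_nonneg)
    ultimately show ?thesis by (simp add: zero_le_mult_iff)
  qed
  have xy: "x \<in> cball 0 R" "y \<in> cball 0 R"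
  proof -
    show "x \<in> cball 0 R" using X A0 by (simp add: R_def)
    have "norm y \<le> norm x + norm (y - x)" using norm_triangle_ineq[of x "y - x"] by simp
    then show "y \<in> cball 0 R" using X E EleA by (simp add: R_def)
  qed
  have "norm (f y - f x) \<le> (K * (1 + R ^ \<kappa>)) * norm (y - x)"
  proof (rule differentiable_bound[OF convex_cball _ _ xy(2,1)])
    fix z :: 'b assume z: "z \<in> cball 0 R"
    show "(f has_derivative (\<lambda>v. f' z \<bullet> v)) (at z within cball 0 R)"
      using der[of z] unfolding gderiv_def by (auto intro: has_derivative_at_withinI simp: inner_commute)
    have "norm (f' z) \<le> K * (1 + R ^ \<kappa>)"
      using z K0 by (intro order_trans[OF gr] mult_left_mono add_left_mono power_mono) auto
    then show "onorm (\<lambda>v. f' z \<bullet> v) \<le> K * (1 + R ^ \<kappa>)"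
      by (intro onorm_le) (metis Cauchy_Schwarz_ineq2 mult_right_mono norm_ge_zero order_trans real_norm_def)
  qed
  also have "\<dots> \<le> (K * (1 + R ^ \<kappa>)) * (h * A)"
    using K0 AR E unfolding EA[symmetric] by (intro mult_left_mono) auto
  finally have "(norm (f y - f x))\<^sup>2 \<le> ((K * (1 + R ^ \<kappa>)) * (h * A))\<^sup>2" by (intro power_mono) auto
  also have "\<dots> = h\<^sup>2 * (K\<^sup>2 * ((1 + R ^ \<kappa>)\<^sup>2 * A\<^sup>2))" by (simp add: power_mult_distrib)
  also have "\<dots> \<le> h\<^sup>2 * (K\<^sup>2 * (2 * (1 + 2 ^ (r + 1) * (X ^ r + A ^ r))))"
  proof (intro mult_left_mono)
    have "(1 + R ^ \<kappa>)\<^sup>2 \<le> 2 * (1 + (R ^ \<kappa>)\<^sup>2)"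
      using zero_le_power2[of "1 - R ^ \<kappa>"] by (simp add: power2_eq_square algebra_simps)
    then have "(1 + R ^ \<kappa>)\<^sup>2 * A\<^sup>2 \<le> 2 * (1 + (R ^ \<kappa>)\<^sup>2) * A\<^sup>2" by (rule mult_right_mono) simp
    also have "\<dots> = 2 * (A\<^sup>2 + (R ^ \<kappa>)\<^sup>2 * A\<^sup>2)" by (simp add: algebra_simps)
    also have "\<dots> \<le> 2 * ((1 + R ^ r) + R ^ r)"
    proof (intro mult_left_mono add_mono)
      have A2: "A\<^sup>2 \<le> R\<^sup>2" using AR A0 by (intro power_mono) auto
      \<comment> \<open>For \<open>R\<close> below 1 the higher power may be smaller than the
        square; the summand 1 covers this case.\<close>
      also have "R\<^sup>2 \<le> 1 + R ^ r"
      proof (cases "R \<le> 1")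
        case True
        then have "R\<^sup>2 \<le> 1" using AR by (intro power_le_one) auto
        then show ?thesis using AR by (simp add: add_increasing2)
      next
        case False
        then have "R\<^sup>2 \<le> R ^ r" unfolding r_def by (intro power_increasing) auto
        then show ?thesis by simp
      qed
      finally show "A\<^sup>2 \<le> 1 + R ^ r" .
      have "(R ^ \<kappa>)\<^sup>2 * A\<^sup>2 \<le> (R ^ \<kappa>)\<^sup>2 * R\<^sup>2" by (intro mult_left_mono A2) simp
      also have "\<dots> = R ^ r" by (simp only: r_def power_add power_mult[symmetric] mult.commute)
      finally show "(R ^ \<kappa>)\<^sup>2 * A\<^sup>2 \<le> R ^ r" .
    qed auto
    also have "\<dots> = 2 * (1 + 2 * R ^ r)" by simp
    also have "\<dots> \<le> 2 * (1 + 2 * (2 ^ r * (X ^ r + A ^ r)))"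
      unfolding R_def using power_add_le[OF X0 A0, of r] by simp
    finally show "(1 + R ^ \<kappa>)\<^sup>2 * A\<^sup>2 \<le> 2 * (1 + 2 ^ (r + 1) * (X ^ r + A ^ r))" by simp
  qed auto
  finally have *: "(norm (f y - f x))\<^sup>2 \<le> h\<^sup>2 * (K\<^sup>2 * (2 * (1 + 2 ^ (r + 1) * (X ^ r + A ^ r))))" .
  have "2 * \<kappa> + 3 = r + 1" "2 * \<kappa> + 2 = r" by (simp_all add: r_def)
  with * show ?thesis by (simp only: real_norm_def power2_abs A_def[symmetric] mult_ac)
qed

subsection \<open>Monte Carlo errors\<close>

context lipschitz_sde
begin

text \<open>All constants are obtained before a scheme is fixed: moments of the initial values give
  those of the path scale, and these give the moments of the solution and of the error divided by
  \<open>h\<close>.\<close>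

lemma monte_carlo_error:
  fixes f :: "(real^'m) \<times> (real^'m) \<Rightarrow> real"
  assumes der: "\<And>x. GDERIV f x :> f' x" and gr: "\<And>x. norm (f' x) \<le> K * (1 + norm x ^ \<kappa>)"
    and mom: "integrable M (\<lambda>\<omega>. norm (p0 \<omega>, q0 \<omega>) ^ (2 * \<kappa> + 2))" and T: "T > 0"
  obtains C h' where "C > 0" "h' > 0"
    "\<And>h P Q N n m Yhat. 0 < h \<Longrightarrow> h \<le> h' \<Longrightarrow> drift_preserving_scheme M F W V' S p0 q0 h P Q \<Longrightarrow>
      h * real N = T \<Longrightarrow> n \<in> {1..N} \<Longrightarrow> m \<ge> 1 \<Longrightarrow> iid_samples M m (\<lambda>\<omega>. f (P n \<omega>, Q n \<omega>)) Yhat \<Longrightarrow>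
      l2norm M (\<lambda>\<omega>. expectation (\<lambda>\<omega>'. f (p (real n * h) \<omega>', q (real n * h) \<omega>')) - mc_estimator m Yhat \<omega>)
        \<le> ennreal (C * h) + ennreal (real m powr (-1/2)) * ennreal_sqrt (var M (\<lambda>\<omega>. f (p (real n * h) \<omega>, q (real n * h) \<omega>)))"
proof -
  define r where "r = 2 * \<kappa> + 2"
  have r: "r > 0" by (simp add: r_def)
  have T0: "0 \<le> T" using T by simp
  define m0 where "m0 = 2 ^ r * expectation (\<lambda>\<omega>. norm (p0 \<omega>, q0 \<omega>) ^ r)"
  have m0: "0 \<le> m0" by (simp add: m0_def)
  have pqm: "p0 \<in> borel_measurable M" "q0 \<in> borel_measurable M"
    using measurable_F_imp[OF order_refl p0] measurable_F_imp[OF order_refl q0] by auto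
  have "(\<integral>\<^sup>+\<omega>. ennreal ((norm (p0 \<omega>) + norm (q0 \<omega>)) ^ r) \<partial>M) \<le> (\<integral>\<^sup>+\<omega>. ennreal ((2 * norm (p0 \<omega>, q0 \<omega>)) ^ r) \<partial>M)"
  proof (intro nn_integral_mono ennreal_leI power_mono)
    fix \<omega> show "norm (p0 \<omega>) + norm (q0 \<omega>) \<le> 2 * norm (p0 \<omega>, q0 \<omega>)"
      using norm_fst_le[of "p0 \<omega>" "q0 \<omega>"] norm_snd_le[of "q0 \<omega>" "p0 \<omega>"] by simp
  qed simp
  also have "\<dots> \<le> ennreal m0"
    unfolding m0_def
  proof (rule nn_integral_power_mult)
    have "(\<lambda>\<omega>. (p0 \<omega>, q0 \<omega>)) \<in> borel_measurable M" by (intro borel_measurable_Pair pqm)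
    then show "(\<lambda>\<omega>. norm (p0 \<omega>, q0 \<omega>)) \<in> borel_measurable M" by (rule measurable_compose[OF _ borel_measurable_norm])
    show "(\<integral>\<^sup>+\<omega>. ennreal (norm (p0 \<omega>, q0 \<omega>) ^ r) \<partial>M) \<le> ennreal (expectation (\<lambda>\<omega>. norm (p0 \<omega>, q0 \<omega>) ^ r))"
      using nn_integral_eq_integral[OF mom[folded r_def]] by simp
  qed auto
  finally have m0': "(\<integral>\<^sup>+\<omega>. ennreal ((norm (p0 \<omega>) + norm (q0 \<omega>)) ^ r) \<partial>M) \<le> ennreal m0" .
  define ms where "ms = 2 ^ r * (2 ^ r * (1 + m0) + T ^ r * gauss_const r T)"
  note ms' = scale_moment[OF T0 r m0 m0', folded ms_def]
  have ms: "0 \<le> ms" using m0 T0 gauss_const_nonneg[of r T] by (simp add: ms_def)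
  define mx where "mx = 2 ^ r * (growth_bound V' L T ^ r * ms + gauss_const r T)"
  note mx' = solution_moment[OF T0 r ms ms', folded mx_def]
  have mx: "0 \<le> mx" using ms growth_bound_nonneg[OF L0 T0, of V'] gauss_const_nonneg[of r T] by (simp add: mx_def)
  define me where "me = scheme_error_const V' L T ^ r * (2 ^ r * (2 ^ r * (gauss_const r T + T ^ r * gauss_const r T)
        + 2 ^ r * (ms + T ^ r * gauss_const r T)))"
  note me' = scheme_error_moment[OF T0 r ms ms', folded me_def]
  have me: "0 \<le> me" using ms T0 scheme_error_const_nonneg[OF T0] gauss_const_nonneg[of r T] by (simp add: me_def)
  define c where "c = (2::real) ^ (2 * \<kappa> + 3)"
  have c: "0 \<le> c" by (simp add: c_def)
  define Cf where "Cf = 2 * K\<^sup>2 * (1 + c * (mx + me))"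
  have Cf: "0 \<le> Cf" using mx me c by (simp add: Cf_def)
  have fm: "f \<in> borel_measurable borel"
    using der by (intro borel_measurable_continuous_onI gderiv_imp_continuous_on) auto
  have fXm: "(\<lambda>\<omega>. f (X \<omega>, Y \<omega>)) \<in> borel_measurable M" if "X \<in> borel_measurable M" "Y \<in> borel_measurable M" for X Y
    using that by (intro measurable_compose[OF borel_measurable_Pair fm])
  \<comment> \<open>\<open>h * sqrt Cf\<close> bounds the L2 distance of the test values and is
    counted twice for the biased estimator; the added 1 secures positivity. The threshold
    \<open>1 / (L + 1)\<close> implies \<open>h \<le> 1\<close> and
    \<open>h * L \<le> 1\<close>.\<close>
  show thesis
  proof (rule that[of "2 * sqrt Cf + 1" "1 / (L + 1)"])
    show "0 < 2 * sqrt Cf + 1" using Cf by (simp add: add_nonneg_pos)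
    show "0 < 1 / (L + 1)" using L0 by simp
    fix h P Q N n m Yhat
    assume h0: "0 < h" and hh: "h \<le> 1 / (L + 1)" and sch: "drift_preserving_scheme M F W V' S p0 q0 h P Q"
      and hN: "h * real N = T" and n: "n \<in> {1..N}" and m1: "m \<ge> 1"
      and iid: "iid_samples M m (\<lambda>\<omega>. f (P n \<omega>, Q n \<omega>)) Yhat"
    have hL: "h * L + h \<le> 1" using hh L0 by (simp add: field_simps)
    have "0 \<le> h * L" using h0 L0 by simp
    with hL h0 have h: "0 < h" "h \<le> 1" "h * L \<le> 1" by auto
    define t where "t = real n * h"
    have t: "t \<in> {0..T}"
    proof -
      have "real n * h \<le> real N * h" using n h0 by (intro mult_right_mono) auto
      then show ?thesis using h0 hN by (simp add: t_def mult.commute)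
    qed
    have tn: "0 \<le> t" using t by simp
    have Pm: "P n \<in> borel_measurable M" "Q n \<in> borel_measurable M" using scheme_measurable[OF sch] h0 by auto
    have xm: "p t \<in> borel_measurable M" "q t \<in> borel_measurable M" using p_measurable[OF tn] q_measurable[OF tn] by auto
    let ?X = "\<lambda>\<omega>. norm (p t \<omega>) + norm (q t \<omega>)"
    let ?E = "\<lambda>\<omega>. norm (p t \<omega> - P n \<omega>) + norm (q t \<omega> - Q n \<omega>)"
    have Xm: "?X \<in> borel_measurable M" and Em: "?E \<in> borel_measurable M" using xm Pm by measurable
    have X1: "(\<integral>\<^sup>+\<omega>. ennreal (?X \<omega> ^ r) \<partial>M) \<le> ennreal mx" by (rule mx'[OF t])
    have E1: "(\<integral>\<^sup>+\<omega>. ennreal ((1 / h * ?E \<omega>) ^ r) \<partial>M) \<le> ennreal me"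
    proof -
      have "(\<integral>\<^sup>+\<omega>. ennreal (?E \<omega> ^ r) \<partial>M) \<le> ennreal (me * h ^ r)"
        unfolding t_def using n hN by (intro me'[OF sch h]) (auto simp: mult.commute)
      then have "(\<integral>\<^sup>+\<omega>. ennreal ((1 / h * ?E \<omega>) ^ r) \<partial>M) \<le> ennreal ((1 / h) ^ r * (me * h ^ r))"
        using h me by (intro nn_integral_power_mult[OF Em]) auto
      also have "(1 / h) ^ r * (me * h ^ r) = me" using h by (simp add: power_divide)
      finally show ?thesis .
    qed
    \<comment> \<open>The general form serves twice: for the difference of the test values, with
      prefactor \<open>h\<close> squared, and for the second moment of the exact one, with prefactor
      1.\<close>
    have moment_bound: "(\<integral>\<^sup>+\<omega>. ennreal (a * (2 * K\<^sup>2 * (1 + c * (U \<omega> ^ r + Z \<omega> ^ r)))) \<partial>M) \<le> ennreal (a * (2 * K\<^sup>2 * (1 + c * (u + z))))"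
      if a: "0 \<le> a" and Um: "U \<in> borel_measurable M" and Zm: "Z \<in> borel_measurable M" and U0: "\<And>\<omega>. 0 \<le> U \<omega>" and Z0: "\<And>\<omega>. 0 \<le> Z \<omega>"
        and U: "(\<integral>\<^sup>+\<omega>. ennreal (U \<omega> ^ r) \<partial>M) \<le> ennreal u" and Z: "(\<integral>\<^sup>+\<omega>. ennreal (Z \<omega> ^ r) \<partial>M) \<le> ennreal z"
        and uz: "0 \<le> u" "0 \<le> z" for a U Z u z
    proof -
      have b: "0 \<le> a * (2 * K\<^sup>2)" using a by simp
      have split: "ennreal (a * (2 * K\<^sup>2 * (1 + c * (v + w)))) = ennreal (a * (2 * K\<^sup>2)) * (1 + ennreal c * (ennreal v + ennreal w))"
        if "0 \<le> v" "0 \<le> w" for v w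
      proof -
        have "ennreal (a * (2 * K\<^sup>2)) * (1 + ennreal c * (ennreal v + ennreal w)) = ennreal (a * (2 * K\<^sup>2)) * ennreal (1 + c * (v + w))"
          using c that by (simp add: ennreal_mult ennreal_plus)
        also have "\<dots> = ennreal (a * (2 * K\<^sup>2) * (1 + c * (v + w)))" using b c that by (simp add: ennreal_mult)
        finally show ?thesis by (simp only: mult.assoc)
      qed
      have "(\<integral>\<^sup>+\<omega>. ennreal (a * (2 * K\<^sup>2 * (1 + c * (U \<omega> ^ r + Z \<omega> ^ r)))) \<partial>M)
        = (\<integral>\<^sup>+\<omega>. ennreal (a * (2 * K\<^sup>2)) * (1 + ennreal c * (ennreal (U \<omega> ^ r) + ennreal (Z \<omega> ^ r))) \<partial>M)"
        using U0 Z0 by (simp only: split zero_le_power)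
      also have "\<dots> = ennreal (a * (2 * K\<^sup>2)) * (1 + ennreal c * ((\<integral>\<^sup>+\<omega>. ennreal (U \<omega> ^ r) \<partial>M) + (\<integral>\<^sup>+\<omega>. ennreal (Z \<omega> ^ r) \<partial>M)))"
        using Um Zm by (simp add: nn_integral_cmult nn_integral_add emeasure_space_1)
      also have "\<dots> \<le> ennreal (a * (2 * K\<^sup>2)) * (1 + ennreal c * (ennreal u + ennreal z))"
        by (intro mult_left_mono add_left_mono add_mono U Z) auto
      also have "\<dots> = ennreal (a * (2 * K\<^sup>2 * (1 + c * (u + z))))" by (rule split[OF uz, symmetric])
      finally show ?thesis .
    qed
    have diff: "(\<integral>\<^sup>+\<omega>. ennreal ((f (P n \<omega>, Q n \<omega>) - f (p t \<omega>, q t \<omega>))\<^sup>2) \<partial>M) \<le> ennreal ((h * sqrt Cf)\<^sup>2)"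
    proof -
      have "(\<integral>\<^sup>+\<omega>. ennreal ((f (P n \<omega>, Q n \<omega>) - f (p t \<omega>, q t \<omega>))\<^sup>2) \<partial>M)
        \<le> (\<integral>\<^sup>+\<omega>. ennreal (h\<^sup>2 * (2 * K\<^sup>2 * (1 + c * (?X \<omega> ^ r + (1 / h * ?E \<omega>) ^ r)))) \<partial>M)"
      proof (intro nn_integral_mono ennreal_leI)
        fix \<omega>
        have "norm ((P n \<omega>, Q n \<omega>) - (p t \<omega>, q t \<omega>)) \<le> ?E \<omega>"
          using norm_Pair_le[of "P n \<omega> - p t \<omega>" "Q n \<omega> - q t \<omega>"] by (simp add: norm_minus_commute)
        from test_function_difference[OF der gr h(1,2) norm_Pair_le this]
        show "(f (P n \<omega>, Q n \<omega>) - f (p t \<omega>, q t \<omega>))\<^sup>2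
          \<le> h\<^sup>2 * (2 * K\<^sup>2 * (1 + c * (?X \<omega> ^ r + (1 / h * ?E \<omega>) ^ r)))"
          by (simp add: c_def r_def)
      qed
      also have "\<dots> \<le> ennreal (h\<^sup>2 * (2 * K\<^sup>2 * (1 + c * (mx + me))))"
        using Em h(1) by (intro moment_bound Xm X1 E1 mx me) auto
      also have "h\<^sup>2 * (2 * K\<^sup>2 * (1 + c * (mx + me))) = (h * sqrt Cf)\<^sup>2"
        using Cf by (simp add: Cf_def power_mult_distrib)
      finally show ?thesis .
    qed
    have fin: "(\<integral>\<^sup>+\<omega>. ennreal ((f (p t \<omega>, q t \<omega>))\<^sup>2) \<partial>M) < \<infinity>"
    proof -
      have "(\<integral>\<^sup>+\<omega>. ennreal ((f (p t \<omega>, q t \<omega>))\<^sup>2) \<partial>M)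
        \<le> (\<integral>\<^sup>+\<omega>. 2 * ennreal (1 * (2 * K\<^sup>2 * (1 + c * (0 ^ r + ?X \<omega> ^ r)))) + 2 * ennreal ((f 0)\<^sup>2) \<partial>M)"
      proof (intro nn_integral_mono)
        fix \<omega>
        \<comment> \<open>Growth of \<open>f\<close> itself comes from the same difference estimate,
          with base point 0 and 1 in place of the step size.\<close>
        have "norm ((p t \<omega>, q t \<omega>) - 0) \<le> ?X \<omega>" using norm_Pair_le by simp
        from test_function_difference[OF der gr zero_less_one order_refl _ this, of 0]
        have "ennreal ((f (p t \<omega>, q t \<omega>) - f 0)\<^sup>2) \<le> ennreal (1 * (2 * K\<^sup>2 * (1 + c * (0 ^ r + ?X \<omega> ^ r))))"
          by (intro ennreal_leI) (simp add: c_def r_def)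
        then have "2 * ennreal ((f (p t \<omega>, q t \<omega>) - f 0)\<^sup>2) + 2 * ennreal ((f 0)\<^sup>2)
          \<le> 2 * ennreal (1 * (2 * K\<^sup>2 * (1 + c * (0 ^ r + ?X \<omega> ^ r)))) + 2 * ennreal ((f 0)\<^sup>2)"
          by (intro add_right_mono mult_left_mono) auto
        then show "ennreal ((f (p t \<omega>, q t \<omega>))\<^sup>2)
          \<le> 2 * ennreal (1 * (2 * K\<^sup>2 * (1 + c * (0 ^ r + ?X \<omega> ^ r)))) + 2 * ennreal ((f 0)\<^sup>2)"
          using ennreal_power2_add_le[of "f (p t \<omega>, q t \<omega>) - f 0" "f 0"] by (simp only: diff_add_cancel order_trans)
      qed
      also have "\<dots> = 2 * (\<integral>\<^sup>+\<omega>. ennreal (1 * (2 * K\<^sup>2 * (1 + c * (0 ^ r + ?X \<omega> ^ r)))) \<partial>M) + 2 * ennreal ((f 0)\<^sup>2)"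
        using Xm by (simp add: nn_integral_cmult nn_integral_add emeasure_space_1)
      also have "\<dots> \<le> 2 * ennreal (1 * (2 * K\<^sup>2 * (1 + c * (0 + mx)))) + 2 * ennreal ((f 0)\<^sup>2)"
        using r by (intro add_right_mono mult_left_mono moment_bound Xm X1 mx) (auto simp: zero_power)
      also have "\<dots> < \<infinity>" by (simp add: ennreal_mult_less_top)
      finally show ?thesis .
    qed
    have D0: "0 \<le> h * sqrt Cf" using h Cf by simp
    have "l2norm M (\<lambda>\<omega>. expectation (\<lambda>\<omega>'. f (p t \<omega>', q t \<omega>')) - mc_estimator m Yhat \<omega>)
        \<le> ennreal (2 * (h * sqrt Cf)) + ennreal (real m powr (-1/2)) * ennreal_sqrt (var M (\<lambda>\<omega>. f (p t \<omega>, q t \<omega>)))"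
      by (rule mc_estimator_biased_l2_error[OF m1 iid fXm[OF Pm] fXm[OF xm] fin D0 diff])
    also have "\<dots> \<le> ennreal ((2 * sqrt Cf + 1) * h) + ennreal (real m powr (-1/2)) * ennreal_sqrt (var M (\<lambda>\<omega>. f (p t \<omega>, q t \<omega>)))"
      using h(1) by (intro add_right_mono ennreal_leI) (simp add: algebra_simps)
    finally show "l2norm M (\<lambda>\<omega>. expectation (\<lambda>\<omega>'. f (p (real n * h) \<omega>', q (real n * h) \<omega>')) - mc_estimator m Yhat \<omega>)
        \<le> ennreal ((2 * sqrt Cf + 1) * h) + ennreal (real m powr (-1/2)) * ennreal_sqrt (var M (\<lambda>\<omega>. f (p (real n * h) \<omega>, q (real n * h) \<omega>)))"
      by (simp only: t_def)
  qed
qed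

end

lemma balanced_work:
  "mc_work h (balanced_samples h) = h powi (-1) * balanced_samples h"
  "h > 0 \<Longrightarrow> h powi (-1) * balanced_samples h = h powi (-3)"
proof -
  show "mc_work h (balanced_samples h) = h powi (-1) * balanced_samples h"
    by (simp add: mc_work_def path_cost_def)
  show "h > 0 \<Longrightarrow> h powi (-1) * balanced_samples h = h powi (-3)"
    using power_int_add[of h "-1" "-2"] by (simp add: balanced_samples_def)
qed

text \<open>The alternative in the first part supplies the integrability behind the two mean energy
  identities; for a non-integrable energy the Bochner integral would be 0 by convention. In the
  second part \<open>C\<close> and \<open>h'\<close> are chosen before the scheme, the grid and the
  samples, so the estimate is uniform in all of these.\<close>

theorem lemma8:
  fixes Om :: "'a measure" and F :: "real \<Rightarrow> 'a measure"
    and W :: "real \<Rightarrow> 'a \<Rightarrow> real^'d"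
    and V :: "real^'m \<Rightarrow> real" and V' :: "real^'m \<Rightarrow> real^'m"
    and \<Sigma> :: "real^'d^'m"
    and p0 q0 :: "'a \<Rightarrow> real^'m" and p q :: "real \<Rightarrow> 'a \<Rightarrow> real^'m"
  assumes "prob_space Om"
    and "normal_filtration Om F"
    and "brownian_motion Om F W"
    and "\<And>x. GDERIV V x :> V' x"
    and "continuous_on UNIV V'"
    and "p0 \<in> borel_measurable (F 0)"
    and "q0 \<in> borel_measurable (F 0)"
    and "integrable Om (\<lambda>\<omega>. hamiltonian V (p0 \<omega>) (q0 \<omega>))"
    and "sde_solution Om F W V' \<Sigma> p0 q0 p q"
  shows
    "(\<forall>h>0. \<forall>P Q. drift_preserving_scheme Om F W V' \<Sigma> p0 q0 h P Q \<longrightarrow>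
       (\<exists>c. \<forall>x. c \<le> V x) \<or>
       ((\<forall>t\<ge>0. (\<integral>\<^sup>+s\<in>{0..t}. (\<integral>\<^sup>+\<omega>. ennreal ((norm (p s \<omega>))\<^sup>2) \<partial>Om) \<partial>lborel) < \<infinity>) \<and>
        (\<forall>n. integrable Om (\<lambda>\<omega>. hamiltonian V (P n \<omega>) (Q n \<omega>)))) \<longrightarrow>
       (\<forall>n M Yhat. M \<ge> 1 \<longrightarrow> iid_samples Om M (\<lambda>\<omega>. hamiltonian V (P n \<omega>) (Q n \<omega>)) Yhat \<longrightarrow>
          l2norm Om (\<lambda>\<omega>. (\<integral>\<omega>'. hamiltonian V (p (real n * h) \<omega>') (q (real n * h) \<omega>') \<partial>Om)
                          - mc_estimator M Yhat \<omega>)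
            = ennreal (real M powr (-1/2)) *
                ennreal_sqrt (var Om (\<lambda>\<omega>. hamiltonian V (P n \<omega>) (Q n \<omega>))) \<and>
          ennreal (real M powr (-1/2)) *
                ennreal_sqrt (var Om (\<lambda>\<omega>. hamiltonian V (P n \<omega>) (Q n \<omega>)))
            \<le> ennreal (real M powr (-1/2)) * l2norm Om (\<lambda>\<omega>. hamiltonian V (P n \<omega>) (Q n \<omega>)))) \<and>
     ((\<exists>L. L-lipschitz_on UNIV V') \<longrightarrow>
     (\<forall>(f :: (real^'m) \<times> (real^'m) \<Rightarrow> real) f' (K::real) (\<kappa>::nat) (T::real).
        (\<forall>x. GDERIV f x :> f' x) \<longrightarrow> (\<forall>x. norm (f' x) \<le> K * (1 + norm x ^ \<kappa>)) \<longrightarrow>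
        integrable Om (\<lambda>\<omega>. norm (p0 \<omega>, q0 \<omega>) ^ (2 * \<kappa> + 2)) \<longrightarrow> T > 0 \<longrightarrow>
        (\<exists>C>0. \<exists>h'>0. \<forall>h. 0 < h \<longrightarrow> h \<le> h' \<longrightarrow>
           (\<forall>P Q N n M Yhat.
              drift_preserving_scheme Om F W V' \<Sigma> p0 q0 h P Q \<longrightarrow>
              h * real N = T \<longrightarrow> n \<in> {1..N} \<longrightarrow> M \<ge> 1 \<longrightarrow>
              iid_samples Om M (\<lambda>\<omega>. f (P n \<omega>, Q n \<omega>)) Yhat \<longrightarrow>
              l2norm Om (\<lambda>\<omega>. (\<integral>\<omega>'. f (p (real n * h) \<omega>', q (real n * h) \<omega>') \<partial>Om)
                              - mc_estimator M Yhat \<omega>)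
                \<le> ennreal (C * h) + ennreal (real M powr (-1/2)) *
                    ennreal_sqrt (var Om (\<lambda>\<omega>. f (p (real n * h) \<omega>, q (real n * h) \<omega>))) \<and>
              ennreal (C * h) + ennreal (real M powr (-1/2)) *
                    ennreal_sqrt (var Om (\<lambda>\<omega>. f (p (real n * h) \<omega>, q (real n * h) \<omega>)))
                \<le> ennreal (C * h) + ennreal (real M powr (-1/2)) *
                    l2norm Om (\<lambda>\<omega>. f (p (real n * h) \<omega>, q (real n * h) \<omega>))) \<and>
           mc_work h (balanced_samples h) = h powi (-1) * balanced_samples h \<and>
           h powi (-1) * balanced_samples h = h powi (-3))))"
proof -
  interpret hamiltonian_sde Om F W V V' \<Sigma> p0 q0 p q
    by (intro hamiltonian_sde.intro brownian.intro brownian_axioms.intro hamiltonian_sde_axioms.intro assms)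
  show ?thesis
  proof (intro conjI allI impI)
    fix h P Q n m Yhat
    assume h: "h > 0" and sch: "drift_preserving_scheme Om F W V' \<Sigma> p0 q0 h P Q"
      and hyp: "(\<exists>c. \<forall>x. c \<le> V x) \<or>
       ((\<forall>t\<ge>0. (\<integral>\<^sup>+s\<in>{0..t}. (\<integral>\<^sup>+\<omega>. ennreal ((norm (p s \<omega>))\<^sup>2) \<partial>Om) \<partial>lborel) < \<infinity>) \<and>
        (\<forall>n. integrable Om (\<lambda>\<omega>. hamiltonian V (P n \<omega>) (Q n \<omega>))))"
      and m: "m \<ge> 1" and iid: "iid_samples Om m (\<lambda>\<omega>. hamiltonian V (P n \<omega>) (Q n \<omega>)) Yhat"
    show "l2norm Om (\<lambda>\<omega>. (\<integral>\<omega>'. hamiltonian V (p (real n * h) \<omega>') (q (real n * h) \<omega>') \<partial>Om) - mc_estimator m Yhat \<omega>)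
      = ennreal (real m powr (-1/2)) * ennreal_sqrt (var Om (\<lambda>\<omega>. hamiltonian V (P n \<omega>) (Q n \<omega>)))"
      by (rule energy_monte_carlo_error[OF sch h assms(8) hyp m iid])
    show "ennreal (real m powr (-1/2)) * ennreal_sqrt (var Om (\<lambda>\<omega>. hamiltonian V (P n \<omega>) (Q n \<omega>)))
      \<le> ennreal (real m powr (-1/2)) * l2norm Om (\<lambda>\<omega>. hamiltonian V (P n \<omega>) (Q n \<omega>))"
      using h by (intro mult_left_mono var_le_second_moment hamiltonian_measurable scheme_measurable[OF sch]) auto
  next
    fix f :: "(real^'m) \<times> (real^'m) \<Rightarrow> real" and f' and K :: real and \<kappa> :: nat and T :: real
    assume lip: "\<exists>L. L-lipschitz_on UNIV V'" and der: "\<forall>x. GDERIV f x :> f' x"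
      and gr: "\<forall>x. norm (f' x) \<le> K * (1 + norm x ^ \<kappa>)"
      and mom: "integrable Om (\<lambda>\<omega>. norm (p0 \<omega>, q0 \<omega>) ^ (2 * \<kappa> + 2))" and T: "T > 0"
    obtain L where L: "L-lipschitz_on UNIV V'" using lip by blast
    interpret lipschitz_sde Om F W V V' \<Sigma> p0 q0 p q L
      by unfold_locales (rule L)
    obtain C h' where C: "C > 0" "h' > 0" and err: "\<And>h P Q N n m Yhat. 0 < h \<Longrightarrow> h \<le> h' \<Longrightarrow> drift_preserving_scheme Om F W V' \<Sigma> p0 q0 h P Q \<Longrightarrow>
      h * real N = T \<Longrightarrow> n \<in> {1..N} \<Longrightarrow> m \<ge> 1 \<Longrightarrow> iid_samples Om m (\<lambda>\<omega>. f (P n \<omega>, Q n \<omega>)) Yhat \<Longrightarrow>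
      l2norm Om (\<lambda>\<omega>. expectation (\<lambda>\<omega>'. f (p (real n * h) \<omega>', q (real n * h) \<omega>')) - mc_estimator m Yhat \<omega>)
        \<le> ennreal (C * h) + ennreal (real m powr (-1/2)) * ennreal_sqrt (var Om (\<lambda>\<omega>. f (p (real n * h) \<omega>, q (real n * h) \<omega>)))"
      using monte_carlo_error[OF spec[OF der] spec[OF gr] mom T] by blast
    have fm: "f \<in> borel_measurable borel"
      using der by (intro borel_measurable_continuous_onI gderiv_imp_continuous_on) auto
    have sd: "ennreal_sqrt (var Om (\<lambda>\<omega>. f (p t \<omega>, q t \<omega>))) \<le> l2norm Om (\<lambda>\<omega>. f (p t \<omega>, q t \<omega>))" if "0 \<le> t" for t
      using that by (intro var_le_second_moment measurable_compose[OF borel_measurable_Pair fm] p_measurable q_measurable)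
    show "\<exists>C>0. \<exists>h'>0. \<forall>h. 0 < h \<longrightarrow> h \<le> h' \<longrightarrow>
           (\<forall>P Q N n M Yhat.
              drift_preserving_scheme Om F W V' \<Sigma> p0 q0 h P Q \<longrightarrow>
              h * real N = T \<longrightarrow> n \<in> {1..N} \<longrightarrow> M \<ge> 1 \<longrightarrow>
              iid_samples Om M (\<lambda>\<omega>. f (P n \<omega>, Q n \<omega>)) Yhat \<longrightarrow>
              l2norm Om (\<lambda>\<omega>. (\<integral>\<omega>'. f (p (real n * h) \<omega>', q (real n * h) \<omega>') \<partial>Om)
                              - mc_estimator M Yhat \<omega>)
                \<le> ennreal (C * h) + ennreal (real M powr (-1/2)) *
                    ennreal_sqrt (var Om (\<lambda>\<omega>. f (p (real n * h) \<omega>, q (real n * h) \<omega>))) \<and>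
              ennreal (C * h) + ennreal (real M powr (-1/2)) *
                    ennreal_sqrt (var Om (\<lambda>\<omega>. f (p (real n * h) \<omega>, q (real n * h) \<omega>)))
                \<le> ennreal (C * h) + ennreal (real M powr (-1/2)) *
                    l2norm Om (\<lambda>\<omega>. f (p (real n * h) \<omega>, q (real n * h) \<omega>))) \<and>
           mc_work h (balanced_samples h) = h powi (-1) * balanced_samples h \<and>
           h powi (-1) * balanced_samples h = h powi (-3)"
    proof (rule exI[of _ C], rule conjI[OF C(1)], rule exI[of _ h'], rule conjI[OF C(2)],
        intro conjI allI impI balanced_work)
      fix h P Q N n m Yhat
      assume h: "0 < h" "h \<le> h'" and sch: "drift_preserving_scheme Om F W V' \<Sigma> p0 q0 h P Q"
        and "h * real N = T" "n \<in> {1..N}" "m \<ge> 1" "iid_samples Om m (\<lambda>\<omega>. f (P n \<omega>, Q n \<omega>)) Yhat"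
      then show "l2norm Om (\<lambda>\<omega>. (\<integral>\<omega>'. f (p (real n * h) \<omega>', q (real n * h) \<omega>') \<partial>Om) - mc_estimator m Yhat \<omega>)
        \<le> ennreal (C * h) + ennreal (real m powr (-1/2)) * ennreal_sqrt (var Om (\<lambda>\<omega>. f (p (real n * h) \<omega>, q (real n * h) \<omega>)))"
        by (rule err)
      show "ennreal (C * h) + ennreal (real m powr (-1/2)) * ennreal_sqrt (var Om (\<lambda>\<omega>. f (p (real n * h) \<omega>, q (real n * h) \<omega>)))
        \<le> ennreal (C * h) + ennreal (real m powr (-1/2)) * l2norm Om (\<lambda>\<omega>. f (p (real n * h) \<omega>, q (real n * h) \<omega>))"
        using h by (intro add_left_mono mult_left_mono sd) auto
    qed
  qed
qed

end
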